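(* Let $\{\mathcal T_h\}_{h\in(0,h_0)}$ be conforming triangulations of $\Omega$. Suppose that there is a constant $C_L>0$ and a sequence $h_k\to0$ such that each $\mathcal T_{h_k}$ contains a regular band $\mathcal B_k$ with base length $h_k$, height $\bar h_k$ and length $L_k$, where $$L_k\ge C_L,\qquad \bar h_k=o(h_k^4)\quad (k\to\infty).$$ Then the finite element method does not converge in $H^1(\Omega)$ on $\{\mathcal T_h\}_{h\in(0,h_0)}$ for general $u$, i.e. it is not true that $|u-U|_{H^1(\Omega)}\to0$ as $h\to0$ for every $u\in H^2(\Omega)$.
   Context: $\Omega\subset\mathbb R^2$ is a bounded polygonal domain with Lipschitz boundary; $h$ is the maximal diameter of elements of $\mathcal T_h$; $X_h\subset H^1(\Omega)$ is the space of globally continuous functions that are linear on every $K\in\mathcal T_h$. The discrete solution $U\in X_h$ associated with $u$ is the piecewise linear conforming finite element solution of Poisson's problem with exact solution $u$, with Dirichlet data imposed by piecewise linear Lagrange interpolation of $u$ on $\partial\Omega$. Regular band with base length $h$, height $\bar h$ and length $L=(N+1)h$, $N\ge1$: a union of elements $K_0,\dots,K_N,\tilde K_1,\dots,\tilde K_N$ of $\mathcal T_h$, all congruent isosceles triangles with base (longest edge) of length $h$ and height $\bar h$, arranged as follows: there are equidistant points $P_0,\dots,P_{N+1}$ on a line with spacing $h$ and equidistant points $Q_0,\dots,Q_N$ with spacing $h$ on a parallel line at distance $\bar h$, such that $K_i$ is the triangle $P_iP_{i+1}Q_i$ with base $P_iP_{i+1}$ and $\tilde K_i$ is the triangle $Q_{i-1}Q_iP_i$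 with base $Q_{i-1}Q_i$. *)

theory Defs
  imports "HOL-Analysis.Analysis" "HOL-Library.Landau_Symbols"
begin

section \<open>Domains\<close>

definition lipschitz_boundary :: "(real^2) set \<Rightarrow> bool" where
  "lipschitz_boundary \<Omega> \<longleftrightarrow>
     (\<forall>x\<in>frontier \<Omega>. \<exists>r>0. \<exists>R g M. orthogonal_transformation (R :: real^2 \<Rightarrow> real^2) \<and>
        M-lipschitz_on UNIV (g :: real \<Rightarrow> real) \<and>
        \<Omega> \<inter> ball x r = {y \<in> ball x r. g (R y $ 1) < R y $ 2})"

definition polygonal_domain :: "(real^2) set \<Rightarrow> bool" where
  "polygonal_domain \<Omega> \<longleftrightarrow>
     open \<Omega> \<and> connected \<Omega> \<and> \<Omega> \<noteq> {} \<and> bounded \<Omega> \<and>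
     (\<exists>S. finite S \<and> frontier \<Omega> = (\<Union>(a, b)\<in>S. closed_segment a b))"


section \<open>Sobolev spaces\<close>

definition partial :: "2 \<Rightarrow> (real^2 \<Rightarrow> real) \<Rightarrow> real^2 \<Rightarrow> real" where
  "partial i f x = frechet_derivative f (at x) (axis i 1)"

definition smooth :: "(real^2 \<Rightarrow> real) \<Rightarrow> bool" where
  "smooth f \<longleftrightarrow> (\<forall>is. foldr partial is f differentiable_on UNIV)"

definition test_functions :: "(real^2) set \<Rightarrow> (real^2 \<Rightarrow> real) set" where
  "test_functions \<Omega> =
     {\<phi>. smooth \<phi> \<and> compact (closure {x. \<phi> x \<noteq> 0}) \<and> closure {x. \<phi> x \<noteq> 0} \<subseteq> \<Omega>}"

definition L2 :: "(real^2) set \<Rightarrow> (real^2 \<Rightarrow> real) set" where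
  "L2 \<Omega> = {f \<in> borel_measurable (lebesgue_on \<Omega>). integrable (lebesgue_on \<Omega>) (\<lambda>x. (f x)\<^sup>2)}"

definition is_weak_partial :: "(real^2) set \<Rightarrow> 2 \<Rightarrow> (real^2 \<Rightarrow> real) \<Rightarrow> (real^2 \<Rightarrow> real) \<Rightarrow> bool" where
  "is_weak_partial \<Omega> i u g \<longleftrightarrow> g \<in> L2 \<Omega> \<and>
     (\<forall>\<phi>\<in>test_functions \<Omega>.
        (LINT x|lebesgue_on \<Omega>. u x * partial i \<phi> x) = - (LINT x|lebesgue_on \<Omega>. g x * \<phi> x))"

text \<open>The weak partial derivative is determined almost everywhere on \<open>\<Omega>\<close>; all uses below
  are insensitive to the choice of representative.\<close>

definition weak_partial :: "(real^2) set \<Rightarrow> 2 \<Rightarrow> (real^2 \<Rightarrow> real) \<Rightarrow> real^2 \<Rightarrow> real" where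
  "weak_partial \<Omega> i u = (SOME g. is_weak_partial \<Omega> i u g)"

definition H1 :: "(real^2) set \<Rightarrow> (real^2 \<Rightarrow> real) set" where
  "H1 \<Omega> = {u \<in> L2 \<Omega>. \<forall>i. \<exists>g. is_weak_partial \<Omega> i u g}"

definition H2 :: "(real^2) set \<Rightarrow> (real^2 \<Rightarrow> real) set" where
  "H2 \<Omega> = {u \<in> H1 \<Omega>. \<forall>i. weak_partial \<Omega> i u \<in> H1 \<Omega>}"

definition H1_seminorm :: "(real^2) set \<Rightarrow> (real^2 \<Rightarrow> real) \<Rightarrow> real" where
  "H1_seminorm \<Omega> u = sqrt (LINT x|lebesgue_on \<Omega>. (\<Sum>i\<in>UNIV. (weak_partial \<Omega> i u x)\<^sup>2))"

definition dirichlet_form :: "(real^2) set \<Rightarrow> (real^2 \<Rightarrow> real) \<Rightarrow> (real^2 \<Rightarrow> real) \<Rightarrow> real" where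
  "dirichlet_form \<Omega> u v =
     (LINT x|lebesgue_on \<Omega>. (\<Sum>i\<in>UNIV. weak_partial \<Omega> i u x * weak_partial \<Omega> i v x))"

definition weak_laplacian :: "(real^2) set \<Rightarrow> (real^2 \<Rightarrow> real) \<Rightarrow> real^2 \<Rightarrow> real" where
  "weak_laplacian \<Omega> u x = (\<Sum>i\<in>UNIV. weak_partial \<Omega> i (weak_partial \<Omega> i u) x)"


section \<open>Triangulations and finite elements\<close>

definition conforming_triangulation :: "(real^2) set \<Rightarrow> (real^2) set set \<Rightarrow> bool" where
  "conforming_triangulation \<Omega> \<T> \<longleftrightarrow>
     triangulation \<T> \<and> (\<forall>K\<in>\<T>. 2 simplex K) \<and> \<Union>\<T> = closure \<Omega>"

text \<open>Elements of \<open>fe_space\<close> are functions on the whole plane of which only the values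
  on \<open>closure \<Omega> = \<Union>\<T>\<close> matter.\<close>

definition fe_space :: "(real^2) set set \<Rightarrow> (real^2 \<Rightarrow> real) set" where
  "fe_space \<T> = {v. continuous_on (\<Union>\<T>) v \<and> (\<forall>K\<in>\<T>. \<exists>a b. \<forall>x\<in>K. v x = a \<bullet> x + b)}"

definition lagrange_interpolant ::
    "(real^2) set set \<Rightarrow> (real^2 \<Rightarrow> real) \<Rightarrow> (real^2 \<Rightarrow> real) \<Rightarrow> bool" where
  "lagrange_interpolant \<T> w I \<longleftrightarrow>
     I \<in> fe_space \<T> \<and> (\<forall>K\<in>\<T>. \<forall>x. x extreme_point_of K \<longrightarrow> I x = w x)"

text \<open>Point values of an \<open>H\<^sup>2\<close> function are those of its continuous representative \<open>w\<close>.
  The right-hand side of Poisson's problem with exact solution \<open>u\<close> is \<open>- \<Delta>u\<close>.\<close>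

definition fe_solution ::
    "(real^2) set \<Rightarrow> (real^2) set set \<Rightarrow> (real^2 \<Rightarrow> real) \<Rightarrow> (real^2 \<Rightarrow> real) \<Rightarrow> bool" where
  "fe_solution \<Omega> \<T> u U \<longleftrightarrow>
     U \<in> fe_space \<T> \<and>
     (\<exists>w I. continuous_on (closure \<Omega>) w \<and> (AE x in lebesgue_on \<Omega>. w x = u x) \<and>
        lagrange_interpolant \<T> w I \<and> (\<forall>x\<in>frontier \<Omega>. U x = I x)) \<and>
     (\<forall>v\<in>fe_space \<T>. (\<forall>x\<in>frontier \<Omega>. v x = 0) \<longrightarrow>
        dirichlet_form \<Omega> U v = (LINT x|lebesgue_on \<Omega>. - weak_laplacian \<Omega> u x * v x))"


section \<open>Regular bands\<close>

definition isosceles_longest_base :: "real^2 \<Rightarrow> real^2 \<Rightarrow> real^2 \<Rightarrow> bool" where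
  "isosceles_longest_base a b c \<longleftrightarrow> dist a c = dist b c \<and> dist a c \<le> dist a b"

text \<open>All triangles below have base length \<open>h\<close> and height \<open>hbar\<close>,
  so being isosceles they are congruent.\<close>

definition regular_band ::
    "(real^2) set set \<Rightarrow> real \<Rightarrow> real \<Rightarrow> real \<Rightarrow> (real^2) set \<Rightarrow> bool" where
  "regular_band \<T> h hbar L B \<longleftrightarrow>
     0 < h \<and> 0 < hbar \<and>
     (\<exists>(N::nat) P Q e. 1 \<le> N \<and> L = (real N + 1) * h \<and> norm e = 1 \<and>
        (\<forall>i\<le>N+1. P i = P 0 + (real i * h) *\<^sub>R e) \<and>
        (\<forall>i\<le>N. Q i = Q 0 + (real i * h) *\<^sub>R e) \<and>
        setdist (range (\<lambda>t. P 0 + t *\<^sub>R e)) (range (\<lambda>t. Q 0 + t *\<^sub>R e)) = hbar \<and>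
        (\<forall>i\<le>N. isosceles_longest_base (P i) (P (i+1)) (Q i) \<and>
           convex hull {P i, P (i+1), Q i} \<in> \<T>) \<and>
        (\<forall>i\<in>{1..N}. isosceles_longest_base (Q (i-1)) (Q i) (P i) \<and>
           convex hull {Q (i-1), Q i, P i} \<in> \<T>) \<and>
        B = (\<Union>i\<le>N. convex hull {P i, P (i+1), Q i}) \<union>
            (\<Union>i\<in>{1..N}. convex hull {Q (i-1), Q i, P i}))"

end

theory Submission
  imports Defs "HOL-Computational_Algebra.Polynomial"
begin

text \<open>
  Take \<open>u x = (x \<bullet> x) / 2\<close>. In a regular band the gradients of \<open>U\<close> on neighbouring elements differ by a
  vector orthogonal to the shared edge, so a jump of the derivative along the band is \<open>2 hbar / h\<close> times
  a jump of the derivative across it. The latter is controlled by the error in \<open>H\<^sup>1\<close>, and summing over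
  the band shows that for \<open>hbar = o(h\<^sup>4)\<close> the function \<open>U\<close> is nearly affine on the edge of the band,
  however large the (bounded) error is. But \<open>u\<close> has second differences \<open>\<tau>\<^sup>2\<close> on that edge. Second
  differences on a segment are bounded by the \<open>L\<^sup>1\<close> norm of the gradient on a parallelogram attached to
  the segment, by moving along its sides; since \<open>\<Omega>\<close> has a Lipschitz boundary and the
  edges have length at least \<open>C\<^sub>L\<close>, parallelograms of a fixed size fit into the closure of \<open>\<Omega>\<close> for a
  subsequence of the bands. Hence the error does not tend to 0.
\<close>

subsection \<open>Smooth bump functions\<close>

text \<open>The exponent 4 comes from a count. A band has about L / h elements of area h * hbar / 2,
  so by Cauchy-Schwarz the squared sum of the normal errors is, up to a term of higher order in
  hbar, at most a multiple of (L / h) * E / (h * hbar), where E is the squared error. The factor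
  hbar / h of the jumps, squared, turns this into L * E * hbar / h^4. Second differences are used
  because the slope of U along the edge is unknown: they annihilate every affine function. Three
  matters shape the rest. The seminorm is built on \<open>weak_partial\<close>, a mere choice, so
  weak gradients must be identified almost everywhere before anything can be computed; the bump
  functions and the fundamental lemma serve this. The denied statement quantifies over families of
  solutions and would hold vacuously if there were none, so existence is proved. Finally the bands
  may run along the frontier in varying directions, so the parallelograms are obtained from a limit
  segment by compactness.\<close>

definition partial_closed :: "(real^2 \<Rightarrow> real) set \<Rightarrow> bool" where
  "partial_closed F \<longleftrightarrow> (\<forall>f\<in>F. f differentiable_on UNIV \<and> (\<forall>i. partial i f \<in> F))"

lemma partial_closed_foldr: "partial_closed F \<Longrightarrow> f \<in> F \<Longrightarrow> foldr partial is f \<in> F"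
  by (induction "is") (auto simp: partial_closed_def)

text \<open>\<open>smooth\<close> speaks of all iterated partials at once. Membership in a family
  that differentiation does not leave serves as an invariant, so that no iterated partial has to be
  computed.\<close>

lemma partial_closed_smooth: "partial_closed F \<Longrightarrow> f \<in> F \<Longrightarrow> smooth f"
  using partial_closed_foldr unfolding partial_closed_def smooth_def by blast

lemma smooth_family: "smooth f \<Longrightarrow> partial_closed {foldr partial is f | is. True}"
  unfolding partial_closed_def smooth_def
  by (auto, metis foldr.simps(2) o_apply)

lemma differentiable_on_UNIV_at:
  "f differentiable_on UNIV \<Longrightarrow> (f has_derivative frechet_derivative f (at x)) (at x)"
  by (simp add: differentiable_on_def frechet_derivative_works)

lemma partial_has_derivative:
  assumes "(f has_derivative D) (at x)" shows "partial i f x = D (axis i 1)"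
  using frechet_derivative_at[OF assms] by (simp add: partial_def)

lemma smooth_mult:
  assumes f: "smooth f" and g: "smooth g"
  shows "smooth (\<lambda>x. f x * g x)"
proof -
  define F where "F = {foldr partial is f | is. True}"
  define G where "G = {foldr partial is g | is. True}"
  have F: "partial_closed F" and G: "partial_closed G"
    using smooth_family f g by (auto simp: F_def G_def)
  \<comment> \<open>Lists of pairs stand for finite sums of products of iterated partials of f and
    g. \<open>S\<close> evaluates such a list and \<open>D i\<close> is the Leibniz rule on it, so
    these sums form the closed family.\<close>
  define S where "S = (\<lambda>(xs :: ((real^2 \<Rightarrow> real) \<times> (real^2 \<Rightarrow> real)) list) x. \<Sum>(p, q)\<leftarrow>xs. p x * q x)"
  define D where "D = (\<lambda>i (xs :: ((real^2 \<Rightarrow> real) \<times> (real^2 \<Rightarrow> real)) list).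
      concat (map (\<lambda>(p, q). [(partial i p, q), (p, partial i q)]) xs))"
  have D_in: "set (D i xs) \<subseteq> F \<times> G" if "set xs \<subseteq> F \<times> G" for i xs
    using that F G by (auto simp: D_def partial_closed_def)
  have der: "\<exists>L. (S xs has_derivative L) (at x) \<and> (\<forall>i. L (axis i 1) = S (D i xs) x)"
    if "set xs \<subseteq> F \<times> G" for xs x
    using that
  proof (induction xs)
    case Nil
    have "(S [] has_derivative (\<lambda>_. 0)) (at x)"
      by (simp add: S_def)
    then show ?case by (intro exI[of _ "\<lambda>_. 0"]) (simp add: S_def D_def)
  next
    case (Cons a xs)
    obtain p q where a: "a = (p, q)" by (cases a)
    from Cons obtain L where L: "(S xs has_derivative L) (at x)"
      "\<And>i. L (axis i 1) = S (D i xs) x" by auto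
    from Cons.prems F G have "p differentiable_on UNIV" "q differentiable_on UNIV"
      by (auto simp: a partial_closed_def)
    note pq = this[THEN differentiable_on_UNIV_at, of x]
    have "S (a # xs) = (\<lambda>x. p x * q x + S xs x)"
      by (auto simp: S_def a)
    then have "(S (a # xs) has_derivative (\<lambda>h. p x * frechet_derivative q (at x) h +
        frechet_derivative p (at x) h * q x + L h)) (at x)"
      by (auto intro!: derivative_eq_intros pq L)
    then show ?case
      by (intro exI conjI allI, assumption) (simp add: L S_def D_def a partial_def algebra_simps)
  qed
  have "partial_closed {S xs | xs. set xs \<subseteq> F \<times> G}"
    unfolding partial_closed_def
  proof (intro ballI conjI allI)
    fix k assume "k \<in> {S xs | xs. set xs \<subseteq> F \<times> G}"
    then obtain xs where xs: "k = S xs" "set xs \<subseteq> F \<times> G" by auto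
    show "k differentiable_on UNIV"
      using der[OF xs(2)] unfolding xs(1) differentiable_on_def differentiable_def
      by auto
    fix i
    have "partial i k x = S (D i xs) x" for x
      using der[OF xs(2), of x] partial_has_derivative unfolding xs(1) by metis
    then have "partial i k = S (D i xs)" by auto
    then show "partial i k \<in> {S xs | xs. set xs \<subseteq> F \<times> G}" using D_in xs(2) by auto
  qed
  moreover have "(\<lambda>x. f x * g x) = S [(f, g)]" by (auto simp: S_def)
  moreover have "f \<in> F" "g \<in> G"
    by (auto simp: F_def G_def intro!: exI[of _ "[]"])
  ultimately show ?thesis
    by (intro partial_closed_smooth) auto
qed

text \<open>With y = 1 / t the derivative in t of q(y) * exp(-y) is y^2 * (q - q')(y) * exp(-y).
  Admitting all polynomials q makes the class closed under differentiation; \<open>flat 1\<close> is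
  the classical exp(-1/t).\<close>

definition flat :: "real poly \<Rightarrow> real \<Rightarrow> real" where
  "flat q t = (if t > 0 then poly q (1 / t) * exp (- (1 / t)) else 0)"

lemma poly_exp_tendsto_0: "((\<lambda>y. poly q y * exp (- y)) \<longlongrightarrow> (0::real)) at_top"
proof -
  have "((\<lambda>y. \<Sum>k\<le>degree q. coeff q k * (y ^ k / exp y)) \<longlongrightarrow> (\<Sum>k\<le>degree q. coeff q k * 0)) at_top"
    by (intro tendsto_intros tendsto_power_div_exp_0)
  then show ?thesis
    by (simp add: poly_altdef sum_distrib_right exp_minus divide_inverse mult.assoc)
qed

lemma flat_tendsto_0: "(flat q \<longlongrightarrow> 0) (at 0)"
proof -
  have "((\<lambda>t. poly q (1 / t) * exp (- (1 / t))) \<longlongrightarrow> (0::real)) (at_right 0)"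
    using filterlim_compose[OF poly_exp_tendsto_0 filterlim_inverse_at_top_right, of q]
    by (simp add: inverse_eq_divide)
  then have "(flat q \<longlongrightarrow> 0) (at_right 0)"
    by (rule Lim_transform_eventually) (auto simp: flat_def eventually_at_filter)
  moreover have "(flat q \<longlongrightarrow> 0) (at_left 0)"
    by (rule Lim_transform_eventually[OF tendsto_const]) (auto simp: flat_def eventually_at_filter)
  ultimately show ?thesis by (simp add: filterlim_split_at)
qed

lemma flat_has_derivative:
  "(flat q has_real_derivative flat ([:0, 0, 1:] * (q - pderiv q)) t) (at t)"
proof (cases t "0::real" rule: linorder_cases)
  case less
  have "((\<lambda>_. 0) has_real_derivative 0) (at t)" by simp
  then have "(flat q has_real_derivative 0) (at t)"
    by (rule DERIV_cong_ev[THEN iffD1, rotated 3])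
      (use less in \<open>auto simp: flat_def intro!: eventually_mono[OF eventually_nhds_in_open[of "{..<0}"]]\<close>)
  with less show ?thesis by (simp add: flat_def)
next
  case equal
  \<comment> \<open>At 0 the difference quotient is again of this class: division by h multiplies q
    by y, which is \<open>pCons 0 q\<close>.\<close>
  have "((\<lambda>h. (flat q (0 + h) - flat q 0) / h) \<longlongrightarrow> 0) (at 0)"
    by (rule Lim_transform_eventually[OF flat_tendsto_0[of "pCons 0 q"]])
      (auto simp: flat_def eventually_at_filter)
  with equal show ?thesis by (simp add: DERIV_def flat_def)
next
  case greater
  have "((\<lambda>t. poly q (1 / t) * exp (- (1 / t))) has_real_derivative
      flat ([:0, 0, 1:] * (q - pderiv q)) t) (at t)"
    using greater
    by (auto intro!: derivative_eq_intros simp: flat_def field_simps power2_eq_square)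
  then show ?thesis
    by (rule DERIV_cong_ev[THEN iffD1, rotated 3])
      (use greater in \<open>auto simp: flat_def intro!: eventually_mono[OF eventually_nhds_in_open[of "{0<..}"]]\<close>)
qed

lemma smooth_flat_affine: "smooth (\<lambda>x. flat q (\<alpha> \<bullet> x + \<beta>))"
proof -
  \<comment> \<open>The factor c absorbs the component of \<alpha> that the chain rule
    produces.\<close>
  define F where "F = {\<lambda>x. c * flat q (\<alpha> \<bullet> x + \<beta>) | c q. True}"
  have der: "((\<lambda>x. c * flat q (\<alpha> \<bullet> x + \<beta>)) has_derivative
      (\<lambda>h. c * ((\<alpha> \<bullet> h) * flat ([:0, 0, 1:] * (q - pderiv q)) (\<alpha> \<bullet> x + \<beta>)))) (at x)" for c q x
    by (auto intro!: derivative_eq_intros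
        has_derivative_compose[OF _ flat_has_derivative[unfolded has_field_derivative_def]])
  have "partial_closed F"
    unfolding partial_closed_def
  proof (intro ballI conjI allI)
    fix f i assume "f \<in> F"
    then obtain c q where f: "f = (\<lambda>x. c * flat q (\<alpha> \<bullet> x + \<beta>))" by (auto simp: F_def)
    show "f differentiable_on UNIV"
      using der unfolding f differentiable_on_def differentiable_def by blast
    have "partial i f = (\<lambda>x. (c * (\<alpha> \<bullet> axis i 1)) * flat ([:0, 0, 1:] * (q - pderiv q)) (\<alpha> \<bullet> x + \<beta>))"
      using partial_has_derivative[OF der] by (auto simp: f fun_eq_iff)
    then show "partial i f \<in> F" unfolding F_def by blast
  qed
  moreover have "(\<lambda>x. flat q (\<alpha> \<bullet> x + \<beta>)) \<in> F"
    by (auto simp: F_def intro!: exI[of _ "1::real"] exI[of _ q])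
  ultimately show ?thesis by (rule partial_closed_smooth)
qed

subsection \<open>Uniqueness of weak derivatives\<close>

lemma flat_one_bounds: "0 \<le> flat 1 t" "flat 1 t \<le> 1"
  by (auto simp: flat_def)

lemma flat_one_tendsto_1: "(flat 1 \<longlongrightarrow> 1) at_top"
proof -
  have "((\<lambda>t::real. exp (- (1 / t))) \<longlongrightarrow> exp (- 0)) at_top"
    by (rule tendsto_exp[OF tendsto_minus[OF tendsto_divide_0[OF tendsto_const
            filterlim_at_top_imp_at_infinity[OF filterlim_ident]]]])
  moreover have "\<forall>\<^sub>F t::real in at_top. exp (- (1 / t)) = flat 1 t"
    using eventually_gt_at_top[of 0] by eventually_elim (simp add: flat_def)
  ultimately have "(flat 1 \<longlongrightarrow> exp (- 0)) at_top"
    by (rule Lim_transform_eventually)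
  then show ?thesis by simp
qed

text \<open>A product of four one-sided cutoffs. The factor n + 1 drives each argument to infinity
  at points of the box; the shift by -1 confines the support to a closed box whose sides lie 1 / (n
  + 1) further inside, hence to a compact subset of \<Omega> even when the box touches the frontier.
  The bound by 1 is there for dominated convergence.\<close>

lemma box_bump:
  fixes a b :: "real^2"
  assumes "box a b \<subseteq> \<Omega>"
  obtains \<phi> where "\<And>n::nat. \<phi> n \<in> test_functions \<Omega>" "\<And>n x. \<bar>\<phi> n x\<bar> \<le> 1"
    "\<And>x. (\<lambda>n. \<phi> n x) \<longlonglongrightarrow> indicator (box a b) x"
proof
  define l where "l = (\<lambda>i (n::nat) (x::real^2). flat 1 ((real (Suc n) *\<^sub>R axis i 1) \<bullet> x + (- real (Suc n) * a $ i - 1)))"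
  define r where "r = (\<lambda>i (n::nat) (x::real^2). flat 1 ((- real (Suc n) *\<^sub>R axis i 1) \<bullet> x + (real (Suc n) * b $ i - 1)))"
  define \<phi> where "\<phi> = (\<lambda>n x. (l 1 n x * l 2 n x) * (r 1 n x * r 2 n x))"
  have l_alt: "l i n x = flat 1 (real (Suc n) * (x $ i - a $ i) - 1)" for i n x
    by (simp add: l_def inner_axis' algebra_simps)
  have r_alt: "r i n x = flat 1 (real (Suc n) * (b $ i - x $ i) - 1)" for i n x
    by (simp add: r_def inner_axis' algebra_simps)
  have bounds: "0 \<le> l i n x" "l i n x \<le> 1" "0 \<le> r i n x" "r i n x \<le> 1" for i n x
    by (auto simp: l_def r_def flat_one_bounds)
  show "\<bar>\<phi> n x\<bar> \<le> 1" for n x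
    unfolding \<phi>_def abs_mult
    by (intro mult_le_one mult_nonneg_nonneg) (use bounds in auto)
  have l_lim: "(\<lambda>n. l i n x) \<longlonglongrightarrow> (if a $ i < x $ i then 1 else 0)" for i x
  proof (cases "a $ i < x $ i")
    case True
    have "filterlim (\<lambda>n. - 1 + real (Suc n) * (x $ i - a $ i)) at_top sequentially"
      using True
      by (intro filterlim_tendsto_add_at_top[OF tendsto_const] filterlim_at_top_mult_tendsto_pos[OF tendsto_const]
          filterlim_compose[OF filterlim_real_sequentially filterlim_Suc])
        auto
    then show ?thesis using filterlim_compose[OF flat_one_tendsto_1] True by (simp add: l_alt)
  next
    case False
    then have "real (Suc n) * (x $ i - a $ i) \<le> 0" for n
      by (intro mult_nonneg_nonpos) auto
    then have "\<not> real (Suc n) * (x $ i - a $ i) - 1 > 0" for n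
      by (smt (verit))
    then show ?thesis using False by (simp add: l_alt flat_def)
  qed
  have r_lim: "(\<lambda>n. r i n x) \<longlonglongrightarrow> (if x $ i < b $ i then 1 else 0)" for i x
  proof (cases "x $ i < b $ i")
    case True
    have "filterlim (\<lambda>n. - 1 + real (Suc n) * (b $ i - x $ i)) at_top sequentially"
      using True
      by (intro filterlim_tendsto_add_at_top[OF tendsto_const] filterlim_at_top_mult_tendsto_pos[OF tendsto_const]
          filterlim_compose[OF filterlim_real_sequentially filterlim_Suc])
        auto
    then show ?thesis using filterlim_compose[OF flat_one_tendsto_1] True by (simp add: r_alt)
  next
    case False
    then have "real (Suc n) * (b $ i - x $ i) \<le> 0" for n
      by (intro mult_nonneg_nonpos) auto
    then have "\<not> real (Suc n) * (b $ i - x $ i) - 1 > 0" for n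
      by (smt (verit))
    then show ?thesis using False by (simp add: r_alt flat_def)
  qed
  show "(\<lambda>n. \<phi> n x) \<longlonglongrightarrow> indicator (box a b) x" for x
  proof -
    have "(\<lambda>n. \<phi> n x) \<longlonglongrightarrow>
      ((if a $ 1 < x $ 1 then 1 else 0) * (if a $ 2 < x $ 2 then 1 else 0)) *
      ((if x $ 1 < b $ 1 then 1 else 0) * (if x $ 2 < b $ 2 then 1 else 0))"
      unfolding \<phi>_def by (intro tendsto_mult l_lim r_lim)
    then show ?thesis
      by (rule back_subst) (auto simp: indicator_def mem_box_cart forall_2)
  qed
  show "\<phi> n \<in> test_functions \<Omega>" for n
  proof -
    have "smooth (\<phi> n)"
      unfolding \<phi>_def l_def r_def by (intro smooth_mult smooth_flat_affine)
    moreover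
    define c where "c = cbox (\<chi> i. a $ i + 1 / real (Suc n)) (\<chi> i. b $ i - 1 / real (Suc n))"
    have "x \<in> c" if "\<phi> n x \<noteq> 0" for x
    proof -
      have "real (Suc n) * (x $ i - a $ i) - 1 > 0 \<and> real (Suc n) * (b $ i - x $ i) - 1 > 0" for i
        using that exhaust_2[of i] by (auto simp: \<phi>_def l_alt r_alt flat_def split: if_splits)
      then have "a $ i + 1 / real (Suc n) \<le> x $ i \<and> x $ i \<le> b $ i - 1 / real (Suc n)" for i
        using less_imp_le by (auto simp: field_simps; smt (verit))
      then show ?thesis by (auto simp: c_def mem_box_cart)
    qed
    then have "closure {x. \<phi> n x \<noteq> 0} \<subseteq> c"
      by (intro closure_minimal) (auto simp: c_def)
    moreover have "c \<subseteq> \<Omega>"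
    proof
      fix x assume "x \<in> c"
      then have "a $ i < x $ i \<and> x $ i < b $ i" for i
      proof -
        have "a $ i + 1 / real (Suc n) \<le> x $ i" "x $ i \<le> b $ i - 1 / real (Suc n)"
          using \<open>x \<in> c\<close> by (auto simp: c_def mem_box_cart)
        moreover have "1 / real (Suc n) > 0" by simp
        ultimately show ?thesis by linarith
      qed
      then show "x \<in> \<Omega>" using assms by (auto simp: mem_box_cart)
    qed
    moreover have "bounded (closure {x. \<phi> n x \<noteq> 0})"
      using calculation(2) bounded_subset[OF bounded_cbox] unfolding c_def by blast
    ultimately show ?thesis
      unfolding test_functions_def compact_eq_bounded_closed by blast
  qed
qed

lemma integral_zero_nn_integral_eq:
  fixes f :: "'a \<Rightarrow> real"
  assumes "integrable M f" "integral\<^sup>L M f = 0"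
  shows "(\<integral>\<^sup>+x. ennreal (f x) \<partial>M) = (\<integral>\<^sup>+x. ennreal (- f x) \<partial>M)"
proof -
  have "(\<integral>\<^sup>+x. ennreal (f x) \<partial>M) \<noteq> \<infinity>" "(\<integral>\<^sup>+x. ennreal (- f x) \<partial>M) \<noteq> \<infinity>"
    using assms(1) by (auto simp: real_integrable_def)
  moreover have "enn2real (\<integral>\<^sup>+x. ennreal (f x) \<partial>M) = enn2real (\<integral>\<^sup>+x. ennreal (- f x) \<partial>M)"
    using real_lebesgue_integral_def[OF assms(1)] assms(2) by simp
  ultimately show ?thesis
    by (metis ennreal_enn2real infinity_ennreal_def top.not_eq_extremum)
qed

text \<open>Since \<open>ennreal\<close> cuts off negative values, p and -p are the densities of the
  positive and the negative part. These finite measures agree on boxes, an intersection-stable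
  generator, so they are equal, and so are their densities almost everywhere.\<close>

lemma AE_zero_of_box_integrals:
  fixes p :: "'a::euclidean_space \<Rightarrow> real"
  assumes "integrable lborel p" "\<And>a b. (LINT x|lborel. p x * indicator (box a b) x) = 0"
  shows "AE x in lborel. p x = 0"
proof -
  have [measurable]: "p \<in> borel_measurable borel" using assms(1) by auto
  have "density lborel (\<lambda>x. ennreal (p x)) = density lborel (\<lambda>x. ennreal (- p x))" (is "?M = ?N")
  proof (rule measure_eqI_generator_eq)
    let ?E = "range (\<lambda>(a, b). box a b::'a set)"
    show "Int_stable ?E"
      by (auto simp: Int_stable_def box_Int_box)
    show "?E \<subseteq> Pow UNIV" "sets ?M = sigma_sets UNIV ?E" "sets ?N = sigma_sets UNIV ?E"
      by (simp_all add: borel_eq_box)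
    let ?A = "\<lambda>n::nat. box (- (real n *\<^sub>R One)) (real n *\<^sub>R One) :: 'a set"
    show "range ?A \<subseteq> ?E" "(\<Union>i. ?A i) = UNIV"
      unfolding UN_box_eq_UNIV by auto
    show "emeasure ?M (?A i) \<noteq> \<infinity>" for i
    proof -
      have "emeasure ?M (?A i) \<le> (\<integral>\<^sup>+x. ennreal (p x) \<partial>lborel)"
        by (auto simp: emeasure_density intro!: nn_integral_mono split: split_indicator)
      also have "\<dots> < \<infinity>"
        using assms(1) by (auto simp: real_integrable_def top.not_eq_extremum)
      finally show ?thesis by auto
    qed
    show "emeasure ?M X = emeasure ?N X" if X: "X \<in> ?E" for X
    proof -
      have [measurable]: "X \<in> sets borel" using X by auto
      have "integrable lborel (\<lambda>x. p x * indicator X x)"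
        using assms(1) by (intro integrable_real_mult_indicator) auto
      moreover have "(LINT x|lborel. p x * indicator X x) = 0" using X assms(2) by auto
      ultimately have "(\<integral>\<^sup>+x. ennreal (p x * indicator X x) \<partial>lborel) = (\<integral>\<^sup>+x. ennreal (- (p x * indicator X x)) \<partial>lborel)"
        by (rule integral_zero_nn_integral_eq)
      moreover have "ennreal (p x * indicator X x) = ennreal (p x) * indicator X x"
        "ennreal (- (p x * indicator X x)) = ennreal (- p x) * indicator X x" for x
        by (auto split: split_indicator)
      ultimately show ?thesis by (simp add: emeasure_density)
    qed
  qed
  then have "AE x in lborel. ennreal (p x) = ennreal (- p x)"
    by (subst (asm) sigma_finite_measure.density_unique_iff[OF sigma_finite_lborel]) auto
  then show ?thesis
  proof eventually_elim
    case (elim x)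
    then show ?case by (cases "p x \<ge> 0") (auto simp: ennreal_eq_0_iff ennreal_neg)
  qed
qed

lemma fundamental_lemma_calculus_of_variations:
  fixes \<Omega> :: "(real^2) set"
  assumes "open \<Omega>" and d: "integrable (lebesgue_on \<Omega>) d"
    and zero: "\<And>\<phi>. \<phi> \<in> test_functions \<Omega> \<Longrightarrow> (LINT x|lebesgue_on \<Omega>. d x * \<phi> x) = 0"
  shows "AE x in lebesgue_on \<Omega>. d x = 0"
proof -
  have \<Omega>[measurable]: "\<Omega> \<in> sets lebesgue" "\<Omega> \<in> sets borel" using assms(1) by auto
  have space: "\<Omega> \<inter> space lebesgue \<in> sets lebesgue" by simp
  \<comment> \<open>Extension by zero, followed by a Borel representative \<open>d'\<close>: the box
    criterion lives on \<open>lborel\<close>, while d is only Lebesgue measurable.\<close>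
  define d0 where "d0 x = indicator \<Omega> x * d x" for x
  have d0: "integrable lebesgue d0"
    using d by (simp add: d0_def[abs_def] integrable_restrict_space)
  obtain d' where [measurable]: "d' \<in> borel_measurable lborel" and d'_AE: "AE x in lborel. d0 x = d' x"
    using completion_ex_borel_measurable_real[of d0 lborel] d0 by auto
  have d'_AE': "AE x in lebesgue. d0 x = d' x" using d'_AE by (rule AE_completion)
  have d'_meas: "d' \<in> borel_measurable lebesgue"
    using measurable_completion[of d' lborel borel] by auto
  have d0_meas: "d0 \<in> borel_measurable lebesgue" using d0 by auto
  have "integrable lebesgue d'"
    using d0 d'_AE' d'_meas d0_meas by (subst integrable_cong_AE[where g=d0]) auto
  then have d': "integrable lborel d'" by (subst (asm) integrable_completion) auto
  have box0: "(LINT x|lborel. d' x * indicator (box a b) x) = 0" if ab: "box a b \<subseteq> \<Omega>" for a b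
  proof -
    obtain \<phi> where \<phi>: "\<And>n::nat. \<phi> n \<in> test_functions \<Omega>" "\<And>n x. \<bar>\<phi> n x\<bar> \<le> 1"
      "\<And>x. (\<lambda>n. \<phi> n x) \<longlonglongrightarrow> indicator (box a b) x"
      using box_bump[OF ab] by blast
    have cont: "continuous_on UNIV (\<phi> n)" for n
    proof -
      have "foldr partial [] (\<phi> n) differentiable_on UNIV"
        using \<phi>(1)[of n] unfolding test_functions_def smooth_def by blast
      then show ?thesis by (simp add: differentiable_imp_continuous_on)
    qed
    have meas[measurable]: "\<phi> n \<in> borel_measurable borel" for n
      using cont by (rule borel_measurable_continuous_onI)
    have [measurable]: "\<phi> n \<in> borel_measurable lebesgue" for n
      using measurable_completion[of "\<phi> n" lborel borel] meas by auto
    have [measurable]: "d0 \<in> borel_measurable lebesgue" using d0 by auto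
    have [measurable]: "box a b \<in> sets lebesgue" by simp
    have "(\<lambda>n. LINT x|lebesgue. d0 x * \<phi> n x) \<longlonglongrightarrow> (LINT x|lebesgue. d0 x * indicator (box a b) x)"
    proof (rule integral_dominated_convergence[where w="\<lambda>x. \<bar>d0 x\<bar>"])
      show "AE x in lebesgue. (\<lambda>n. d0 x * \<phi> n x) \<longlonglongrightarrow> d0 x * indicator (box a b) x"
        by (intro AE_I2 tendsto_mult tendsto_const \<phi>)
      show "AE x in lebesgue. norm (d0 x * \<phi> n x) \<le> \<bar>d0 x\<bar>" for n
        using \<phi>(2)[of n] by (intro AE_I2) (auto simp: abs_mult intro: mult_left_le)
      show "(\<lambda>x. d0 x * indicator (box a b) x) \<in> borel_measurable lebesgue"
        by (rule borel_measurable_times) (auto intro: borel_measurable_indicator)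
      show "(\<lambda>x. d0 x * \<phi> n x) \<in> borel_measurable lebesgue" for n
        by (rule borel_measurable_times) auto
      show "integrable lebesgue (\<lambda>x. \<bar>d0 x\<bar>)"
        using d0 by simp
    qed
    moreover have "(LINT x|lebesgue. d0 x * \<phi> n x) = 0" for n
      using zero[OF \<phi>(1)[of n]]
      by (simp add: integral_restrict_space d0_def mult.assoc)
    ultimately have "(LINT x|lebesgue. d0 x * indicator (box a b) x) = 0"
      by (simp add: LIMSEQ_const_iff)
    also have "(LINT x|lebesgue. d0 x * indicator (box a b) x) = (LINT x|lebesgue. d' x * indicator (box a b) x)"
    proof (rule integral_cong_AE)
      show "AE x in lebesgue. d0 x * indicator (box a b) x = d' x * indicator (box a b) x"
        using d'_AE' by eventually_elim simp
    qed (rule borel_measurable_times; use d'_meas d0_meas in \<open>auto intro: borel_measurable_indicator\<close>)+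
    also have "\<dots> = (LINT x|lborel. d' x * indicator (box a b) x)"
      by (rule integral_completion) auto
    finally show ?thesis .
  qed
  \<comment> \<open>The criterion asks for all boxes of the plane, \<open>box0\<close> covers only
    those inside \<Omega>. Restricting \<open>d'\<close> to one box of \<Omega> resolves this,
    because its intersection with any other box is a box inside \<Omega>.\<close>
  have Q0: "AE x in lborel. x \<in> box a b \<longrightarrow> d' x = 0" if ab: "box a b \<subseteq> \<Omega>" for a b
  proof -
    have "AE x in lborel. d' x * indicator (box a b) x = 0"
    proof (rule AE_zero_of_box_integrals)
      show "integrable lborel (\<lambda>x. d' x * indicator (box a b) x)"
        using d' by (intro integrable_real_mult_indicator) auto
      fix l u
      obtain l' u' where lu: "box a b \<inter> box l u = box l' u'"
        by (rule that, rule box_Int_box)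
      have "(LINT x|lborel. d' x * indicator (box a b) x * indicator (box l u) x) =
        (LINT x|lborel. d' x * indicator (box l' u') x)"
        unfolding lu[symmetric] by (simp add: indicator_inter_arith mult.assoc)
      also have "\<dots> = 0" using lu ab by (intro box0) auto
      finally show "(LINT x|lborel. d' x * indicator (box a b) x * indicator (box l u) x) = 0" .
    qed
    then show ?thesis by eventually_elim (auto split: split_indicator_asm)
  qed
  \<comment> \<open>Countably many boxes cover \<Omega>, so the exceptional null sets together
    remain null.\<close>
  obtain \<D> where \<D>: "countable \<D>" "\<D> \<subseteq> Pow \<Omega>" "\<And>X. X \<in> \<D> \<Longrightarrow> \<exists>a b. X = box a b" "\<Union>\<D> = \<Omega>"
    by (rule open_countable_Union_open_box[OF assms(1)], rule that)
  have "AE x in lborel. \<forall>X\<in>\<D>. x \<in> X \<longrightarrow> d' x = 0"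
    unfolding AE_ball_countable[OF \<D>(1)]
  proof
    fix X assume "X \<in> \<D>"
    then obtain a b where ab: "X = box a b" using \<D>(3) by meson
    moreover have "X \<subseteq> \<Omega>" using \<open>X \<in> \<D>\<close> \<D>(2) by (meson PowD subsetD)
    ultimately show "AE x in lborel. x \<in> X \<longrightarrow> d' x = 0" using Q0 by simp
  qed
  then have "AE x in lebesgue. \<forall>X\<in>\<D>. x \<in> X \<longrightarrow> d' x = 0" by (rule AE_completion)
  with d'_AE' have "AE x in lebesgue. x \<in> \<Omega> \<longrightarrow> d x = 0"
  proof eventually_elim
    case (elim x)
    show ?case
    proof
      assume "x \<in> \<Omega>"
      then obtain X where "X \<in> \<D>" "x \<in> X" using \<D>(4) by blast
      then show "d x = 0" using elim \<open>x \<in> \<Omega>\<close> by (simp add: d0_def)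
    qed
  qed
  then show ?thesis
    unfolding AE_restrict_space_iff[OF space] .
qed

subsection \<open>Integration over the plane\<close>

lemma prod_Basis_real2: "(\<Prod>b\<in>(Basis :: (real^2) set). v \<bullet> b) = v $ 1 * v $ 2"
proof -
  have "(\<Prod>b\<in>(Basis :: (real^2) set). v \<bullet> b) = (\<Prod>i\<in>(UNIV::2 set). v \<bullet> axis i 1)"
  proof -
    have b: "(Basis :: (real^2) set) = (\<lambda>i. axis i 1) ` UNIV" by (auto simp: Basis_vec_def)
    have inj: "inj (\<lambda>i. axis i (1::real) :: real^2)" by (auto simp: inj_def axis_eq_axis)
    show ?thesis unfolding b by (subst prod.reindex[OF inj]) simp
  qed
  then show ?thesis by (simp add: UNIV_2 inner_axis)
qed

lemma lborel_real2_eq_distr: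
  fixes i j :: 2
  assumes "i \<noteq> j"
  shows "(lborel :: (real^2) measure) =
    distr (lborel \<Otimes>\<^sub>M lborel) borel (\<lambda>(s, t). t *\<^sub>R axis i 1 + s *\<^sub>R axis j 1)"
proof (rule lborel_eqI)
  have ij: "(i = 1 \<and> j = 2) \<or> (i = 2 \<and> j = 1)"
    using assms exhaust_2[of i] exhaust_2[of j] by auto
  fix l u :: "real^2" assume "\<And>b. b \<in> Basis \<Longrightarrow> l \<bullet> b \<le> u \<bullet> b"
  then have lu: "l $ k \<le> u $ k" for k
    by (metis axis_in_Basis_iff inner_axis inner_real_def mult.right_neutral Basis_real_def insertI1)
  have "(\<lambda>(s, t). t *\<^sub>R axis i 1 + s *\<^sub>R axis j 1 :: real^2) -` box l u =
      {l $ j <..< u $ j} \<times> {l $ i <..< u $ i}"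
    using ij by (auto simp: mem_box_cart forall_2 axis_def)
  then show "emeasure (distr (lborel \<Otimes>\<^sub>M lborel) borel (\<lambda>(s, t). t *\<^sub>R axis i 1 + s *\<^sub>R axis j 1)) (box l u) =
      ennreal (\<Prod>b\<in>Basis. (u - l) \<bullet> b)"
    using ij lu
    by (subst emeasure_distr)
       (auto simp: prod_Basis_real2 space_pair_measure lborel.emeasure_pair_measure_Times
         ennreal_mult[symmetric] mult.commute)
qed simp

text \<open>It suffices to compare the two measures on boxes. The preimage of a box under the linear
  map is its image under the inverse, and the determinant formula is applied to that set.\<close>

lemma lborel_real2_eq_linear:
  fixes a b :: "real^2"
  assumes d: "a $ 1 * b $ 2 - a $ 2 * b $ 1 \<noteq> 0"
  shows "(lborel :: (real^2) measure) =
    density (distr lborel borel (\<lambda>v::real^2. v $ 1 *\<^sub>R a + v $ 2 *\<^sub>R b))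
      (\<lambda>_. ennreal \<bar>a $ 1 * b $ 2 - a $ 2 * b $ 1\<bar>)"
proof (rule lborel_eqI)
  define A where "A = (\<lambda>v::real^2. v $ 1 *\<^sub>R a + v $ 2 *\<^sub>R b)"
  have lin: "linear A"
    by (rule linearI) (auto simp: A_def algebra_simps)
  have det: "det (matrix A) = a $ 1 * b $ 2 - a $ 2 * b $ 1"
    by (simp add: det_2 matrix_def A_def axis_def)
  then have "inj A" using d det_nz_iff_inj[OF lin] by simp
  then obtain A' where A': "linear A'" "\<And>x. A' (A x) = x" "\<And>x. A (A' x) = x"
    using linear_injective_isomorphism[OF lin] by metis
  have [measurable]: "A \<in> borel_measurable borel"
    using lin by (intro borel_measurable_continuous_onI linear_continuous_on linear_linear[THEN iffD2])
  fix l u :: "real^2" assume "\<And>b. b \<in> Basis \<Longrightarrow> l \<bullet> b \<le> u \<bullet> b"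
  then have lu: "emeasure lborel (box l u) = ennreal (\<Prod>b\<in>Basis. (u - l) \<bullet> b)"
    by (simp add: emeasure_lborel_box)
  have eq: "A -` box l u = A' ` box l u"
    using A' by (auto simp: image_iff) metis
  have m: "A' ` box l u \<in> lmeasurable"
    using measurable_linear_image[OF A'(1)] lmeasurable_box by blast
  have "A ` A' ` box l u = box l u" using A' by (force simp: image_iff)
  with measure_linear_image[OF lin m]
  have "measure lebesgue (box l u) = \<bar>det (matrix A)\<bar> * measure lebesgue (A' ` box l u)"
    by simp
  then have "emeasure lebesgue (box l u) = ennreal \<bar>det (matrix A)\<bar> * emeasure lebesgue (A' ` box l u)"
    using m by (simp add: emeasure_eq_measure2 fmeasurableD2 ennreal_mult' lmeasurable_box)
  then have *: "emeasure lborel (box l u) = ennreal \<bar>det (matrix A)\<bar> * emeasure lborel (A -` box l u)"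
    unfolding eq[symmetric]
    using measurable_sets[of A borel borel "box l u"] by simp
  show "emeasure (density (distr lborel borel (\<lambda>v::real^2. v $ 1 *\<^sub>R a + v $ 2 *\<^sub>R b))
      (\<lambda>_. ennreal \<bar>a $ 1 * b $ 2 - a $ 2 * b $ 1\<bar>)) (box l u) = ennreal (\<Prod>b\<in>Basis. (u - l) \<bullet> b)"
    unfolding A_def[symmetric]
    using * by (simp add: emeasure_density nn_integral_cmult_indicator emeasure_distr lu det)
qed simp

text \<open>Oblique coordinates with origin p. The integrals extend over the whole plane and are
  taken in the extended nonnegative reals, so no integrability is at stake.\<close>

lemma nn_integral_parallelogram:
  fixes a b p :: "real^2"
  assumes d: "a $ 1 * b $ 2 - a $ 2 * b $ 1 \<noteq> 0" and [measurable]: "W \<in> borel_measurable borel"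
  shows "(\<integral>\<^sup>+x. W x \<partial>lborel) = ennreal \<bar>a $ 1 * b $ 2 - a $ 2 * b $ 1\<bar> *
    (\<integral>\<^sup>+s. \<integral>\<^sup>+t. W (p + t *\<^sub>R a + s *\<^sub>R b) \<partial>lborel \<partial>lborel)"
proof -
  let ?d = "ennreal \<bar>a $ 1 * b $ 2 - a $ 2 * b $ 1\<bar>"
  have [measurable]: "(\<lambda>v::real^2. v $ 1 *\<^sub>R a + v $ 2 *\<^sub>R b) \<in> borel_measurable borel"
    by (intro borel_measurable_continuous_onI continuous_intros)
  have [measurable]: "(\<lambda>(s, t). t *\<^sub>R axis 1 1 + s *\<^sub>R axis 2 1 :: real^2) \<in> borel_measurable (lborel \<Otimes>\<^sub>M lborel)"
    by (simp add: split_beta')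
  have "(\<integral>\<^sup>+x. W x \<partial>lborel) = (\<integral>\<^sup>+x. W x \<partial>(distr lborel borel ((+) p)))"
    by (simp add: lborel_distr_plus)
  also have "\<dots> = (\<integral>\<^sup>+x. W (p + x) \<partial>lborel)"
    by (subst nn_integral_distr) auto
  also have "\<dots> = ?d * (\<integral>\<^sup>+v. W (p + ((v::real^2) $ 1 *\<^sub>R a + v $ 2 *\<^sub>R b)) \<partial>lborel)"
    by (subst lborel_real2_eq_linear[OF d])
       (simp add: nn_integral_density nn_integral_distr nn_integral_cmult)
  also have "(\<integral>\<^sup>+v. W (p + ((v::real^2) $ 1 *\<^sub>R a + v $ 2 *\<^sub>R b)) \<partial>lborel) =
      (\<integral>\<^sup>+z. W (p + (snd z *\<^sub>R a + fst z *\<^sub>R b)) \<partial>(lborel \<Otimes>\<^sub>M lborel))"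
    by (subst lborel_real2_eq_distr[of 1 2])
       (auto simp: nn_integral_distr axis_def split_beta' intro!: nn_integral_cong)
  also have "\<dots> = (\<integral>\<^sup>+s. \<integral>\<^sup>+t. W (p + (t *\<^sub>R a + s *\<^sub>R b)) \<partial>lborel \<partial>lborel)"
    by (subst lborel.nn_integral_fst[symmetric]) auto
  finally show ?thesis by (simp add: add.assoc)
qed

lemma integral_real2_iterated:
  fixes w :: "real^2 \<Rightarrow> real"
  assumes "i \<noteq> j" and w: "integrable lborel w"
  shows "(LINT x|lborel. w x) = (LINT s|lborel. LINT t|lborel. w (t *\<^sub>R axis i 1 + s *\<^sub>R axis j 1))"
proof -
  have [measurable]: "w \<in> borel_measurable borel" using w by auto
  have m: "(\<lambda>(s, t). t *\<^sub>R axis i 1 + s *\<^sub>R axis j 1 :: real^2) \<in> borel_measurable (lborel \<Otimes>\<^sub>M lborel)"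
    by (simp add: split_beta')
  have "integrable (lborel \<Otimes>\<^sub>M lborel) (\<lambda>z. w (case z of (s, t) \<Rightarrow> t *\<^sub>R axis i 1 + s *\<^sub>R axis j 1))"
    using w m by (subst (asm) lborel_real2_eq_distr[OF assms(1)]) (simp add: integrable_distr_eq)
  then have "integrable (lborel \<Otimes>\<^sub>M lborel) (\<lambda>(s, t). w (t *\<^sub>R axis i 1 + s *\<^sub>R axis j 1))"
    by (simp add: split_beta')
  from lborel_pair.integral_fst'[OF this]
  show ?thesis using m
    by (subst lborel_real2_eq_distr[OF assms(1)]) (simp add: integral_distr split_beta')
qed

subsection \<open>Piecewise continuously differentiable functions\<close>

text \<open>Each piece carries a function \<open>F K\<close> that is differentiable on the whole
  plane, which avoids one-sided derivatives at the frontier of K. Continuity of f follows, since f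
  agrees with the continuous \<open>F K\<close> on finitely many closed pieces. The notion covers
  elements of \<open>fe_space\<close>, the quadratic u and its coordinate derivatives alike.\<close>

definition piecewise_C1 ::
    "(real^2) set set \<Rightarrow> ((real^2) set \<Rightarrow> real^2 \<Rightarrow> real) \<Rightarrow> ((real^2) set \<Rightarrow> real^2 \<Rightarrow> real^2) \<Rightarrow>
     (real^2 \<Rightarrow> real) \<Rightarrow> bool" where
  "piecewise_C1 \<T> F D f \<longleftrightarrow> finite \<T> \<and>
     (\<forall>K\<in>\<T>. convex K \<and> compact K \<and> continuous_on UNIV (D K) \<and>
       (\<forall>x. (F K has_derivative (\<lambda>h. D K x \<bullet> h)) (at x)) \<and> (\<forall>x\<in>K. f x = F K x))"

text \<open>Averaging over the pieces that contain the point makes the gradient Borel measurable without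
  a choice; its component along a line is still the derivative of the function on that line at all
  but finitely many points, even when the line runs along a common edge of two pieces.\<close>

definition pgrad :: "(real^2) set set \<Rightarrow> ((real^2) set \<Rightarrow> real^2 \<Rightarrow> real^2) \<Rightarrow> real^2 \<Rightarrow> real^2" where
  "pgrad \<T> D x = (\<Sum>K\<in>\<T>. indicator K x *\<^sub>R D K x) /\<^sub>R (\<Sum>K\<in>\<T>. indicator K x)"

text \<open>A line meets a convex piece in an interval; the endpoints of these intervals form the
  finite exceptional set in which differentiability along the line may fail.\<close>

lemma finite_frontier_convex_real:
  fixes J :: "real set"
  assumes "convex J" shows "finite (frontier J)"
proof -
  have "is_interval J" using assms by (simp add: is_interval_convex_1)
  then have "\<exists>a b. J = {} \<or> J = UNIV \<or> J = {..<b} \<or> J = {..b} \<or> J = {a<..} \<or> J = {a..} \<or>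
      J = {a<..<b} \<or> J = {a<..b} \<or> J = {a..<b} \<or> J = {a..b}"
    by (rule is_real_interval)
  then obtain a b where J: "J = {} \<or> J = UNIV \<or> J = {..<b} \<or> J = {..b} \<or> J = {a<..} \<or> J = {a..} \<or>
      J = {a<..<b} \<or> J = {a<..b} \<or> J = {a..<b} \<or> J = {a..b}" by blast
  have cl: "closure {a<..<b} \<subseteq> {a..b}" "closure {a<..b} \<subseteq> {a..b}" "closure {a..<b} \<subseteq> {a..b}"
    by (intro closure_minimal; auto)+
  have "frontier J \<subseteq> {a, b}"
    using J cl by (elim disjE) (auto simp: frontier_def interior_open)
  then show ?thesis using finite_subset by blast
qed

text \<open>An average of equal numbers. Only one component is compared, because along a common edge
  the full gradients of the pieces may differ.\<close>

lemma pgrad_eqI: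
  assumes "finite \<T>" "x \<in> \<Union>\<T>" "\<And>K. K \<in> \<T> \<Longrightarrow> x \<in> K \<Longrightarrow> D K x \<bullet> v = c"
  shows "pgrad \<T> D x \<bullet> v = c"
proof -
  have "(\<Sum>K\<in>\<T>. indicator K x *\<^sub>R D K x) \<bullet> v = (\<Sum>K\<in>\<T>. indicator K x * c)"
    unfolding inner_sum_left using assms(3)
    by (intro sum.cong) (auto simp: indicator_def)
  also have "\<dots> = (\<Sum>K\<in>\<T>. indicator K x) * c" by (simp add: sum_distrib_right)
  finally have "(\<Sum>K\<in>\<T>. indicator K x *\<^sub>R D K x) \<bullet> v = (\<Sum>K\<in>\<T>. indicator K x) * c" .
  moreover have "(\<Sum>K\<in>\<T>. indicator K x :: real) > 0"
  proof -
    obtain K where "K \<in> \<T>" "x \<in> K" using assms(2) by auto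
    then show ?thesis using assms(1) by (intro sum_pos2[of _ K]) auto
  qed
  ultimately show ?thesis by (simp add: pgrad_def)
qed

lemma norm_pgrad_le:
  assumes "finite \<T>"
  shows "norm (pgrad \<T> D x) \<le> (\<Sum>K\<in>\<T>. indicator K x * norm (D K x))"
proof (cases "x \<in> \<Union>\<T>")
  case True
  then obtain K where K: "K \<in> \<T>" "x \<in> K" by auto
  have "(1::real) \<le> (\<Sum>K\<in>\<T>. indicator K x)"
    using member_le_sum[of K \<T> "\<lambda>K. indicator K x :: real"] K assms by simp
  then have "norm (pgrad \<T> D x) \<le> norm (\<Sum>K\<in>\<T>. indicator K x *\<^sub>R D K x)"
    using mult_right_mono[of 1 "\<Sum>K\<in>\<T>. indicator K x" "norm (\<Sum>K\<in>\<T>. indicator K x *\<^sub>R D K x)"]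
    by (simp add: pgrad_def field_simps)
  also have "\<dots> \<le> (\<Sum>K\<in>\<T>. norm (indicator K x *\<^sub>R D K x))" by (rule norm_sum)
  also have "\<dots> = (\<Sum>K\<in>\<T>. indicator K x * norm (D K x))" by simp
  finally show ?thesis .
next
  case False
  then have "indicator K x = (0::real)" if "K \<in> \<T>" for K using that by auto
  then show ?thesis by (simp add: pgrad_def)
qed

context
  fixes \<T> F D f
  assumes pw: "piecewise_C1 \<T> F D f"
begin

lemma piecewise_C1_finite: "finite \<T>"
  using pw by (simp add: piecewise_C1_def)

lemma piecewise_C1_continuous_on: "continuous_on (\<Union>\<T>) f"
proof -
  have "continuous_on (\<Union>K\<in>\<T>. K) f"
  proof (rule continuous_on_closed_Union)
    fix K assume "K \<in> \<T>"
    then have "continuous_on K (F K)" "\<forall>x\<in>K. f x = F K x" "compact K"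
      using pw unfolding piecewise_C1_def
      by (meson continuous_at_imp_continuous_on has_derivative_continuous)+
    then show "closed K" "continuous_on K f"
      by (auto intro: compact_imp_closed cong: continuous_on_cong)
  qed (rule piecewise_C1_finite)
  then show ?thesis by simp
qed

lemma piecewise_C1_compact: "compact (\<Union>\<T>)"
  using pw by (auto simp: piecewise_C1_def intro!: compact_Union)

lemma pgrad_measurable: "pgrad \<T> D \<in> borel_measurable borel"
proof -
  have "K \<in> sets borel" "D K \<in> borel_measurable borel" if "K \<in> \<T>" for K
    using pw that by (auto simp: piecewise_C1_def intro!: borel_compact borel_measurable_continuous_onI)
  then show ?thesis
    unfolding pgrad_def[abs_def]
    by (intro borel_measurable_scaleR borel_measurable_inverse borel_measurable_sum
        borel_measurable_indicator) auto
qed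

lemma pgrad_bounded: obtains C where "0 \<le> C" "\<And>x. norm (pgrad \<T> D x) \<le> C"
proof -
  have "\<exists>C\<ge>0. \<forall>x\<in>K. norm (D K x) \<le> C" if "K \<in> \<T>" for K
  proof -
    have "compact K" "continuous_on K (D K)"
      using pw that by (auto simp: piecewise_C1_def intro: continuous_on_subset)
    then have "bounded (D K ` K)" by (intro compact_imp_bounded compact_continuous_image)
    then show ?thesis by (auto simp: bounded_pos intro: less_imp_le)
  qed
  then obtain C where C: "\<And>K. K \<in> \<T> \<Longrightarrow> C K \<ge> 0 \<and> (\<forall>x\<in>K. norm (D K x) \<le> C K)" by metis
  show ?thesis
  proof
    show "0 \<le> (\<Sum>K\<in>\<T>. C K)" using C by (intro sum_nonneg) auto
    fix x
    have "(\<Sum>K\<in>\<T>. indicator K x * norm (D K x)) \<le> (\<Sum>K\<in>\<T>. C K)"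
      using C by (intro sum_mono) (auto simp: indicator_def)
    then show "norm (pgrad \<T> D x) \<le> (\<Sum>K\<in>\<T>. C K)"
      using norm_pgrad_le[OF piecewise_C1_finite, of D x] by linarith
  qed
qed

text \<open>Away from the interval endpoints, every piece that contains the point also contains a
  neighbourhood of it on the line. All these pieces then give the derivative of the same function of
  t, so their components along \<nu> coincide and equal that of the average.\<close>

lemma piecewise_C1_line:
  obtains E where "finite E"
    "\<And>t. t \<notin> E \<Longrightarrow> p + t *\<^sub>R \<nu> \<in> \<Union>\<T> \<Longrightarrow>
       ((\<lambda>t. f (p + t *\<^sub>R \<nu>)) has_real_derivative pgrad \<T> D (p + t *\<^sub>R \<nu>) \<bullet> \<nu>) (at t)"
proof
  define J where "J K = {t. p + t *\<^sub>R \<nu> \<in> K}" for K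
  have conv: "convex (J K)" if "K \<in> \<T>" for K
  proof (rule convexI)
    fix s t u v :: real assume *: "s \<in> J K" "t \<in> J K" "0 \<le> u" "0 \<le> v" "u + v = 1"
    have "convex K" using pw that by (auto simp: piecewise_C1_def)
    then have "u *\<^sub>R (p + s *\<^sub>R \<nu>) + v *\<^sub>R (p + t *\<^sub>R \<nu>) \<in> K"
      using * by (auto simp: J_def intro: convexD)
    also have "u *\<^sub>R (p + s *\<^sub>R \<nu>) + v *\<^sub>R (p + t *\<^sub>R \<nu>) = (u + v) *\<^sub>R p + (u * s + v * t) *\<^sub>R \<nu>"
      by (simp add: algebra_simps)
    finally show "u *\<^sub>R s + v *\<^sub>R t \<in> J K" using * by (simp add: J_def)
  qed
  show "finite (\<Union>K\<in>\<T>. frontier (J K))"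
    using piecewise_C1_finite conv finite_frontier_convex_real by auto
  fix t assume t: "t \<notin> (\<Union>K\<in>\<T>. frontier (J K))" "p + t *\<^sub>R \<nu> \<in> \<Union>\<T>"
  have der: "((\<lambda>t. f (p + t *\<^sub>R \<nu>)) has_real_derivative D K (p + t *\<^sub>R \<nu>) \<bullet> \<nu>) (at t)"
    if K: "K \<in> \<T>" "p + t *\<^sub>R \<nu> \<in> K" for K
  proof -
    have int: "t \<in> interior (J K)"
      using t(1) K closure_subset[of "J K"] by (auto simp: J_def frontier_def)
    have "(F K has_derivative (\<lambda>h. D K (p + t *\<^sub>R \<nu>) \<bullet> h)) (at (p + t *\<^sub>R \<nu>))"
      using pw K by (auto simp: piecewise_C1_def)
    note d0 = this
    have d1: "((\<lambda>t. p + t *\<^sub>R \<nu>) has_derivative (\<lambda>s. s *\<^sub>R \<nu>)) (at t)"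
      by (auto intro!: derivative_eq_intros)
    have "((\<lambda>t. F K (p + t *\<^sub>R \<nu>)) has_derivative (\<lambda>s. D K (p + t *\<^sub>R \<nu>) \<bullet> (s *\<^sub>R \<nu>))) (at t)"
      by (rule has_derivative_compose[OF d1 d0])
    then have "((\<lambda>t. F K (p + t *\<^sub>R \<nu>)) has_real_derivative D K (p + t *\<^sub>R \<nu>) \<bullet> \<nu>) (at t)"
      by (simp add: has_field_derivative_def mult_commute_abs)
    moreover have "\<forall>\<^sub>F s in nhds t. F K (p + s *\<^sub>R \<nu>) = f (p + s *\<^sub>R \<nu>)"
    proof -
      have "\<forall>\<^sub>F s in nhds t. s \<in> interior (J K)"
        using int by (intro eventually_nhds_in_open) auto
      then show ?thesis
        using pw K(1) interior_subset[of "J K"]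
        by (elim eventually_mono) (auto simp: piecewise_C1_def J_def)
    qed
    ultimately show ?thesis
      by (rule DERIV_cong_ev[OF refl _ refl, THEN iffD1, rotated])
  qed
  obtain K where K: "K \<in> \<T>" "p + t *\<^sub>R \<nu> \<in> K" using t(2) by auto
  have "pgrad \<T> D (p + t *\<^sub>R \<nu>) \<bullet> \<nu> = D K (p + t *\<^sub>R \<nu>) \<bullet> \<nu>"
    by (rule pgrad_eqI) (use t(2) piecewise_C1_finite DERIV_unique[OF der der[OF K]] in auto)
  then show "((\<lambda>t. f (p + t *\<^sub>R \<nu>)) has_real_derivative pgrad \<T> D (p + t *\<^sub>R \<nu>) \<bullet> \<nu>) (at t)"
    using der[OF K] by simp
qed

text \<open>The fundamental theorem of calculus with finitely many exceptional points. The bound is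
  stated with \<open>ennreal\<close> so that it can be integrated over the remaining coordinate
  without further conditions.\<close>

lemma piecewise_C1_increment_le:
  assumes "a \<le> b" and seg: "\<And>t. t \<in> {a..b} \<Longrightarrow> p + t *\<^sub>R \<nu> \<in> \<Union>\<T>" and \<nu>: "norm \<nu> \<le> 1"
  shows "ennreal \<bar>f (p + b *\<^sub>R \<nu>) - f (p + a *\<^sub>R \<nu>)\<bar> \<le>
    (\<integral>\<^sup>+t. ennreal (norm (pgrad \<T> D (p + t *\<^sub>R \<nu>))) * indicator {a..b} t \<partial>lborel)"
proof -
  define g where "g = (\<lambda>t. pgrad \<T> D (p + t *\<^sub>R \<nu>) \<bullet> \<nu>)"
  obtain E where E: "finite E"
    "\<And>t. t \<notin> E \<Longrightarrow> p + t *\<^sub>R \<nu> \<in> \<Union>\<T> \<Longrightarrow>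
       ((\<lambda>t. f (p + t *\<^sub>R \<nu>)) has_real_derivative pgrad \<T> D (p + t *\<^sub>R \<nu>) \<bullet> \<nu>) (at t)"
    using piecewise_C1_line by blast
  have "continuous_on {a..b} (\<lambda>t. f (p + t *\<^sub>R \<nu>))"
    by (rule continuous_on_compose2[OF piecewise_C1_continuous_on]) (use seg in \<open>auto intro!: continuous_intros\<close>)
  then have I: "(g has_integral f (p + b *\<^sub>R \<nu>) - f (p + a *\<^sub>R \<nu>)) {a..b}"
    unfolding g_def using seg E(2)
    by (intro fundamental_theorem_of_calculus_interior_strong[OF E(1) assms(1)])
      (auto simp flip: has_real_derivative_iff_has_vector_derivative)
  have "(\<lambda>t. p + t *\<^sub>R \<nu>) \<in> borel_measurable borel"
    by (intro borel_measurable_continuous_onI continuous_intros)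
  from measurable_compose[OF this pgrad_measurable]
  have [measurable]: "(\<lambda>t. pgrad \<T> D (p + t *\<^sub>R \<nu>)) \<in> borel_measurable borel" .
  obtain C where C: "0 \<le> C" "\<And>x. norm (pgrad \<T> D x) \<le> C" using pgrad_bounded by blast
  have g_le: "norm (g t) \<le> norm (pgrad \<T> D (p + t *\<^sub>R \<nu>))" for t
    unfolding g_def real_norm_def
    using Cauchy_Schwarz_ineq2[of "pgrad \<T> D (p + t *\<^sub>R \<nu>)" \<nu>]
      mult_left_le[OF \<nu>, of "norm (pgrad \<T> D (p + t *\<^sub>R \<nu>))"] by auto
  have "set_integrable lborel {a..b} g"
    unfolding set_integrable_def
  proof (rule integrableI_bounded_set[where A="{a..b}" and B=C])
    show "AE x in lborel. x \<in> {a..b} \<longrightarrow> norm (indicat_real {a..b} x *\<^sub>R g x) \<le> C"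
      using C(2) order_trans[OF g_le] by (auto simp: indicator_def)
  qed (auto simp: g_def emeasure_lborel_Icc_eq)
  then have int: "integrable lborel (\<lambda>t. indicator {a..b} t *\<^sub>R g t)"
    and "(LINT t:{a..b}|lborel. g t) = f (p + b *\<^sub>R \<nu>) - f (p + a *\<^sub>R \<nu>)"
    using set_borel_integral_eq_integral(2)[of "{a..b}" g] I integral_unique
    by (auto simp: set_integrable_def)
  then have "f (p + b *\<^sub>R \<nu>) - f (p + a *\<^sub>R \<nu>) = (LINT t|lborel. indicator {a..b} t *\<^sub>R g t)"
    by (simp add: set_lebesgue_integral_def)
  then have "ennreal \<bar>f (p + b *\<^sub>R \<nu>) - f (p + a *\<^sub>R \<nu>)\<bar> \<le> (\<integral>\<^sup>+t. ennreal (norm (indicator {a..b} t *\<^sub>R g t)) \<partial>lborel)"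
    using integral_norm_bound_ennreal[OF int] by simp
  also have "\<dots> \<le> (\<integral>\<^sup>+t. ennreal (norm (pgrad \<T> D (p + t *\<^sub>R \<nu>))) * indicator {a..b} t \<partial>lborel)"
    using g_le by (intro nn_integral_mono) (auto simp: indicator_def intro!: ennreal_leI)
  finally show ?thesis .
qed

end

subsection \<open>Weak derivatives of piecewise differentiable functions\<close>

lemma test_function_smooth:
  assumes "\<phi> \<in> test_functions \<Omega>"
  shows "continuous_on UNIV \<phi>" "continuous_on UNIV (partial i \<phi>)"
    "(\<phi> has_derivative frechet_derivative \<phi> (at x)) (at x)"
proof -
  have s: "\<And>is. foldr partial is \<phi> differentiable_on UNIV"
    using assms by (simp add: test_functions_def smooth_def)
  from s[of "[]"] s[of "[i]"] show "continuous_on UNIV \<phi>" "continuous_on UNIV (partial i \<phi>)"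
    by (auto intro: differentiable_imp_continuous_on)
  from s[of "[]"] show "(\<phi> has_derivative frechet_derivative \<phi> (at x)) (at x)"
    by (simp add: differentiable_on_UNIV_at)
qed

lemma test_function_outside_support:
  assumes "\<phi> \<in> test_functions \<Omega>" "x \<notin> closure {x. \<phi> x \<noteq> 0}"
  shows "\<phi> x = 0" "partial i \<phi> x = 0"
proof -
  have z: "\<phi> y = 0" if "y \<notin> closure {x. \<phi> x \<noteq> 0}" for y
    using that closure_subset[of "{x. \<phi> x \<noteq> 0}"] by auto
  from z[OF assms(2)] show "\<phi> x = 0" .
  have "(\<phi> has_derivative (\<lambda>_. 0)) (at x)"
  proof (rule has_derivative_transform_within_open[of "\<lambda>_. 0" _ x UNIV "- closure {x. \<phi> x \<noteq> 0}"])
    show "0 = \<phi> y" if "y \<in> - closure {x. \<phi> x \<noteq> 0}" for y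
      using z[of y] that by (metis ComplD)
  qed (use assms in auto)
  from partial_has_derivative[OF this] show "partial i \<phi> x = 0" .
qed

lemma test_function_bounded:
  assumes "\<phi> \<in> test_functions \<Omega>"
  obtains C where "0 \<le> C" "\<And>x. \<bar>\<phi> x\<bar> \<le> C" "\<And>x. \<bar>partial i \<phi> x\<bar> \<le> C"
proof -
  let ?S = "closure {x. \<phi> x \<noteq> 0}"
  have "compact ?S" using assms by (simp add: test_functions_def)
  then have "bounded (\<phi> ` ?S)" "bounded (partial i \<phi> ` ?S)"
    using test_function_smooth[OF assms]
    by (auto intro!: compact_imp_bounded compact_continuous_image intro: continuous_on_subset)
  then obtain A B where AB: "0 < A" "\<And>x. x \<in> ?S \<Longrightarrow> \<bar>\<phi> x\<bar> \<le> A" "0 < B" "\<And>x. x \<in> ?S \<Longrightarrow> \<bar>partial i \<phi> x\<bar> \<le> B"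
    unfolding bounded_pos by (metis imageI real_norm_def)
  show ?thesis
  proof (rule that[of "A + B"])
    fix x
    consider "x \<in> ?S" | "\<phi> x = 0" "partial i \<phi> x = 0"
      using test_function_outside_support(1)[OF assms, of x] test_function_outside_support(2)[OF assms, of x i]
      by blast
    then have "\<bar>\<phi> x\<bar> \<le> A \<and> \<bar>partial i \<phi> x\<bar> \<le> B"
      by cases (use AB in auto)
    then show "\<bar>\<phi> x\<bar> \<le> A + B" "\<bar>partial i \<phi> x\<bar> \<le> A + B"
      using AB(1,3) by linarith+
  qed (use AB in auto)
qed

lemma L2_integrable:
  assumes "\<Omega> \<in> lmeasurable" "g \<in> L2 \<Omega>"
  shows "integrable (lebesgue_on \<Omega>) g"
proof (rule Bochner_Integration.integrable_bound)
  interpret finite_measure "lebesgue_on \<Omega>" using assms(1) by (rule finite_measure_lebesgue_on)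
  show "integrable (lebesgue_on \<Omega>) (\<lambda>x. 1 + (g x)\<^sup>2)" "g \<in> borel_measurable (lebesgue_on \<Omega>)"
    using assms(2) by (auto simp: L2_def)
  show "AE x in lebesgue_on \<Omega>. norm (g x) \<le> norm (1 + (g x)\<^sup>2)"
  proof (rule AE_I2)
    fix x
    have "0 \<le> (\<bar>g x\<bar> - 1)\<^sup>2" by simp
    then have "\<bar>g x\<bar> \<le> 1 + (g x)\<^sup>2"
      using abs_ge_zero[of "g x"] by (simp add: power2_diff)
    then show "norm (g x) \<le> norm (1 + (g x)\<^sup>2)" by simp
  qed
qed

lemma borel_lebesgue_on:
  fixes f :: "'a::euclidean_space \<Rightarrow> 'b::topological_space"
  assumes "f \<in> borel_measurable borel"
  shows "f \<in> borel_measurable (lebesgue_on \<Omega>)"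
proof -
  have "f \<in> borel_measurable lborel" using assms by simp
  from measurable_restrict_space1[OF measurable_completion[OF this]] show ?thesis .
qed

lemma weak_partial_unique:
  assumes \<Omega>: "open \<Omega>" "bounded \<Omega>" and g: "is_weak_partial \<Omega> i u g" and g': "is_weak_partial \<Omega> i u g'"
  shows "AE x in lebesgue_on \<Omega>. g x = g' x"
proof -
  have lm: "\<Omega> \<in> lmeasurable" using \<Omega> by (simp add: bounded_set_imp_lmeasurable lmeasurable_open)
  have int: "integrable (lebesgue_on \<Omega>) g" "integrable (lebesgue_on \<Omega>) g'"
    using g g' L2_integrable[OF lm] by (auto simp: is_weak_partial_def)
  have "AE x in lebesgue_on \<Omega>. g x - g' x = 0"
  proof (rule fundamental_lemma_calculus_of_variations[OF \<Omega>(1)])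
    show "integrable (lebesgue_on \<Omega>) (\<lambda>x. g x - g' x)" using int by simp
    fix \<phi> assume \<phi>: "\<phi> \<in> test_functions \<Omega>"
    obtain C where C: "0 \<le> C" "\<And>x. \<bar>\<phi> x\<bar> \<le> C" using test_function_bounded[OF \<phi>] by metis
    have "\<phi> \<in> borel_measurable borel"
      using test_function_smooth(1)[OF \<phi>] by (rule borel_measurable_continuous_onI)
    then have m: "\<phi> \<in> borel_measurable (lebesgue_on \<Omega>)"
      by (rule borel_lebesgue_on)
    have i: "integrable (lebesgue_on \<Omega>) (\<lambda>x. h x * \<phi> x)" if "integrable (lebesgue_on \<Omega>) h" for h
    proof (rule Bochner_Integration.integrable_bound)
      show "integrable (lebesgue_on \<Omega>) (\<lambda>x. C * h x)" using that by simp
      show "(\<lambda>x. h x * \<phi> x) \<in> borel_measurable (lebesgue_on \<Omega>)"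
        using m that by (intro borel_measurable_times) auto
      show "AE x in lebesgue_on \<Omega>. norm (h x * \<phi> x) \<le> norm (C * h x)"
        using C by (intro AE_I2) (auto simp: abs_mult mult.commute intro!: mult_right_mono)
    qed
    have "(LINT x|lebesgue_on \<Omega>. g x * \<phi> x) = (LINT x|lebesgue_on \<Omega>. g' x * \<phi> x)"
      using g g' \<phi> unfolding is_weak_partial_def by fastforce
    then show "(LINT x|lebesgue_on \<Omega>. (g x - g' x) * \<phi> x) = 0"
      using i[OF int(1)] i[OF int(2)] by (simp add: left_diff_distrib)
  qed
  then show ?thesis by eventually_elim simp
qed

text \<open>This makes the choice in \<open>weak_partial\<close> usable: any explicit weak
  derivative may replace it under an integral.\<close>

lemma weak_partial_AE:
  assumes "open \<Omega>" "bounded \<Omega>" "is_weak_partial \<Omega> i u g"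
  shows "is_weak_partial \<Omega> i u (weak_partial \<Omega> i u)"
    "AE x in lebesgue_on \<Omega>. weak_partial \<Omega> i u x = g x"
proof -
  show *: "is_weak_partial \<Omega> i u (weak_partial \<Omega> i u)"
    unfolding weak_partial_def using someI[of "is_weak_partial \<Omega> i u", OF assms(3)] .
  show "AE x in lebesgue_on \<Omega>. weak_partial \<Omega> i u x = g x"
    by (rule weak_partial_unique[OF assms(1,2) * assms(3)])
qed

lemma bounded_borel_L2:
  assumes "\<Omega> \<in> lmeasurable" "g \<in> borel_measurable (lebesgue_on \<Omega>)" "\<And>x. x \<in> \<Omega> \<Longrightarrow> \<bar>g x\<bar> \<le> C"
  shows "g \<in> L2 \<Omega>"
proof -
  interpret finite_measure "lebesgue_on \<Omega>" using assms(1) by (rule finite_measure_lebesgue_on)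
  have "integrable (lebesgue_on \<Omega>) (\<lambda>x. (g x)\<^sup>2)"
  proof (rule integrable_const_bound[where B="C\<^sup>2"])
    show "AE x in lebesgue_on \<Omega>. norm ((g x)\<^sup>2) \<le> C\<^sup>2"
    proof (rule AE_I2)
      fix x assume "x \<in> space (lebesgue_on \<Omega>)"
      then have "\<bar>g x\<bar> \<le> C" using assms(3) by (simp add: space_restrict_space)
      then show "norm ((g x)\<^sup>2) \<le> C\<^sup>2" by (simp add: abs_le_square_iff[symmetric])
    qed
  qed (use assms(2) in measurable)
  with assms(2) show ?thesis by (simp add: L2_def)
qed

lemma lebesgue_on_integral_eq_lborel:
  fixes k :: "real^2 \<Rightarrow> real"
  assumes "\<Omega> \<in> sets borel" "(\<lambda>x. indicator \<Omega> x * k x) \<in> borel_measurable borel"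
  shows "(LINT x|lebesgue_on \<Omega>. k x) = (LINT x|lborel. indicator \<Omega> x * k x)"
proof -
  have "(LINT x|lebesgue_on \<Omega>. k x) = (LINT x|lebesgue. indicator \<Omega> x * k x)"
    using assms(1) by (subst integral_restrict_space) auto
  also have "\<dots> = (LINT x|lborel. indicator \<Omega> x * k x)"
    using assms(2) by (intro integral_completion) auto
  finally show ?thesis .
qed

text \<open>On every line parallel to axis i the product of f and \<phi> is continuous,
  differentiable outside a finite set and zero far away, so its derivative has integral 0; Fubini
  gives the claim. Working on lines spares the interface terms of the divergence theorem on the
  pieces.\<close>

lemma piecewise_C1_is_weak_partial:
  assumes pw: "piecewise_C1 \<T> F D f" and \<Omega>: "open \<Omega>" "\<Omega> \<subseteq> \<Union>\<T>"
  shows "is_weak_partial \<Omega> i f (\<lambda>x. pgrad \<T> D x $ i)"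
  unfolding is_weak_partial_def
proof (intro conjI ballI)
  have bdd: "bounded \<Omega>"
    using piecewise_C1_compact[OF pw] \<Omega>(2) bounded_subset compact_imp_bounded by blast
  have lm: "\<Omega> \<in> lmeasurable" using \<Omega> bdd by (simp add: lmeasurable_open)
  define g where "g = (\<lambda>x. pgrad \<T> D x $ i)"
  have [measurable]: "pgrad \<T> D \<in> borel_measurable borel" using pgrad_measurable[OF pw] .
  have "(\<lambda>v::real^2. v $ i) \<in> borel_measurable borel"
    by (intro borel_measurable_continuous_onI continuous_intros)
  from measurable_compose[OF \<open>pgrad \<T> D \<in> borel_measurable borel\<close> this]
  have [measurable]: "g \<in> borel_measurable borel" unfolding g_def .
  obtain Cg where Cg: "0 \<le> Cg" "\<And>x. \<bar>g x\<bar> \<le> Cg"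
  proof (rule pgrad_bounded[OF pw])
    fix C assume C: "0 \<le> C" "\<And>x. norm (pgrad \<T> D x) \<le> C"
    show ?thesis
      by (rule that[OF C(1)]) (use component_le_norm_cart order_trans C(2) in \<open>unfold g_def, blast\<close>)
  qed
  show "(\<lambda>x. pgrad \<T> D x $ i) \<in> L2 \<Omega>"
    unfolding g_def[symmetric]
    by (rule bounded_borel_L2[OF lm borel_lebesgue_on, of _ Cg])
      (use Cg \<open>g \<in> borel_measurable borel\<close> in auto)
  fix \<phi> assume \<phi>: "\<phi> \<in> test_functions \<Omega>"
  obtain C where C: "0 \<le> C" "\<And>x. \<bar>\<phi> x\<bar> \<le> C" "\<And>x. \<bar>partial i \<phi> x\<bar> \<le> C"
    using test_function_bounded[OF \<phi>] by metis
  define S where "S = closure {x. \<phi> x \<noteq> 0}"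
  have S: "closed S" "S \<subseteq> \<Omega>" using \<phi> by (auto simp: S_def test_functions_def)
  note outside = test_function_outside_support[OF \<phi>, folded S_def]
  have \<phi>m[measurable]: "\<phi> \<in> borel_measurable borel" "partial i \<phi> \<in> borel_measurable borel"
    using test_function_smooth(1,2)[OF \<phi>] by (auto intro: borel_measurable_continuous_onI)
  have f_cont: "continuous_on \<Omega> f"
    using piecewise_C1_continuous_on[OF pw] \<Omega>(2) continuous_on_subset by blast
  have [measurable]: "\<Omega> \<in> sets borel" using \<Omega> by simp
  have fm[measurable]: "(\<lambda>x. indicator \<Omega> x * f x) \<in> borel_measurable borel"
    using borel_measurable_continuous_on_indicator[OF _ f_cont] by simp
  have "bounded (f ` \<Omega>)"
    using compact_imp_bounded[OF compact_continuous_image[OF piecewise_C1_continuous_on[OF pw] piecewise_C1_compact[OF pw]]]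
      \<Omega>(2) by (meson bounded_subset image_mono)
  then obtain Cf where Cf: "0 < Cf" "\<And>x. x \<in> \<Omega> \<Longrightarrow> \<bar>f x\<bar> \<le> Cf"
    unfolding bounded_pos by (metis imageI real_norm_def)
  \<comment> \<open>Extended by zero, both integrands live on the plane; \<open>w\<close> is the
    derivative of the product along axis i.\<close>
  define a1 where "a1 = (\<lambda>x. indicator \<Omega> x * (f x * partial i \<phi> x))"
  define a2 where "a2 = (\<lambda>x. indicator \<Omega> x * (g x * \<phi> x))"
  define w where "w x = a1 x + a2 x" for x
  have am[measurable]: "a1 \<in> borel_measurable borel" "a2 \<in> borel_measurable borel"
    unfolding a1_def a2_def mult.assoc[symmetric] by measurable
  have fin: "emeasure lborel \<Omega> < \<infinity>" using bdd by (rule emeasure_bounded_finite)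
  have a1_bd: "\<bar>a1 x\<bar> \<le> Cf * C" and a2_bd: "\<bar>a2 x\<bar> \<le> Cg * C" for x
    using Cf C Cg less_imp_le[OF Cf(1)]
    by (auto simp: a1_def a2_def indicator_def abs_mult intro!: mult_mono)
  have a1: "integrable lborel a1"
  proof (rule integrableI_bounded_set[of \<Omega> _ _ "Cf * C"])
    show "AE x in lborel. x \<in> \<Omega> \<longrightarrow> norm (a1 x) \<le> Cf * C" by (simp add: a1_bd)
    show "AE x in lborel. x \<notin> \<Omega> \<longrightarrow> a1 x = 0" by (simp add: a1_def)
  qed (use fin am in auto)
  have a2: "integrable lborel a2"
  proof (rule integrableI_bounded_set[of \<Omega> _ _ "Cg * C"])
    show "AE x in lborel. x \<in> \<Omega> \<longrightarrow> norm (a2 x) \<le> Cg * C" by (simp add: a2_bd)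
    show "AE x in lborel. x \<notin> \<Omega> \<longrightarrow> a2 x = 0" by (simp add: a2_def)
  qed (use fin am in auto)
  have w: "integrable lborel w" using a1 a2 by (simp add: w_def[abs_def])
  obtain j where ij: "i \<noteq> j"
    using exhaust_2[of i] by (cases "i = 1") (auto intro: that[of 2] that[of 1])
  have line: "(LINT t|lborel. w (t *\<^sub>R axis i 1 + s *\<^sub>R axis j 1)) = 0" for s
  proof -
    define p :: "real^2" where "p = s *\<^sub>R axis j 1"
    define \<nu> :: "real^2" where "\<nu> = axis i 1"
    \<comment> \<open>Cutting off outside \<Omega> makes \<open>H\<close> differentiable also where
      the line leaves \<Omega>: off the support of \<phi> it vanishes in a neighbourhood, and on the
      support it is locally the plain product.\<close>
    define H where "H t = indicator \<Omega> (p + t *\<^sub>R \<nu>) * (f (p + t *\<^sub>R \<nu>) * \<phi> (p + t *\<^sub>R \<nu>))" for t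
    obtain R where R: "0 < R" "\<And>x. x \<in> \<Omega> \<Longrightarrow> norm x \<le> R" using bdd unfolding bounded_pos by blast
    have far: "p + t *\<^sub>R \<nu> \<notin> \<Omega>" if "\<bar>t\<bar> > R" for t
    proof
      assume "p + t *\<^sub>R \<nu> \<in> \<Omega>"
      then have "\<bar>(p + t *\<^sub>R \<nu>) $ i\<bar> \<le> R" using R(2) component_le_norm_cart order_trans by blast
      moreover have "(p + t *\<^sub>R \<nu>) $ i = t" using ij by (simp add: p_def \<nu>_def axis_def)
      ultimately show False using that by simp
    qed
    have line_cont: "continuous_on UNIV (\<lambda>t. p + t *\<^sub>R \<nu>)" by (intro continuous_intros)
    have near: "\<forall>\<^sub>F t' in nhds t. p + t' *\<^sub>R \<nu> \<in> V" if "open V" "p + t *\<^sub>R \<nu> \<in> V" for t V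
      using eventually_nhds_in_open[OF open_vimage[OF that(1) line_cont], of t] that(2) by simp
    have H0: "(H has_real_derivative 0) (at t)" "w (p + t *\<^sub>R \<nu>) = 0" if "p + t *\<^sub>R \<nu> \<notin> S" for t
    proof -
      have "\<forall>\<^sub>F t' in nhds t. 0 = H t'"
        using near[OF open_Compl[OF S(1)], of t] that outside(1)
        by (auto simp: H_def elim!: eventually_mono)
      then show "(H has_real_derivative 0) (at t)"
        by (rule DERIV_cong_ev[OF refl _ refl, THEN iffD1]) simp
      show "w (p + t *\<^sub>R \<nu>) = 0" using outside that by (simp add: w_def a1_def a2_def)
    qed
    obtain E where E: "finite E"
      "\<And>t. t \<notin> E \<Longrightarrow> p + t *\<^sub>R \<nu> \<in> \<Union>\<T> \<Longrightarrow>
         ((\<lambda>t. f (p + t *\<^sub>R \<nu>)) has_real_derivative pgrad \<T> D (p + t *\<^sub>R \<nu>) \<bullet> \<nu>) (at t)"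
      using piecewise_C1_line[OF pw] by blast
    have \<phi>_der: "((\<lambda>t. \<phi> (p + t *\<^sub>R \<nu>)) has_real_derivative partial i \<phi> (p + t *\<^sub>R \<nu>)) (at t)" for t
    proof -
      note d0 = test_function_smooth(3)[OF \<phi>, of "p + t *\<^sub>R \<nu>"]
      have d1: "((\<lambda>t. p + t *\<^sub>R \<nu>) has_derivative (\<lambda>s. s *\<^sub>R \<nu>)) (at t)"
        by (auto intro!: derivative_eq_intros)
      have "((\<lambda>t. \<phi> (p + t *\<^sub>R \<nu>)) has_derivative
          (\<lambda>s. frechet_derivative \<phi> (at (p + t *\<^sub>R \<nu>)) (s *\<^sub>R \<nu>))) (at t)"
        by (rule has_derivative_compose[OF d1 d0])
      then show ?thesis
        using linear_cmul[OF has_derivative_linear[OF d0]]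
        by (simp add: has_field_derivative_def partial_def \<nu>_def mult_commute_abs)
    qed
    have H_near: "\<forall>\<^sub>F t' in nhds t. f (p + t' *\<^sub>R \<nu>) * \<phi> (p + t' *\<^sub>R \<nu>) = H t'"
      if "p + t *\<^sub>R \<nu> \<in> \<Omega>" for t
      using near[OF \<Omega>(1) that] by eventually_elim (simp add: H_def)
    have H1: "(H has_real_derivative w (p + t *\<^sub>R \<nu>)) (at t)" if "t \<notin> E" "p + t *\<^sub>R \<nu> \<in> S" for t
    proof -
      have "p + t *\<^sub>R \<nu> \<in> \<Omega>" using that S by auto
      then have "((\<lambda>t. f (p + t *\<^sub>R \<nu>)) has_real_derivative g (p + t *\<^sub>R \<nu>)) (at t)"
        using E(2)[OF that(1)] \<Omega>(2) by (auto simp: g_def \<nu>_def inner_axis)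
      from DERIV_mult[OF this \<phi>_der]
      have "((\<lambda>t. f (p + t *\<^sub>R \<nu>) * \<phi> (p + t *\<^sub>R \<nu>)) has_real_derivative w (p + t *\<^sub>R \<nu>)) (at t)"
        using \<open>p + t *\<^sub>R \<nu> \<in> \<Omega>\<close> by (simp add: w_def a1_def a2_def algebra_simps)
      then show ?thesis
        by (rule DERIV_cong_ev[OF refl _ refl, THEN iffD1, OF H_near[OF \<open>p + t *\<^sub>R \<nu> \<in> \<Omega>\<close>]])
    qed
    have H_cont: "isCont H t" for t
    proof (cases "p + t *\<^sub>R \<nu> \<in> S")
      case True
      then have in\<Omega>: "p + t *\<^sub>R \<nu> \<in> \<Omega>" using S by auto
      then have "isCont f (p + t *\<^sub>R \<nu>)" using f_cont \<Omega>(1) continuous_on_eq_continuous_at by blast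
      moreover have "isCont (\<lambda>t. p + t *\<^sub>R \<nu>) t" by (intro continuous_intros)
      ultimately have "isCont (\<lambda>t. f (p + t *\<^sub>R \<nu>)) t" by (rule isCont_o2[rotated])
      then have "isCont (\<lambda>t. f (p + t *\<^sub>R \<nu>) * \<phi> (p + t *\<^sub>R \<nu>)) t"
        using DERIV_isCont[OF \<phi>_der] by (rule continuous_mult)
      then show ?thesis using isCont_cong[OF H_near[OF in\<Omega>]] by simp
    next
      case False
      then show ?thesis by (rule DERIV_isCont[OF H0(1)])
    qed
    have deriv: "(H has_vector_derivative w (p + t *\<^sub>R \<nu>)) (at t)" if "t \<notin> E" for t
      using H0[of t] H1[OF that]
      by (cases "p + t *\<^sub>R \<nu> \<in> S") (auto simp flip: has_real_derivative_iff_has_vector_derivative)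
    have "((\<lambda>t. w (p + t *\<^sub>R \<nu>)) has_integral H (R + 1) - H (- (R + 1))) {- (R + 1)..R + 1}"
      using R(1) deriv H_cont
      by (intro fundamental_theorem_of_calculus_interior_strong[OF E(1)])
        (auto intro: continuous_at_imp_continuous_on)
    moreover have "H (R + 1) = 0" "H (- (R + 1)) = 0" using far R(1) by (auto simp: H_def)
    ultimately have "((\<lambda>t. w (p + t *\<^sub>R \<nu>)) has_integral 0) {- (R + 1)..R + 1}" by simp
    then have I0: "((\<lambda>t. w (p + t *\<^sub>R \<nu>)) has_integral 0) UNIV"
    proof (rule has_integral_on_superset)
      show "w (p + t *\<^sub>R \<nu>) = 0" if "t \<notin> {- (R + 1)..R + 1}" for t
      proof -
        have "\<bar>t\<bar> > R" using that by auto
        then show ?thesis using far by (simp add: w_def a1_def a2_def)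
      qed
    qed simp
    have [measurable]: "w \<in> borel_measurable borel" unfolding w_def[abs_def] by measurable
    have "integrable lborel (\<lambda>t. w (p + t *\<^sub>R \<nu>))"
    proof (rule integrableI_bounded_set[of "{-R..R}" _ _ "Cf * C + Cg * C"])
      have "(\<lambda>t. p + t *\<^sub>R \<nu>) \<in> borel_measurable borel" by (intro borel_measurable_continuous_onI line_cont)
      then show "(\<lambda>t. w (p + t *\<^sub>R \<nu>)) \<in> borel_measurable lborel" by measurable
      show "AE t in lborel. t \<in> {- R..R} \<longrightarrow> norm (w (p + t *\<^sub>R \<nu>)) \<le> Cf * C + Cg * C"
      proof (intro AE_I2 impI)
        fix t show "norm (w (p + t *\<^sub>R \<nu>)) \<le> Cf * C + Cg * C"
          using a1_bd[of "p + t *\<^sub>R \<nu>"] a2_bd[of "p + t *\<^sub>R \<nu>"] unfolding w_def by simp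
      qed
      show "AE t in lborel. t \<notin> {- R..R} \<longrightarrow> w (p + t *\<^sub>R \<nu>) = 0"
        using far by (intro AE_I2) (auto simp: w_def a1_def a2_def)
    qed (auto simp: emeasure_lborel_Icc_eq)
    from has_integral_integral_lborel[OF this] I0
    have "(LINT t|lborel. w (p + t *\<^sub>R \<nu>)) = 0" by (metis has_integral_unique)
    then show ?thesis by (simp add: p_def \<nu>_def add.commute)
  qed
  have "(LINT x|lborel. w x) = 0"
    by (subst integral_real2_iterated[OF ij w]) (simp add: line)
  then have "(LINT x|lborel. a1 x) = - (LINT x|lborel. a2 x)"
    using a1 a2 by (simp add: w_def)
  moreover have "(LINT x|lebesgue_on \<Omega>. f x * partial i \<phi> x) = (LINT x|lborel. a1 x)"
    unfolding a1_def by (rule lebesgue_on_integral_eq_lborel) (use am(1) in \<open>auto simp flip: a1_def\<close>)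
  moreover have "(LINT x|lebesgue_on \<Omega>. g x * \<phi> x) = (LINT x|lborel. a2 x)"
    unfolding a2_def by (rule lebesgue_on_integral_eq_lborel) (use am(2) in \<open>auto simp flip: a2_def\<close>)
  ultimately show "(LINT x|lebesgue_on \<Omega>. f x * partial i \<phi> x) = - (LINT x|lebesgue_on \<Omega>. pgrad \<T> D x $ i * \<phi> x)"
    by (simp add: g_def)
qed

subsection \<open>Integrals of products of weak gradients\<close>

lemma pgrad_add_scaleR:
  "pgrad \<T> (\<lambda>K x. D K x + c *\<^sub>R D' K x) x = pgrad \<T> D x + c *\<^sub>R pgrad \<T> D' x"
proof -
  have "(\<Sum>K\<in>\<T>. indicator K x *\<^sub>R (D K x + c *\<^sub>R D' K x)) =
      (\<Sum>K\<in>\<T>. indicator K x *\<^sub>R D K x) + c *\<^sub>R (\<Sum>K\<in>\<T>. indicator K x *\<^sub>R D' K x)"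
    by (simp add: scaleR_add_right sum.distrib scaleR_sum_right mult.commute)
  then show ?thesis by (simp add: pgrad_def scaleR_add_right mult.commute)
qed

context
  fixes \<Omega> :: "(real^2) set" and \<T> F D f
  assumes pw: "piecewise_C1 \<T> F D f" and \<Omega>: "open \<Omega>" "\<Omega> \<subseteq> \<Union>\<T>"
begin

lemma piecewise_C1_lmeasurable: "bounded \<Omega>" "\<Omega> \<in> lmeasurable"
proof -
  show "bounded \<Omega>"
    using piecewise_C1_compact[OF pw] \<Omega>(2) bounded_subset compact_imp_bounded by blast
  then show "\<Omega> \<in> lmeasurable" using \<Omega> by (simp add: lmeasurable_open)
qed

lemma weak_partial_piecewise_C1:
  "AE x in lebesgue_on \<Omega>. weak_partial \<Omega> i f x = pgrad \<T> D x $ i"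
  "weak_partial \<Omega> i f \<in> borel_measurable (lebesgue_on \<Omega>)"
  "(\<lambda>x. pgrad \<T> D x $ i) \<in> borel_measurable (lebesgue_on \<Omega>)"
proof -
  note w = weak_partial_AE[OF \<Omega>(1) piecewise_C1_lmeasurable(1) piecewise_C1_is_weak_partial[OF pw \<Omega>]]
  show "AE x in lebesgue_on \<Omega>. weak_partial \<Omega> i f x = pgrad \<T> D x $ i" by (rule w(2))
  show "weak_partial \<Omega> i f \<in> borel_measurable (lebesgue_on \<Omega>)"
    using w(1) by (simp add: is_weak_partial_def L2_def)
  show "(\<lambda>x. pgrad \<T> D x $ i) \<in> borel_measurable (lebesgue_on \<Omega>)"
    using piecewise_C1_is_weak_partial[OF pw \<Omega>] by (simp add: is_weak_partial_def L2_def)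
qed

lemma piecewise_C1_L2: "f \<in> L2 \<Omega>"
proof -
  have "continuous_on \<Omega> f" using piecewise_C1_continuous_on[OF pw] \<Omega>(2) continuous_on_subset by blast
  then have m: "f \<in> borel_measurable (lebesgue_on \<Omega>)"
    using \<Omega> by (intro continuous_imp_measurable_on_sets_lebesgue) auto
  have "bounded (f ` \<Union>\<T>)"
    by (intro compact_imp_bounded compact_continuous_image piecewise_C1_continuous_on[OF pw] piecewise_C1_compact[OF pw])
  then obtain C where "\<And>x. x \<in> \<Union>\<T> \<Longrightarrow> \<bar>f x\<bar> \<le> C" by (auto simp: bounded_iff)
  then show ?thesis
    by (rule bounded_borel_L2[OF piecewise_C1_lmeasurable(2) m]) (use \<Omega>(2) in blast)
qed

lemma piecewise_C1_H1: "f \<in> H1 \<Omega>"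
  unfolding H1_def
  by (intro CollectI conjI allI exI, rule piecewise_C1_L2, rule piecewise_C1_is_weak_partial[OF pw \<Omega>])

end

lemma dirichlet_form_piecewise_C1:
  assumes pw: "piecewise_C1 \<T> F D f" and pw': "piecewise_C1 \<T>' F' D' f'"
    and \<Omega>: "open \<Omega>" "\<Omega> \<subseteq> \<Union>\<T>" "\<Omega> \<subseteq> \<Union>\<T>'"
  shows "dirichlet_form \<Omega> f f' = (LINT x|lebesgue_on \<Omega>. pgrad \<T> D x \<bullet> pgrad \<T>' D' x)"
  unfolding dirichlet_form_def
proof (rule integral_cong_AE)
  note w = weak_partial_piecewise_C1[OF pw \<Omega>(1,2)] weak_partial_piecewise_C1[OF pw' \<Omega>(1,3)]
  show "(\<lambda>x. \<Sum>i\<in>UNIV. weak_partial \<Omega> i f x * weak_partial \<Omega> i f' x) \<in> borel_measurable (lebesgue_on \<Omega>)"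
    using w by (intro borel_measurable_sum borel_measurable_times) auto
  have "(\<lambda>x. pgrad \<T> D x \<bullet> pgrad \<T>' D' x) = (\<lambda>x. \<Sum>i\<in>UNIV. pgrad \<T> D x $ i * pgrad \<T>' D' x $ i)"
    by (simp add: inner_vec_def)
  then show "(\<lambda>x. pgrad \<T> D x \<bullet> pgrad \<T>' D' x) \<in> borel_measurable (lebesgue_on \<Omega>)"
    using w by (auto intro!: borel_measurable_sum borel_measurable_times)
  have "AE x in lebesgue_on \<Omega>. \<forall>i\<in>UNIV. weak_partial \<Omega> i f x = pgrad \<T> D x $ i \<and>
      weak_partial \<Omega> i f' x = pgrad \<T>' D' x $ i"
    using w by (intro AE_finite_allI) auto
  then show "AE x in lebesgue_on \<Omega>. (\<Sum>i\<in>UNIV. weak_partial \<Omega> i f x * weak_partial \<Omega> i f' x) =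
      pgrad \<T> D x \<bullet> pgrad \<T>' D' x"
    by eventually_elim (simp add: inner_vec_def)
qed

lemma H1_seminorm_eq_dirichlet_form: "H1_seminorm \<Omega> u = sqrt (dirichlet_form \<Omega> u u)"
  by (simp add: H1_seminorm_def dirichlet_form_def power2_eq_square)

lemma pgrad_inner_integrable:
  assumes pw: "piecewise_C1 \<T> F D f" and pw': "piecewise_C1 \<T>' F' D' f'" and \<Omega>: "open \<Omega>" "\<Omega> \<subseteq> \<Union>\<T>"
  shows "integrable (lebesgue_on \<Omega>) (\<lambda>x. pgrad \<T> D x \<bullet> pgrad \<T>' D' x)"
proof -
  have lm: "\<Omega> \<in> lmeasurable" by (rule piecewise_C1_lmeasurable[OF pw \<Omega>])
  interpret finite_measure "lebesgue_on \<Omega>" using lm by (rule finite_measure_lebesgue_on)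
  obtain C where C: "0 \<le> C" "\<And>x. norm (pgrad \<T> D x) \<le> C" using pgrad_bounded[OF pw] by blast
  obtain C' where C': "0 \<le> C'" "\<And>x. norm (pgrad \<T>' D' x) \<le> C'" using pgrad_bounded[OF pw'] by blast
  show ?thesis
  proof (rule integrable_const_bound[where B="C * C'"])
    show "AE x in lebesgue_on \<Omega>. norm (pgrad \<T> D x \<bullet> pgrad \<T>' D' x) \<le> C * C'"
    proof (rule AE_I2)
      fix x
      have "norm (pgrad \<T> D x \<bullet> pgrad \<T>' D' x) \<le> norm (pgrad \<T> D x) * norm (pgrad \<T>' D' x)"
        using Cauchy_Schwarz_ineq2 by simp
      also have "\<dots> \<le> C * C'" using C C' by (intro mult_mono) auto
      finally show "norm (pgrad \<T> D x \<bullet> pgrad \<T>' D' x) \<le> C * C'" .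
    qed
    have [measurable]: "pgrad \<T> D \<in> borel_measurable borel" "pgrad \<T>' D' \<in> borel_measurable borel"
      using pgrad_measurable[OF pw] pgrad_measurable[OF pw'] .
    show "(\<lambda>x. pgrad \<T> D x \<bullet> pgrad \<T>' D' x) \<in> borel_measurable (lebesgue_on \<Omega>)"
      by (intro borel_lebesgue_on) measurable
  qed
qed

subsection \<open>Finite elements on conforming triangulations\<close>

lemma two_simplex_facts:
  fixes K :: "(real^2) set"
  assumes "2 simplex K"
  shows "convex K" "compact K" "interior K \<noteq> {}" "finite {x. x extreme_point_of K}"
    "convex hull {x. x extreme_point_of K} = K"
proof -
  obtain C where C: "\<not> affine_dependent C" "int (card C) = 2 + 1" "K = convex hull C"
    using assms by (auto simp: simplex_def)
  have fC: "finite C" using C(2) by (metis card.infinite of_nat_0 zero_neq_numeral one_plus_numeral add.commute numeral_eq_iff semiring_norm)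
  show "convex K" using C by simp
  show "compact K" using C fC by (simp add: finite_imp_compact_convex_hull)
  have ext: "{x. x extreme_point_of K} = C"
    using extreme_point_of_convex_hull_affine_independent[OF C(1)] C(3) by auto
  with fC C show "finite {x. x extreme_point_of K}" "convex hull {x. x extreme_point_of K} = K" by auto
  have "aff_dim K = 2"
    using C aff_dim_convex_hull[of C] aff_dim_affine_independent[OF C(1)] by simp
  then have "interior K = rel_interior K" by (simp add: interior_rel_interior_gen)
  moreover have "K \<noteq> {}" using C(2,3) by auto
  ultimately show "interior K \<noteq> {}" using rel_interior_eq_empty[OF \<open>convex K\<close>] by simp
qed

lemma affine_eq_on_interior:
  fixes a a' :: "real^2"
  assumes "interior K \<noteq> {}" "\<And>x. x \<in> K \<Longrightarrow> a \<bullet> x + b = a' \<bullet> x + b'"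
  shows "a = a'"
proof -
  obtain x where "x \<in> interior K" using assms(1) by auto
  then obtain e where e: "e > 0" "ball x e \<subseteq> K" by (meson mem_interior)
  define d where "d = a - a'"
  \<comment> \<open>The step t * norm d stays below the radius e; the summand 1 keeps the
    denominator positive when d = 0.\<close>
  define t where "t = e / (2 * (norm d + 1))"
  have d1: "norm d + 1 > 0" by (simp add: add_nonneg_pos)
  then have t: "t > 0" using e by (simp add: t_def)
  have "t * (2 * (norm d + 1)) = e"
    using d1 nonzero_eq_divide_eq[of "2 * (norm d + 1)" t e] t_def by simp
  then have "2 * (t * norm d) + 2 * t = e" by (simp add: algebra_simps)
  moreover have "t * norm d \<ge> 0" using t by simp
  ultimately have "t * norm d < e" using t by linarith
  then have "x + t *\<^sub>R d \<in> K" "x \<in> K"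
    using e t by (auto simp: dist_norm intro!: subsetD[OF e(2)])
  from assms(2)[OF this(1)] assms(2)[OF this(2)]
  have "a \<bullet> (t *\<^sub>R d) = a' \<bullet> (t *\<^sub>R d)" by (simp only: inner_add_right)
  then have "t * (d \<bullet> d) = 0" by (simp add: d_def inner_diff_left inner_diff_right algebra_simps)
  then show ?thesis using t by (simp add: d_def)
qed

definition slope :: "(real^2 \<Rightarrow> real) \<Rightarrow> (real^2) set \<Rightarrow> real^2" where
  "slope v K = (SOME a. \<exists>b. \<forall>x\<in>K. v x = a \<bullet> x + b)"

text \<open>Chosen relative to \<open>slope v K\<close>, so that the two choices belong to the same
  affine function.\<close>

definition offset :: "(real^2 \<Rightarrow> real) \<Rightarrow> (real^2) set \<Rightarrow> real" where
  "offset v K = (SOME b. \<forall>x\<in>K. v x = slope v K \<bullet> x + b)"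

lemma fe_space_slope_offset:
  assumes "v \<in> fe_space \<T>" "K \<in> \<T>" "x \<in> K"
  shows "v x = slope v K \<bullet> x + offset v K"
proof -
  have "\<exists>a b. \<forall>x\<in>K. v x = a \<bullet> x + b" using assms by (auto simp: fe_space_def)
  then have "\<exists>b. \<forall>x\<in>K. v x = slope v K \<bullet> x + b" unfolding slope_def by (rule someI_ex)
  then have "\<forall>x\<in>K. v x = slope v K \<bullet> x + offset v K" unfolding offset_def by (rule someI_ex)
  then show ?thesis using assms(3) by blast
qed

lemma slope_eqI:
  fixes K :: "(real^2) set"
  assumes "interior K \<noteq> {}" "\<And>x. x \<in> K \<Longrightarrow> v x = a \<bullet> x + b"
  shows "slope v K = a"
proof -
  have "\<exists>a b. \<forall>x\<in>K. v x = a \<bullet> x + b" using assms(2) by blast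
  then have "\<exists>b. \<forall>x\<in>K. v x = slope v K \<bullet> x + b" unfolding slope_def by (rule someI_ex)
  then obtain b' where "\<forall>x\<in>K. v x = slope v K \<bullet> x + b'" by blast
  then show ?thesis using assms affine_eq_on_interior[OF assms(1), of "slope v K" b' a b] by simp
qed

context
  fixes \<Omega> :: "(real^2) set" and \<T> :: "(real^2) set set"
  assumes tri: "conforming_triangulation \<Omega> \<T>" and op: "open \<Omega>"
begin

lemma triangulation_facts:
  shows "finite \<T>" "\<Union>\<T> = closure \<Omega>" "\<Omega> \<subseteq> \<Union>\<T>"
    "K \<in> \<T> \<Longrightarrow> 2 simplex K" "K \<in> \<T> \<Longrightarrow> K' \<in> \<T> \<Longrightarrow> K \<inter> K' face_of K"
proof -
  show "finite \<T>" and u: "\<Union>\<T> = closure \<Omega>"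
    using tri by (auto simp: conforming_triangulation_def triangulation_def)
  show "\<Omega> \<subseteq> \<Union>\<T>" unfolding u by (rule closure_subset)
  show "K \<in> \<T> \<Longrightarrow> 2 simplex K"
    using tri unfolding conforming_triangulation_def by blast
  show "K \<in> \<T> \<Longrightarrow> K' \<in> \<T> \<Longrightarrow> K \<inter> K' face_of K"
    using tri unfolding conforming_triangulation_def triangulation_def by blast
qed

text \<open>The intersection is a face of both triangles, and a face that meets the interior is the
  whole set.\<close>

lemma triangulation_interior_unique:
  assumes "K \<in> \<T>" "K' \<in> \<T>" "x \<in> interior K" "x \<in> K'"
  shows "K' = K"
proof -
  have f1: "K \<inter> K' face_of K" using triangulation_facts(5)[OF assms(1,2)] .
  have f2: "K' \<inter> K face_of K'" using triangulation_facts(5)[OF assms(2,1)] .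
  have x: "x \<in> K" using assms(3) interior_subset by auto
  have eq: "K \<inter> K' = K" using face_of_disjoint_interior[OF f1] assms(3,4) x by auto
  then have "x \<in> interior K'" using assms(3) interior_mono[of K K'] by auto
  then have "K' \<inter> K = K'" using face_of_disjoint_interior[OF f2] x assms(4) by auto
  with eq show ?thesis by auto
qed

lemma pgrad_interior:
  assumes "K \<in> \<T>" "x \<in> interior K"
  shows "pgrad \<T> D x = D K x"
proof -
  have "pgrad \<T> D x \<bullet> v = D K x \<bullet> v" for v
  proof (rule pgrad_eqI)
    show "x \<in> \<Union>\<T>" using assms interior_subset by blast
    show "D K' x \<bullet> v = D K x \<bullet> v" if "K' \<in> \<T>" "x \<in> K'" for K'
      using triangulation_interior_unique[OF assms(1) that(1) assms(2) that(2)] by simp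
  qed (rule triangulation_facts)
  then show ?thesis by (meson vector_eq_rdot)
qed

lemma fe_space_piecewise_C1:
  assumes "v \<in> fe_space \<T>"
  shows "piecewise_C1 \<T> (\<lambda>K x. slope v K \<bullet> x + offset v K) (\<lambda>K x. slope v K) v"
  unfolding piecewise_C1_def
proof (intro conjI ballI allI)
  fix K assume K: "K \<in> \<T>"
  show "convex K" "compact K" using two_simplex_facts(1,2)[OF triangulation_facts(4)[OF K]] by auto
  show "((\<lambda>x. slope v K \<bullet> x + offset v K) has_derivative (\<bullet>) (slope v K)) (at x)" for x
    by (rule derivative_eq_intros | rule refl)+ simp
  show "v x = slope v K \<bullet> x + offset v K" if "x \<in> K" for x
    by (rule fe_space_slope_offset[OF assms K that])
qed (auto simp: triangulation_facts(1))

lemma fe_space_diff_scale: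
  assumes "v \<in> fe_space \<T>" "w \<in> fe_space \<T>"
  shows "(\<lambda>x. v x - c * w x) \<in> fe_space \<T>"
    and "K \<in> \<T> \<Longrightarrow> slope (\<lambda>x. v x - c * w x) K = slope v K - c *\<^sub>R slope w K"
proof -
  have eq: "v x - c * w x = (slope v K - c *\<^sub>R slope w K) \<bullet> x + (offset v K - c * offset w K)"
    if "K \<in> \<T>" "x \<in> K" for K x
    using fe_space_slope_offset[OF assms(1) that] fe_space_slope_offset[OF assms(2) that]
    by (simp add: inner_diff_left algebra_simps)
  then have "\<forall>K\<in>\<T>. \<exists>a b. \<forall>x\<in>K. v x - c * w x = a \<bullet> x + b" by blast
  moreover have "continuous_on (\<Union>\<T>) (\<lambda>x. v x - c * w x)"
    using assms by (auto simp: fe_space_def intro!: continuous_intros)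
  ultimately show "(\<lambda>x. v x - c * w x) \<in> fe_space \<T>" by (simp add: fe_space_def)
  show "slope (\<lambda>x. v x - c * w x) K = slope v K - c *\<^sub>R slope w K" if "K \<in> \<T>"
    using eq[OF that] two_simplex_facts(3)[OF triangulation_facts(4)[OF that]] by (intro slope_eqI)
qed

lemma dirichlet_form_fe_space:
  assumes "v \<in> fe_space \<T>" "w \<in> fe_space \<T>"
  shows "dirichlet_form \<Omega> v w =
      (LINT x|lebesgue_on \<Omega>. pgrad \<T> (\<lambda>K x. slope v K) x \<bullet> pgrad \<T> (\<lambda>K x. slope w K) x)"
    and "integrable (lebesgue_on \<Omega>) (\<lambda>x. pgrad \<T> (\<lambda>K x. slope v K) x \<bullet> pgrad \<T> (\<lambda>K x. slope w K) x)"
proof -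
  note p = fe_space_piecewise_C1[OF assms(1)] fe_space_piecewise_C1[OF assms(2)]
  show "dirichlet_form \<Omega> v w =
      (LINT x|lebesgue_on \<Omega>. pgrad \<T> (\<lambda>K x. slope v K) x \<bullet> pgrad \<T> (\<lambda>K x. slope w K) x)"
    by (rule dirichlet_form_piecewise_C1[OF p op triangulation_facts(3) triangulation_facts(3)])
  show "integrable (lebesgue_on \<Omega>) (\<lambda>x. pgrad \<T> (\<lambda>K x. slope v K) x \<bullet> pgrad \<T> (\<lambda>K x. slope w K) x)"
    by (rule pgrad_inner_integrable[OF p op triangulation_facts(3)])
qed

lemma dirichlet_form_diff_scale:
  assumes "u \<in> fe_space \<T>" "v \<in> fe_space \<T>" "w \<in> fe_space \<T>"
  shows "dirichlet_form \<Omega> u (\<lambda>x. v x - c * w x) = dirichlet_form \<Omega> u v - c * dirichlet_form \<Omega> u w"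
proof -
  have "pgrad \<T> (\<lambda>K x. slope (\<lambda>x. v x - c * w x) K) y =
      pgrad \<T> (\<lambda>K x. slope v K) y - c *\<^sub>R pgrad \<T> (\<lambda>K x. slope w K) y" for y
  proof -
    have "pgrad \<T> (\<lambda>K x. slope (\<lambda>x. v x - c * w x) K) y =
        pgrad \<T> (\<lambda>K x. slope v K + (- c) *\<^sub>R slope w K) y"
      unfolding pgrad_def using fe_space_diff_scale(2)[OF assms(2,3)] by simp
    then show ?thesis unfolding pgrad_add_scaleR by simp
  qed
  then show ?thesis
    using dirichlet_form_fe_space[OF assms(1) fe_space_diff_scale(1)[OF assms(2,3)]]
      dirichlet_form_fe_space[OF assms(1,2)] dirichlet_form_fe_space[OF assms(1,3)]
    by (simp add: inner_diff_right)
qed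

lemma dirichlet_form_zero_slope:
  assumes "v \<in> fe_space \<T>" "w \<in> fe_space \<T>" "\<And>x. x \<in> \<Union>\<T> \<Longrightarrow> w x = 0"
  shows "dirichlet_form \<Omega> v w = 0"
proof -
  have "slope w K = 0" if "K \<in> \<T>" for K
    using two_simplex_facts(3)[OF triangulation_facts(4)[OF that]] assms(3) that
    by (intro slope_eqI[of _ _ _ 0]) auto
  then have "pgrad \<T> (\<lambda>K x. slope w K) y = 0" for y by (simp add: pgrad_def)
  then show ?thesis using dirichlet_form_fe_space[OF assms(1,2)] by simp
qed

lemma fe_space_zero_at_vertices:
  assumes "v \<in> fe_space \<T>" "\<And>K z. K \<in> \<T> \<Longrightarrow> z extreme_point_of K \<Longrightarrow> v z = 0" "x \<in> \<Union>\<T>"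
  shows "v x = 0"
proof -
  obtain K where K: "K \<in> \<T>" "x \<in> K" using assms(3) by auto
  let ?H = "{y. slope v K \<bullet> y = - offset v K}"
  have "{z. z extreme_point_of K} \<subseteq> ?H"
    using assms(2)[OF K(1)] fe_space_slope_offset[OF assms(1) K(1)] by (force simp: extreme_point_of_def)
  then have "convex hull {z. z extreme_point_of K} \<subseteq> ?H" by (intro hull_minimal convex_hyperplane)
  then have "x \<in> ?H" using two_simplex_facts(5)[OF triangulation_facts(4)[OF K(1)]] K(2) by auto
  then show ?thesis using fe_space_slope_offset[OF assms(1) K] by simp
qed

text \<open>Definiteness of the energy on functions with zero boundary values. The gradient vanishes
  almost everywhere, and the part of the interior of a triangle inside \<Omega> is open and
  nonempty, hence not null; so every slope is 0.\<close>

lemma fe_space_zero_energy: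
  assumes v: "v \<in> fe_space \<T>" "dirichlet_form \<Omega> v v = 0" "\<And>x. x \<in> frontier \<Omega> \<Longrightarrow> v x = 0"
    and "connected \<Omega>" "bounded \<Omega>" "\<Omega> \<noteq> {}" and x: "x \<in> \<Union>\<T>"
  shows "v x = 0"
proof -
  let ?g = "pgrad \<T> (\<lambda>K x. slope v K)"
  have "AE x in lebesgue_on \<Omega>. ?g x \<bullet> ?g x = 0"
  proof (rule integral_nonneg_eq_0_iff_AE[THEN iffD1])
    show "integrable (lebesgue_on \<Omega>) (\<lambda>x. ?g x \<bullet> ?g x)" "(LINT x|lebesgue_on \<Omega>. ?g x \<bullet> ?g x) = 0"
      using v(2) dirichlet_form_fe_space[OF v(1) v(1)] by simp_all
  qed simp
  then have ae: "AE x in lebesgue. x \<in> \<Omega> \<longrightarrow> ?g x = 0"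
    using op by (subst (asm) AE_restrict_space_iff) auto
  have slope0: "slope v K = 0" if K: "K \<in> \<T>" for K
  proof -
    let ?O = "interior K \<inter> \<Omega>"
    have "K \<subseteq> closure \<Omega>" using K triangulation_facts(2) by auto
    then have "interior K \<inter> closure \<Omega> \<noteq> {}"
      using two_simplex_facts(3)[OF triangulation_facts(4)[OF K]] interior_subset by blast
    then have "?O \<noteq> {}" using open_Int_closure_eq_empty[OF open_interior] by blast
    then have nn: "\<not> negligible ?O" using op by (intro open_not_negligible) auto
    show ?thesis
    proof (rule ccontr)
      assume "slope v K \<noteq> 0"
      with ae have "AE x in lebesgue. x \<notin> ?O"
        by (auto simp: pgrad_interior[OF K] elim!: eventually_mono)
      then have "?O \<in> null_sets lebesgue"
        using op by (subst AE_iff_null_sets) auto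
      then show False using nn by (simp add: negligible_iff_null_sets)
    qed
  qed
  \<comment> \<open>With all slopes zero, v has finitely many values. A continuous function of this
    kind on a connected set is constant, which replaces an argument on chains of adjacent
    triangles.\<close>
  have "connected (\<Union>\<T>)" unfolding triangulation_facts(2) using assms(4) by (rule connected_imp_connected_closure)
  moreover have "continuous_on (\<Union>\<T>) v" using v(1) by (simp add: fe_space_def)
  moreover have "v ` \<Union>\<T> \<subseteq> offset v ` \<T>"
    using fe_space_slope_offset[OF v(1)] slope0 by force
  then have "finite (v ` \<Union>\<T>)" using triangulation_facts(1) finite_subset by blast
  ultimately obtain c where c: "\<And>x. x \<in> \<Union>\<T> \<Longrightarrow> v x = c"
    using continuous_finite_range_constant[of "\<Union>\<T>" v] unfolding constant_on_def by auto
  have "\<Omega> \<noteq> UNIV" using assms(5) not_bounded_UNIV by auto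
  then obtain z where z: "z \<in> frontier \<Omega>" using frontier_not_empty assms(6) by blast
  then have "z \<in> \<Union>\<T>" unfolding triangulation_facts(2) by (simp add: frontier_def)
  then show ?thesis using c x v(3)[OF z] by metis
qed

end

subsection \<open>Existence of finite element solutions\<close>

text \<open>Induction over the nodes: one node is removed by passing to the functions that vanish there.\<close>

lemma riesz_nodal:
  fixes V :: "('a \<Rightarrow> real) set" and d :: "('a \<Rightarrow> real) \<Rightarrow> ('a \<Rightarrow> real) \<Rightarrow> real"
  assumes "finite Z" "V \<noteq> {}"
    and closed: "\<And>u v c. u \<in> V \<Longrightarrow> v \<in> V \<Longrightarrow> (\<lambda>x. u x - c * v x) \<in> V"
    and sym: "\<And>u v. u \<in> V \<Longrightarrow> v \<in> V \<Longrightarrow> d u v = d v u"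
    and lin: "\<And>u v w c. u \<in> V \<Longrightarrow> v \<in> V \<Longrightarrow> w \<in> V \<Longrightarrow> d u (\<lambda>x. v x - c * w x) = d u v - c * d u w"
    and load: "\<And>v w c. v \<in> V \<Longrightarrow> w \<in> V \<Longrightarrow> load (\<lambda>x. v x - c * w x) = load v - c * load w"
    and ker: "\<And>v. v \<in> V \<Longrightarrow> d v v = 0 \<or> (\<forall>z\<in>Z. v z = 0) \<Longrightarrow> load v = 0 \<and> (\<forall>w\<in>V. d w v = 0)"
  shows "\<exists>w\<in>V. \<forall>v\<in>V. d w v = load v"
  using assms
proof (induction Z arbitrary: V load rule: finite_induct)
  case empty
  then obtain w where "w \<in> V" by blast
  with empty.prems(6) have "\<forall>v\<in>V. d w v = load v" by simp
  with \<open>w \<in> V\<close> show ?case by blast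
next
  case (insert z Z)
  note closed = insert.prems(2) and sym = insert.prems(3) and lin = insert.prems(4)
    and load = insert.prems(5) and ker = insert.prems(6)
  define V' where "V' = {v \<in> V. v z = 0}"
  have V': "V' \<subseteq> V" by (auto simp: V'_def)
  have IH: "\<exists>w\<in>V'. \<forall>v\<in>V'. d w v = k v"
    if k: "\<And>v w c. v \<in> V \<Longrightarrow> w \<in> V \<Longrightarrow> k (\<lambda>x. v x - c * w x) = k v - c * k w"
      "\<And>v. v \<in> V \<Longrightarrow> d v v = 0 \<or> (\<forall>y\<in>insert z Z. v y = 0) \<Longrightarrow> k v = 0" for k
  proof (rule insert.IH)
    obtain v where "v \<in> V" using insert.prems(1) by blast
    from closed[OF this this, of 1] show "V' \<noteq> {}" unfolding V'_def by fastforce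
    show "k v = 0 \<and> (\<forall>w\<in>V'. d w v = 0)" if "v \<in> V'" "d v v = 0 \<or> (\<forall>y\<in>Z. v y = 0)" for v
    proof -
      have "v \<in> V" "d v v = 0 \<or> (\<forall>y\<in>insert z Z. v y = 0)" using that by (auto simp: V'_def)
      with k(2)[of v] ker[of v] V' show ?thesis by blast
    qed
  qed (use V' closed sym lin k(1) in \<open>auto simp: V'_def\<close>)
  have IH_load: "\<exists>w\<in>V'. \<forall>v\<in>V'. d w v = load v"
  proof (rule IH)
    show "load (\<lambda>x. v x - c * w x) = load v - c * load w" if "v \<in> V" "w \<in> V" for v w c
      using that by (rule load)
    show "load v = 0" if "v \<in> V" "d v v = 0 \<or> (\<forall>y\<in>insert z Z. v y = 0)" for v
      using ker[OF that] by blast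
  qed
  show ?case
  proof (cases "V' = V")
    case True
    with IH_load show ?thesis by simp
  next
    case False
    then obtain v1 where v1: "v1 \<in> V" "v1 z \<noteq> 0" by (auto simp: V'_def)
    have "\<exists>w\<in>V'. \<forall>v\<in>V'. d w v = d v1 v"
    proof (rule IH)
      show "d v1 (\<lambda>x. v x - c * w x) = d v1 v - c * d v1 w" if "v \<in> V" "w \<in> V" for v w c
        using v1(1) that by (rule lin)
      show "d v1 v = 0" if "v \<in> V" "d v v = 0 \<or> (\<forall>y\<in>insert z Z. v y = 0)" for v
        using ker[OF that] v1(1) by blast
    qed
    then obtain p where p: "p \<in> V'" "\<And>v. v \<in> V' \<Longrightarrow> d p v = d v1 v" by blast
    \<comment> \<open>One Gram-Schmidt step: p is a d-projection of v1 onto V', so e is orthogonal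
      to V' and still does not vanish at z.\<close>
    define e where "e = (\<lambda>x. v1 x - 1 * p x)"
    have e: "e \<in> V" "e z \<noteq> 0"
      using closed[OF v1(1), of p 1] p(1) v1(2) by (auto simp: e_def V'_def)
    have de: "d v e = 0" "d e v = 0" if "v \<in> V'" for v
    proof -
      have vV: "v \<in> V" "p \<in> V" using that V' p by auto
      have "d v e = d v v1 - 1 * d v p" unfolding e_def by (rule lin[OF vV(1) v1(1) vV(2)])
      then show "d v e = 0" using p(2)[OF that] sym vV v1(1) by simp
      then show "d e v = 0" using sym e(1) vV by simp
    qed
    obtain w' where w': "w' \<in> V'" "\<And>v. v \<in> V' \<Longrightarrow> d w' v = load v" using IH_load by blast
    \<comment> \<open>If d e e = 0, then \<open>ker\<close> gives load e = 0, so the value 0 also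
      solves the equation for \<alpha>.\<close>
    define \<alpha> where "\<alpha> = (if d e e = 0 then 0 else load e / d e e)"
    have \<alpha>: "\<alpha> * d e e = load e" using ker[OF e(1)] by (auto simp: \<alpha>_def)
    define w where "w = (\<lambda>x. w' x - (- \<alpha>) * e x)"
    have wV: "w \<in> V" unfolding w_def using closed e(1) w'(1) V' by blast
    have dw: "d w v = d w' v + \<alpha> * d e v" if "v \<in> V" for v
    proof -
      have "d w v = d v w" using sym wV that by blast
      also have "\<dots> = d v w' - (- \<alpha>) * d v e"
        unfolding w_def using lin[OF that _ e(1), of w'] w'(1) V' by blast
      finally show ?thesis using sym that e(1) w'(1) V' by (auto simp: subset_iff)
    qed
    have "d w v = load v" if v: "v \<in> V" for v
    proof -
      \<comment> \<open>Removing the multiple of e that carries the value at z splits v into a part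
        in V' and a part along e, on which the equation is already known.\<close>
      define v' where "v' = (\<lambda>x. v x - (v z / e z) * e x)"
      have v': "v' \<in> V'" using closed[OF v e(1), of "v z / e z"] e(2) by (simp add: V'_def v'_def)
      have d_v': "d w v' = d w v - (v z / e z) * d w e"
        unfolding v'_def by (rule lin[OF wV v e(1)])
      have l_v': "load v' = load v - (v z / e z) * load e"
        unfolding v'_def by (rule load[OF v e(1)])
      have "d w v' = load v'" using dw[of v'] w'(2)[OF v'] de(2)[OF v'] v' V' by auto
      moreover have "d w e = load e" using dw[OF e(1)] de(1)[OF w'(1)] \<alpha> by simp
      ultimately show ?thesis using d_v' l_v' by simp
    qed
    with wV show ?thesis by blast
  qed
qed

text \<open>With c as origin the differences to the other points are linearly independent, so
  prescribed values extend to a linear functional; its adjoint at 1 is the representing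
  vector.\<close>

lemma affine_interpolation:
  fixes C :: "'a::euclidean_space set"
  assumes "\<not> affine_dependent C"
  shows "\<exists>a b. \<forall>x\<in>C. w x = a \<bullet> x + (b::real)"
proof (cases "C = {}")
  case False
  then obtain c where c: "c \<in> C" by blast
  then have "independent ((\<lambda>x. - c + x) ` (C - {c}))"
    using assms affine_dependent_iff_dependent2[OF c] by simp
  from linear_independent_extend[OF this, of "\<lambda>y. w (c + y) - w c"]
  obtain g where g: "linear g" "\<And>x. x \<in> C - {c} \<Longrightarrow> g (- c + x) = w (c + (- c + x)) - w c"
    by auto
  then have gx: "g (x - c) = w x - w c" if "x \<in> C" for x
    using that linear_0[OF g(1)] by (cases "x = c") (auto simp: algebra_simps)
  have "w x = adjoint g 1 \<bullet> x + (w c - adjoint g 1 \<bullet> c)" if "x \<in> C" for x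
  proof -
    have "adjoint g 1 \<bullet> (x - c) = g (x - c)"
      using adjoint_works[OF g(1), of "x - c" 1] by (simp add: inner_commute)
    then show ?thesis using gx[OF that] by (simp add: inner_diff_right)
  qed
  then show ?thesis by blast
qed auto

context
  fixes \<Omega> :: "(real^2) set" and \<T> :: "(real^2) set set"
  assumes tri: "conforming_triangulation \<Omega> \<T>" and op: "open \<Omega>"
begin

lemmas triangulation_facts' = triangulation_facts[OF tri op]

lemma lagrange_interpolant_exists: "\<exists>I. lagrange_interpolant \<T> w I"
proof -
  have "\<exists>a b. \<forall>x. x extreme_point_of K \<longrightarrow> w x = a \<bullet> x + b" if K: "K \<in> \<T>" for K
  proof -
    obtain C where C: "\<not> affine_dependent C" "K = convex hull C"
      using triangulation_facts'(4)[OF K] by (auto simp: simplex_def)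
    with affine_interpolation[OF C(1), of w] show ?thesis
      using extreme_point_of_convex_hull_affine_independent[OF C(1)] by auto
  qed
  then obtain A B where AB: "\<And>K x. K \<in> \<T> \<Longrightarrow> x extreme_point_of K \<Longrightarrow> w x = A K \<bullet> x + B K" by metis
  \<comment> \<open>Here conformity enters: the intersection is a common face, its extreme points
    are vertices of both triangles, and it is their convex hull. Two affine functions equal at these
    vertices agree on it.\<close>
  have agree: "A K \<bullet> x + B K = A K' \<bullet> x + B K'" if K: "K \<in> \<T>" "K' \<in> \<T>" "x \<in> K" "x \<in> K'" for K K' x
  proof -
    let ?F = "K \<inter> K'" and ?H = "{y. (A K - A K') \<bullet> y = B K' - B K}"
    have F: "?F face_of K" "?F face_of K'"
      using triangulation_facts'(5)[OF K(1,2)] triangulation_facts'(5)[OF K(2,1)] by (auto simp: Int_commute)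
    have cc: "compact ?F" "convex ?F"
      using two_simplex_facts[OF triangulation_facts'(4)] K by (auto intro!: compact_Int convex_Int)
    have "{y. y extreme_point_of ?F} \<subseteq> ?H"
    proof
      fix y assume "y \<in> {y. y extreme_point_of ?F}"
      then have "y extreme_point_of K" "y extreme_point_of K'"
        using extreme_point_of_face[OF F(1)] extreme_point_of_face[OF F(2)] by auto
      from AB[OF K(1) this(1)] AB[OF K(2) this(2)] show "y \<in> ?H" by (simp add: inner_diff_left)
    qed
    then have "convex hull {y. y extreme_point_of ?F} \<subseteq> ?H" by (intro hull_minimal convex_hyperplane)
    then have "?F \<subseteq> ?H" using Krein_Milman_Minkowski[OF cc] by simp
    then show ?thesis using K(3,4) by (auto simp: inner_diff_left)
  qed
  define I where "I x = A (SOME K. K \<in> \<T> \<and> x \<in> K) \<bullet> x + B (SOME K. K \<in> \<T> \<and> x \<in> K)" for x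
  have I: "I x = A K \<bullet> x + B K" if "K \<in> \<T>" "x \<in> K" for x K
  proof -
    have "(SOME K. K \<in> \<T> \<and> x \<in> K) \<in> \<T> \<and> x \<in> (SOME K. K \<in> \<T> \<and> x \<in> K)"
      by (rule someI[of "\<lambda>K. K \<in> \<T> \<and> x \<in> K" K]) (use that in simp)
    then show ?thesis unfolding I_def using agree that by blast
  qed
  have "continuous_on (\<Union>K\<in>\<T>. K) I"
  proof (rule continuous_on_closed_Union)
    fix K assume K: "K \<in> \<T>"
    show "closed K" using two_simplex_facts(2)[OF triangulation_facts'(4)[OF K]] by (rule compact_imp_closed)
    have "continuous_on K (\<lambda>x. A K \<bullet> x + B K)" by (intro continuous_intros)
    then show "continuous_on K I" using I[OF K] by (simp cong: continuous_on_cong)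
  qed (rule triangulation_facts')
  then have "I \<in> fe_space \<T>" using I by (auto simp: fe_space_def)
  moreover have "I x = w x" if "K \<in> \<T>" "x extreme_point_of K" for K x
    using I[OF that(1), of x] AB[OF that] that(2) by (simp add: extreme_point_of_def)
  ultimately show ?thesis by (auto simp: lagrange_interpolant_def)
qed

lemma fe_space_bounded_measurable:
  assumes "v \<in> fe_space \<T>"
  shows "v \<in> borel_measurable (lebesgue_on \<Omega>)" "\<exists>C. \<forall>x\<in>\<Omega>. \<bar>v x\<bar> \<le> C"
proof -
  have cont: "continuous_on (\<Union>\<T>) v" using assms by (simp add: fe_space_def)
  have "continuous_on \<Omega> v" by (rule continuous_on_subset[OF cont triangulation_facts'(3)])
  then show "v \<in> borel_measurable (lebesgue_on \<Omega>)"
    using op by (intro continuous_imp_measurable_on_sets_lebesgue) auto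
  have "compact (\<Union>\<T>)"
    using piecewise_C1_compact[OF fe_space_piecewise_C1[OF tri op assms]] .
  then have "bounded (v ` \<Union>\<T>)" using cont by (intro compact_imp_bounded compact_continuous_image)
  then obtain C where "\<And>x. x \<in> \<Union>\<T> \<Longrightarrow> \<bar>v x\<bar> \<le> C" unfolding bounded_iff by auto
  then have "\<bar>v x\<bar> \<le> C" if "x \<in> \<Omega>" for x
    using subsetD[OF triangulation_facts'(3) that] by simp
  then show "\<exists>C. \<forall>x\<in>\<Omega>. \<bar>v x\<bar> \<le> C" by blast
qed

lemma load_integrable:
  assumes "integrable (lebesgue_on \<Omega>) k" "v \<in> fe_space \<T>"
  shows "integrable (lebesgue_on \<Omega>) (\<lambda>x. k x * v x)"
proof -
  obtain C where C: "\<forall>x\<in>\<Omega>. \<bar>v x\<bar> \<le> C" using fe_space_bounded_measurable[OF assms(2)] by blast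
  show ?thesis
  proof (rule Bochner_Integration.integrable_bound)
    show "integrable (lebesgue_on \<Omega>) (\<lambda>x. C * k x)" using assms by simp
    show "(\<lambda>x. k x * v x) \<in> borel_measurable (lebesgue_on \<Omega>)"
      using fe_space_bounded_measurable[OF assms(2)] assms(1) by (intro borel_measurable_times) auto
    show "AE x in lebesgue_on \<Omega>. norm (k x * v x) \<le> norm (C * k x)"
    proof (rule AE_I2)
      fix x assume "x \<in> space (lebesgue_on \<Omega>)"
      then have "\<bar>v x\<bar> \<le> \<bar>C\<bar>" using C by (force simp: space_restrict_space)
      then show "norm (k x * v x) \<le> norm (C * k x)"
        using mult_right_mono[of "\<bar>v x\<bar>" "\<bar>C\<bar>" "\<bar>k x\<bar>"] by (simp add: abs_mult mult.commute)
    qed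
  qed
qed

text \<open>The interpolant I lifts the boundary data, and a correction W with zero boundary values
  solves the variational equation with the energy of I moved to the right-hand side. Membership in
  \<open>H2\<close> makes the Laplacian integrable, hence the load well defined.\<close>

lemma fe_solution_exists:
  assumes \<Omega>: "connected \<Omega>" "bounded \<Omega>" "\<Omega> \<noteq> {}"
    and u: "u \<in> H2 \<Omega>" "continuous_on (closure \<Omega>) w" "AE x in lebesgue_on \<Omega>. w x = u x"
  shows "\<exists>U. fe_solution \<Omega> \<T> u U"
proof -
  have lm: "\<Omega> \<in> lmeasurable" using op \<Omega> by (simp add: lmeasurable_open)
  have k_int: "integrable (lebesgue_on \<Omega>) (\<lambda>x. - weak_laplacian \<Omega> u x)"
  proof -
    have "integrable (lebesgue_on \<Omega>) (weak_partial \<Omega> i (weak_partial \<Omega> i u))" for i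
    proof -
      obtain g where "is_weak_partial \<Omega> i (weak_partial \<Omega> i u) g"
        using u(1) unfolding H2_def H1_def by blast
      from weak_partial_AE(1)[OF op \<Omega>(2) this] show ?thesis
        using L2_integrable[OF lm] by (simp add: is_weak_partial_def)
    qed
    then show ?thesis unfolding weak_laplacian_def[abs_def] by simp
  qed
  obtain I where I: "lagrange_interpolant \<T> w I" using lagrange_interpolant_exists by blast
  then have IV: "I \<in> fe_space \<T>" by (simp add: lagrange_interpolant_def)
  define V where "V = {v \<in> fe_space \<T>. \<forall>x\<in>frontier \<Omega>. v x = 0}"
  have Vfe: "v \<in> fe_space \<T>" if "v \<in> V" for v using that by (simp add: V_def)
  define load where "load v = (LINT x|lebesgue_on \<Omega>. - weak_laplacian \<Omega> u x * v x) - dirichlet_form \<Omega> I v" for v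
  define Z where "Z = (\<Union>K\<in>\<T>. {z. z extreme_point_of K})"
  have sym: "dirichlet_form \<Omega> v v' = dirichlet_form \<Omega> v' v" for v v'
    by (simp add: dirichlet_form_def mult.commute)
  have "\<exists>w\<in>V. \<forall>v\<in>V. dirichlet_form \<Omega> w v = load v"
  proof (rule riesz_nodal[of Z])
    show "finite Z"
      unfolding Z_def using triangulation_facts'(1,4) two_simplex_facts(4) by blast
    have "(\<lambda>_. 0) \<in> V"
      by (auto simp: V_def fe_space_def intro!: exI[of _ 0])
    then show "V \<noteq> {}" by blast
    show "(\<lambda>x. v x - c * v' x) \<in> V" if "v \<in> V" "v' \<in> V" for v v' c
      using that fe_space_diff_scale(1)[OF tri op, of v v' c] by (auto simp: V_def)
    show "dirichlet_form \<Omega> v' (\<lambda>x. v x - c * v'' x) = dirichlet_form \<Omega> v' v - c * dirichlet_form \<Omega> v' v''"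
      if "v' \<in> V" "v \<in> V" "v'' \<in> V" for v v' v'' c
      using dirichlet_form_diff_scale[OF tri op] that Vfe by blast
    show "load (\<lambda>x. v x - c * v' x) = load v - c * load v'" if "v \<in> V" "v' \<in> V" for v v' c
    proof -
      note i = load_integrable[OF k_int Vfe[OF that(1)]] load_integrable[OF k_int Vfe[OF that(2)]]
      have "(LINT x|lebesgue_on \<Omega>. - weak_laplacian \<Omega> u x * (v x - c * v' x)) =
          (LINT x|lebesgue_on \<Omega>. - weak_laplacian \<Omega> u x * v x - c * (- weak_laplacian \<Omega> u x * v' x))"
        by (intro Bochner_Integration.integral_cong) (auto simp: algebra_simps)
      also have "\<dots> = (LINT x|lebesgue_on \<Omega>. - weak_laplacian \<Omega> u x * v x) -
          c * (LINT x|lebesgue_on \<Omega>. - weak_laplacian \<Omega> u x * v' x)"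
        by (subst Bochner_Integration.integral_diff) (use i in simp_all)
      finally show ?thesis
        using dirichlet_form_diff_scale[OF tri op IV Vfe[OF that(1)] Vfe[OF that(2)], of c]
        by (simp add: load_def right_diff_distrib)
    qed
    \<comment> \<open>Elements of \<open>fe_space\<close> are arbitrary outside the closure of
      \<Omega>, so zero energy or zero nodal values do not make v the zero function. Vanishing on
      the triangulated set is enough for all integrals.\<close>
    show "load v = 0 \<and> (\<forall>w\<in>V. dirichlet_form \<Omega> w v = 0)"
      if v: "v \<in> V" "dirichlet_form \<Omega> v v = 0 \<or> (\<forall>z\<in>Z. v z = 0)" for v
    proof -
      have zero: "v x = 0" if "x \<in> \<Union>\<T>" for x
        using v(2)
      proof
        assume "dirichlet_form \<Omega> v v = 0"
        then show ?thesis
          using fe_space_zero_energy[OF tri op Vfe[OF v(1)] _ _ \<Omega> that] v(1) by (auto simp: V_def)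
      next
        assume "\<forall>z\<in>Z. v z = 0"
        then show ?thesis
          using fe_space_zero_at_vertices[OF tri op Vfe[OF v(1)] _ that] by (auto simp: Z_def)
      qed
      have "(LINT x|lebesgue_on \<Omega>. - weak_laplacian \<Omega> u x * v x) = (LINT x|lebesgue_on \<Omega>. 0)"
        using zero[OF subsetD[OF triangulation_facts'(3)]]
        by (intro Bochner_Integration.integral_cong) (simp_all add: space_restrict_space)
      moreover have "dirichlet_form \<Omega> w v = 0" if "w \<in> fe_space \<T>" for w
        using dirichlet_form_zero_slope[OF tri op that Vfe[OF v(1)]] zero by blast
      ultimately show ?thesis using IV Vfe by (simp add: load_def)
    qed
  qed (rule sym)
  then obtain W where W: "W \<in> V" "\<And>v. v \<in> V \<Longrightarrow> dirichlet_form \<Omega> W v = load v" by blast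
  define U where "U = (\<lambda>x. I x - (- 1) * W x)"
  have "fe_solution \<Omega> \<T> u U"
    unfolding fe_solution_def
  proof (intro conjI ballI impI)
    show U: "U \<in> fe_space \<T>"
      unfolding U_def by (rule fe_space_diff_scale(1)[OF tri op IV Vfe[OF W(1)]])
    have "U x = I x" if "x \<in> frontier \<Omega>" for x using that W(1) by (simp add: U_def V_def)
    then show "\<exists>w I. continuous_on (closure \<Omega>) w \<and> (AE x in lebesgue_on \<Omega>. w x = u x) \<and>
        lagrange_interpolant \<T> w I \<and> (\<forall>x\<in>frontier \<Omega>. U x = I x)"
      using u I by blast
    fix v assume v: "v \<in> fe_space \<T>" "\<forall>x\<in>frontier \<Omega>. v x = 0"
    then have "v \<in> V" by (simp add: V_def)
    have "dirichlet_form \<Omega> U v = dirichlet_form \<Omega> v U" by (rule sym)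
    also have "\<dots> = dirichlet_form \<Omega> v I - (- 1) * dirichlet_form \<Omega> v W"
      unfolding U_def by (rule dirichlet_form_diff_scale[OF tri op v(1) IV Vfe[OF W(1)]])
    finally show "dirichlet_form \<Omega> U v = (LINT x|lebesgue_on \<Omega>. - weak_laplacian \<Omega> u x * v x)"
      using W(2)[OF \<open>v \<in> V\<close>] sym[of v W] sym[of v I] by (simp add: load_def)
  qed
  then show ?thesis by blast
qed

end

subsection \<open>Piecewise linear functions on a regular band\<close>

text \<open>The weak gradient of \<open>u - U\<close> for \<open>u x = (x \<bullet> x) / 2\<close>.\<close>

definition grad_error :: "(real^2) set set \<Rightarrow> (real^2 \<Rightarrow> real) \<Rightarrow> real^2 \<Rightarrow> real^2" where
  "grad_error \<T> U x = x - pgrad \<T> (\<lambda>K x. slope U K) x"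

definition zigzag :: "real^2 \<Rightarrow> real^2 \<Rightarrow> real^2 \<Rightarrow> real \<Rightarrow> real \<Rightarrow> nat \<Rightarrow> real^2" where
  "zigzag p e n h hbar m = p + (real m * h / 2) *\<^sub>R e + (if odd m then hbar else 0) *\<^sub>R n"

text \<open>The vertices \<open>P 0, Q 0, P 1, Q 1, \<dots>\<close> in this order: three consecutive ones span an element.\<close>

lemma regular_band_zigzag:
  assumes "regular_band \<T> h hbar L B"
  obtains N p e n where "L = (real N + 1) * h" "0 < h" "0 < hbar" "norm e = 1" "norm n = 1" "e \<bullet> n = 0"
    "\<And>m. m \<le> 2 * N \<Longrightarrow> convex hull {zigzag p e n h hbar m, zigzag p e n h hbar (m + 1), zigzag p e n h hbar (m + 2)} \<in> \<T>"
proof -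
  from assms obtain N P Q e where h: "0 < h" "0 < hbar" and N: "1 \<le> N" "L = (real N + 1) * h" and e: "norm e = 1"
    and P: "\<And>i. i \<le> N + 1 \<Longrightarrow> P i = P 0 + (real i * h) *\<^sub>R e"
    and Q: "\<And>i. i \<le> N \<Longrightarrow> Q i = Q 0 + (real i * h) *\<^sub>R e"
    and dist: "setdist (range (\<lambda>t. P 0 + t *\<^sub>R e)) (range (\<lambda>t. Q 0 + t *\<^sub>R e)) = hbar"
    and K: "\<And>i. i \<le> N \<Longrightarrow> isosceles_longest_base (P i) (P (i+1)) (Q i) \<and> convex hull {P i, P (i+1), Q i} \<in> \<T>"
    and K': "\<And>i. i \<in> {1..N} \<Longrightarrow> convex hull {Q (i-1), Q i, P i} \<in> \<T>"
    unfolding regular_band_def by blast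
  have ee: "e \<bullet> e = 1" using e by (simp add: norm_eq_1)
  \<comment> \<open>From the midpoint of the base P 0 P 1 to the apex Q 0. Equal legs make w
    orthogonal to e, and so its length is the distance of the two parallel lines.\<close>
  define w where "w = Q 0 - P 0 - (h / 2) *\<^sub>R e"
  have we: "w \<bullet> e = 0"
  proof -
    have "dist (P 0) (Q 0) = dist (P 1) (Q 0)"
      using K[of 0] by (simp add: isosceles_longest_base_def)
    moreover have "P 1 = P 0 + h *\<^sub>R e" using P[of 1] by simp
    ultimately have "norm (Q 0 - P 0) = norm (Q 0 - P 0 - h *\<^sub>R e)"
      by (simp add: dist_norm norm_minus_commute algebra_simps)
    then have "(Q 0 - P 0) \<bullet> (Q 0 - P 0) = (Q 0 - P 0 - h *\<^sub>R e) \<bullet> (Q 0 - P 0 - h *\<^sub>R e)"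
      by (simp add: norm_eq)
    also have "\<dots> = (Q 0 - P 0) \<bullet> (Q 0 - P 0) - 2 * h * ((Q 0 - P 0) \<bullet> e) + h * h"
      by (simp add: inner_diff_left inner_diff_right ee inner_commute algebra_simps)
    finally have "h * (2 * ((Q 0 - P 0) \<bullet> e)) = h * h" by (simp add: algebra_simps)
    then have "(Q 0 - P 0) \<bullet> e = h / 2" using h by simp
    then show ?thesis by (simp add: w_def inner_diff_left ee)
  qed
  have "norm w = hbar"
  proof (rule antisym)
    have "norm w \<le> dist x y" if "x \<in> range (\<lambda>t. P 0 + t *\<^sub>R e)" "y \<in> range (\<lambda>t. Q 0 + t *\<^sub>R e)" for x y
    proof -
      obtain s t where "x = P 0 + s *\<^sub>R e" "y = Q 0 + t *\<^sub>R e" using \<open>x \<in> _\<close> \<open>y \<in> _\<close> by auto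
      then have "y - x = w + (h / 2 + t - s) *\<^sub>R e" by (simp add: w_def algebra_simps)
      then have "(norm (y - x))\<^sup>2 = (norm w)\<^sup>2 + (h / 2 + t - s)\<^sup>2"
        using norm_add_Pythagorean[of w "(h / 2 + t - s) *\<^sub>R e"] we by (simp add: orthogonal_def e)
      then have "(norm w)\<^sup>2 \<le> (norm (y - x))\<^sup>2" by simp
      then show ?thesis by (simp add: dist_norm norm_minus_commute)
    qed
    then show "norm w \<le> hbar" unfolding dist[symmetric] by (intro le_setdistI) auto
    have "hbar \<le> dist (P 0 + (h / 2) *\<^sub>R e) (Q 0 + 0 *\<^sub>R e)"
      unfolding dist[symmetric] by (intro setdist_le_dist) auto
    then show "hbar \<le> norm w" by (simp add: w_def dist_norm norm_minus_commute algebra_simps)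
  qed
  define n where "n = w /\<^sub>R hbar"
  have n: "norm n = 1" "e \<bullet> n = 0" "w = hbar *\<^sub>R n"
    using \<open>norm w = hbar\<close> we h by (auto simp: n_def inner_commute)
  let ?R = "zigzag (P 0) e n h hbar"
  have PR: "P i = ?R (2 * i)" if "i \<le> N + 1" for i
    by (subst P[OF that]) (simp add: zigzag_def)
  have QR: "Q i = ?R (2 * i + 1)" if "i \<le> N" for i
  proof -
    have "Q 0 = P 0 + w + (h / 2) *\<^sub>R e" by (simp add: w_def)
    then show ?thesis by (subst Q[OF that]) (simp add: zigzag_def n(3) algebra_simps add_divide_distrib)
  qed
  have "convex hull {?R m, ?R (m + 1), ?R (m + 2)} \<in> \<T>" if "m \<le> 2 * N" for m
  proof (cases "even m")
    case True
    then obtain i where i: "m = 2 * i" by (elim evenE)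
    have "{P i, P (i + 1), Q i} = {?R m, ?R (m + 1), ?R (m + 2)}"
      using PR[of i] PR[of "i + 1"] QR[of i] that by (auto simp: i)
    with K[of i] that i show ?thesis by simp
  next
    case False
    then obtain j where j: "m = 2 * j + 1" by (elim oddE)
    have "{Q (j + 1 - 1), Q (j + 1), P (j + 1)} = {?R m, ?R (m + 1), ?R (m + 2)}"
      using PR[of "j + 1"] QR[of j] QR[of "j + 1"] that by (auto simp: j)
    with K'[of "j + 1"] that j show ?thesis by simp
  qed
  then show ?thesis using that N h e n by blast
qed

section \<open>Elements of the band and the gradients on them\<close>

context
  fixes \<Omega> :: "(real^2) set" and \<T> :: "(real^2) set set" and U :: "real^2 \<Rightarrow> real"
    and h hbar :: real and N :: nat and p e n :: "real^2"
  assumes tri: "conforming_triangulation \<Omega> \<T>" and op: "open \<Omega>" and neg: "negligible (frontier \<Omega>)"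
    and U: "U \<in> fe_space \<T>"
    and h: "0 < h" "0 < hbar" and e: "norm e = 1" and n: "norm n = 1" and en: "e \<bullet> n = 0"
    and elements: "\<And>m. m \<le> 2 * N \<Longrightarrow> convex hull {zigzag p e n h hbar m, zigzag p e n h hbar (m + 1), zigzag p e n h hbar (m + 2)} \<in> \<T>"
begin

abbreviation "zz \<equiv> zigzag p e n h hbar"
abbreviation "elt m \<equiv> convex hull {zz m, zz (m + 1), zz (m + 2)}"
abbreviation "slp m \<equiv> slope U (elt m)"

lemma ee: "e \<bullet> e = 1" and nn: "n \<bullet> n = 1" and ne: "n \<bullet> e = 0"
  using e n en by (auto simp: norm_eq_1 inner_commute)

lemma zigzag_inner:
  "(zz m - p) \<bullet> e = real m * h / 2" "(zz m - p) \<bullet> n = (if odd m then hbar else 0)"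
  by (auto simp: zigzag_def inner_add_left ee nn en ne)

lemma zigzag_Suc: "zz (m + 1) = zz m + (h / 2) *\<^sub>R e + (if odd m then - hbar else hbar) *\<^sub>R n"
proof -
  have eq: "real (m + 1) * h / 2 = real m * h / 2 + h / 2" by (simp add: field_simps)
  show ?thesis unfolding zigzag_def eq by (auto simp: scaleR_add_left)
qed

lemma zigzag_Suc2: "zz (m + 2) = zz m + h *\<^sub>R e"
proof -
  have eq: "real (m + 2) * h / 2 = real m * h / 2 + h" by (simp add: field_simps)
  show ?thesis unfolding zigzag_def eq by (auto simp: scaleR_add_left)
qed

lemma elt_bounds:
  assumes "x \<in> elt m"
  shows "real m * h / 2 \<le> (x - p) \<bullet> e" "0 \<le> (x - p) \<bullet> n" "(x - p) \<bullet> n \<le> hbar"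
proof -
  have "elt m \<subseteq> {x. e \<bullet> x \<ge> real m * h / 2 + e \<bullet> p} \<inter> {x. n \<bullet> x \<ge> n \<bullet> p} \<inter> {x. n \<bullet> x \<le> hbar + n \<bullet> p}"
  proof (intro hull_minimal convex_Int convex_halfspace_ge convex_halfspace_le)
    have "zz k \<in> {x. e \<bullet> x \<ge> real m * h / 2 + e \<bullet> p} \<inter> {x. n \<bullet> x \<ge> n \<bullet> p} \<inter> {x. n \<bullet> x \<le> hbar + n \<bullet> p}"
      if "m \<le> k" for k
    proof -
      have "real m * h / 2 \<le> real k * h / 2" using that h by simp
      moreover have "e \<bullet> zz k = real k * h / 2 + e \<bullet> p" "n \<bullet> zz k = (if odd k then hbar else 0) + n \<bullet> p"
        using zigzag_inner[of k] unfolding inner_commute[of e] inner_commute[of n] inner_diff_left by linarith+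
      ultimately show ?thesis using h by auto
    qed
    then show "{zz m, zz (m + 1), zz (m + 2)} \<subseteq>
        {x. e \<bullet> x \<ge> real m * h / 2 + e \<bullet> p} \<inter> {x. n \<bullet> x \<ge> n \<bullet> p} \<inter> {x. n \<bullet> x \<le> hbar + n \<bullet> p}"
      by simp
  qed
  with assms show "real m * h / 2 \<le> (x - p) \<bullet> e" "0 \<le> (x - p) \<bullet> n" "(x - p) \<bullet> n \<le> hbar"
    by (auto simp: inner_diff_left inner_commute algebra_simps)
qed

text \<open>The vertex with index m is the leftmost point of its element, so the position along e
  recovers m. Distinct indices thus give disjoint interiors.\<close>

lemma elt_inj:
  assumes "elt m = elt m'" shows "m = m'"
proof -
  have *: "k \<le> m" if "elt m = elt k" for m k
  proof -
    have "zz m \<in> elt m" by (intro hull_inc) simp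
    then have "real k * h / 2 \<le> (zz m - p) \<bullet> e" using elt_bounds(1) that by simp
    then show ?thesis using zigzag_inner(1)[of m] h by simp
  qed
  from *[of m m'] *[of m' m] assms show ?thesis by auto
qed

lemma elt_content: "measure lebesgue (elt m) = h * hbar / 2"
proof -
  define D where "D = (\<lambda>(a::real^2) (b::real^2). a $ 1 * b $ 2 - a $ 2 * b $ 1)"
  \<comment> \<open>Lagrange's identity: for an orthonormal pair the determinant is 1 or -1.\<close>
  have "(D e n)\<^sup>2 = (e \<bullet> e) * (n \<bullet> n) - (e \<bullet> n)\<^sup>2"
    by (simp add: D_def inner_vec_def sum_2 power2_eq_square algebra_simps)
  then have "(D e n)\<^sup>2 = 1" using ee nn en by simp
  then have D: "\<bar>D e n\<bar> = 1" using power2_eq_1_iff[of "D e n"] by auto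
  define \<sigma> :: real where "\<sigma> = (if odd m then - 1 else 1)"
  have "zz (m + 1) - zz m = (h / 2) *\<^sub>R e + (\<sigma> * hbar) *\<^sub>R n" "zz (m + 2) - zz m = h *\<^sub>R e"
    using zigzag_Suc[of m] zigzag_Suc2[of m] by (auto simp: \<sigma>_def)
  then have "D (zz (m + 2) - zz m) (zz (m + 1) - zz m) = h * \<sigma> * hbar * D e n"
    by (simp add: D_def algebra_simps)
  then have *: "\<bar>D (zz (m + 2) - zz m) (zz (m + 1) - zz m)\<bar> = h * hbar"
    using D h by (simp add: abs_mult \<sigma>_def)
  have "measure lborel (elt m) = \<bar>(zz (m + 2) $ 1 - zz m $ 1) * (zz (m + 1) $ 2 - zz m $ 2) -
      (zz (m + 1) $ 1 - zz m $ 1) * (zz (m + 2) $ 2 - zz m $ 2)\<bar> / 2"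
    by (rule content_triangle)
  also have "\<dots> = \<bar>D (zz (m + 2) - zz m) (zz (m + 1) - zz m)\<bar> / 2"
    by (simp add: D_def mult.commute)
  finally have "measure lborel (elt m) = h * hbar / 2" unfolding * .
  moreover have "elt m \<in> sets lborel" by (simp add: borel_compact finite_imp_compact_convex_hull)
  ultimately show ?thesis by (simp add: measure_completion)
qed

lemma slope_jump:
  assumes "m < 2 * N"
  shows "\<bar>(slp (m + 1) - slp m) \<bullet> e\<bar> * (h / 2) = \<bar>(slp (m + 1) - slp m) \<bullet> n\<bar> * hbar"
proof -
  have "elt m \<in> \<T>" "elt (m + 1) \<in> \<T>" using elements[of m] elements[of "m + 1"] assms by simp_all
  note val = fe_space_slope_offset[OF U this(1)] fe_space_slope_offset[OF U this(2)]
  have in_elt: "zz (m + 1) \<in> elt m" "zz (m + 2) \<in> elt m" "zz (m + 1) \<in> elt (m + 1)" "zz (m + 2) \<in> elt (m + 1)"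
    by (auto intro!: hull_inc)
  have "(slp (m + 1) - slp m) \<bullet> (zz (m + 2) - zz (m + 1)) = 0"
    using val(1)[OF in_elt(1)] val(1)[OF in_elt(2)] val(2)[OF in_elt(3)] val(2)[OF in_elt(4)]
    by (simp add: inner_diff_left inner_diff_right)
  moreover define \<sigma> :: real where "\<sigma> = (if odd m then 1 else - 1)"
  have "zz (m + 2) - zz (m + 1) = (h / 2) *\<^sub>R e + (\<sigma> * hbar) *\<^sub>R n"
    using zigzag_Suc[of "m + 1"] by (auto simp: \<sigma>_def)
  ultimately have "((slp (m + 1) - slp m) \<bullet> e) * (h / 2) = - \<sigma> * (((slp (m + 1) - slp m) \<bullet> n) * hbar)"
    by (simp add: inner_add_right algebra_simps)
  then have "\<bar>((slp (m + 1) - slp m) \<bullet> e) * (h / 2)\<bar> = \<bar>((slp (m + 1) - slp m) \<bullet> n) * hbar\<bar>"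
    by (simp add: \<sigma>_def split: if_splits)
  then show ?thesis using h by (simp add: abs_mult)
qed

text \<open>The gradient of u at x is x, and on the band its normal component differs from p
  \<bullet> n by at most hbar. Up to this amount the defect measures the normal component of the
  error on element m, by a number independent of the point.\<close>

definition "defect m = (slp m - p) \<bullet> n"

lemma defect_square_le:
  assumes "x \<in> elt m"
  shows "(defect m)\<^sup>2 - 2 * hbar\<^sup>2 \<le> 2 * ((x - slp m) \<bullet> (x - slp m))"
proof -
  let ?a = "(x - slp m) \<bullet> n" and ?b = "(x - p) \<bullet> n"
  have "defect m = ?b - ?a" by (simp add: defect_def inner_diff_left)
  moreover have "(b - a)\<^sup>2 \<le> 2 * a\<^sup>2 + 2 * b\<^sup>2" for a b :: real
    using zero_le_power2[of "a + b"] by (simp add: power2_eq_square algebra_simps)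
  ultimately have "(defect m)\<^sup>2 \<le> 2 * ?a\<^sup>2 + 2 * ?b\<^sup>2" by simp
  moreover have "?b\<^sup>2 \<le> hbar\<^sup>2" using elt_bounds[OF assms] by (intro power_mono) auto
  moreover have "?a\<^sup>2 \<le> (x - slp m) \<bullet> (x - slp m)"
    using Cauchy_Schwarz_ineq[of "x - slp m" n] by (simp add: nn)
  ultimately show ?thesis by linarith
qed

text \<open>The pointwise bound is integrated over the disjoint interiors of the elements inside
  \<Omega>. Each has area h * hbar / 2, since triangle frontiers and the frontier of \<Omega> are
  negligible; elsewhere the step function is 0, below the nonnegative squared error.\<close>

lemma sum_defect_square_le:
  assumes int: "integrable (lebesgue_on \<Omega>) (\<lambda>x. grad_error \<T> U x \<bullet> grad_error \<T> U x)"
  shows "(\<Sum>m\<le>2 * N. (defect m)\<^sup>2 - 2 * hbar\<^sup>2) * (h * hbar / 2) \<le> 2 * (LINT x|lebesgue_on \<Omega>. grad_error \<T> U x \<bullet> grad_error \<T> U x)"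
proof -
  have conv: "convex (elt m)" for m by simp
  have meas: "measure (lebesgue_on \<Omega>) (interior (elt m) \<inter> \<Omega>) = h * hbar / 2"
    and lm: "interior (elt m) \<inter> \<Omega> \<in> sets (lebesgue_on \<Omega>)" if "m \<le> 2 * N" for m
  proof -
    have cpt: "compact (elt m)" by (simp add: finite_imp_compact_convex_hull)
    have "elt m \<subseteq> closure \<Omega>" using elements[OF that] triangulation_facts(2)[OF tri op] by auto
    then have sub: "elt m - (interior (elt m) \<inter> \<Omega>) \<subseteq> frontier (elt m) \<union> frontier \<Omega>"
      using op by (auto simp: frontier_def interior_open compact_imp_closed[OF cpt])
    have n0: "negligible (elt m - (interior (elt m) \<inter> \<Omega>))"
      by (rule negligible_subset[OF _ sub]) (use neg negligible_convex_frontier[OF conv] in simp)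
    have "interior (elt m) \<inter> \<Omega> - elt m = {}" using interior_subset by blast
    with n0 have "negligible ((elt m - (interior (elt m) \<inter> \<Omega>)) \<union> (interior (elt m) \<inter> \<Omega> - elt m))" by simp
    then have "measure lebesgue (interior (elt m) \<inter> \<Omega>) = measure lebesgue (elt m)"
      using measure_negligible_symdiff[of "elt m" "interior (elt m) \<inter> \<Omega>"] cpt
      by (simp add: lmeasurable_compact)
    moreover have "measure (lebesgue_on \<Omega>) (interior (elt m) \<inter> \<Omega>) = measure lebesgue (interior (elt m) \<inter> \<Omega>)"
      by (rule measure_restrict_space) (use op in auto)
    ultimately show "measure (lebesgue_on \<Omega>) (interior (elt m) \<inter> \<Omega>) = h * hbar / 2"
      using elt_content[of m] by metis
    show "interior (elt m) \<inter> \<Omega> \<in> sets (lebesgue_on \<Omega>)"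
      using op by (auto simp: sets_restrict_space intro!: image_eqI[of _ _ "interior (elt m)"])
  qed
  have bdd: "bounded \<Omega>"
    using piecewise_C1_lmeasurable(1)[OF fe_space_piecewise_C1[OF tri op U] op triangulation_facts(3)[OF tri op]] .
  then have "\<Omega> \<in> lmeasurable" using op by (simp add: lmeasurable_open)
  then interpret finite_measure "lebesgue_on \<Omega>" by (rule finite_measure_lebesgue_on)
  let ?c = "\<lambda>m. (defect m)\<^sup>2 - 2 * hbar\<^sup>2"
  let ?f = "\<lambda>x. \<Sum>m\<le>2 * N. ?c m * indicator (interior (elt m) \<inter> \<Omega>) x"
  have int_f: "integrable (lebesgue_on \<Omega>) (\<lambda>x. ?c m * indicator (interior (elt m) \<inter> \<Omega>) x)" if "m \<le> 2 * N" for m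
    using lm[OF that] emeasure_finite by (intro integrable_mult_right integrable_real_indicator) (auto simp: top.not_eq_extremum[symmetric])
  have "(\<Sum>m\<le>2 * N. ?c m) * (h * hbar / 2) = (\<Sum>m\<le>2 * N. ?c m * measure (lebesgue_on \<Omega>) (interior (elt m) \<inter> \<Omega>))"
    unfolding sum_distrib_right using meas by (intro sum.cong) auto
  also have "\<dots> = (\<Sum>m\<le>2 * N. LINT x|lebesgue_on \<Omega>. ?c m * indicator (interior (elt m) \<inter> \<Omega>) x)"
    using lm by (intro sum.cong) (auto simp: space_restrict_space)
  also have "\<dots> = (LINT x|lebesgue_on \<Omega>. ?f x)"
    using int_f by (subst Bochner_Integration.integral_sum) auto
  also have "\<dots> \<le> (LINT x|lebesgue_on \<Omega>. 2 * (grad_error \<T> U x \<bullet> grad_error \<T> U x))"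
  proof (rule integral_mono)
    show "integrable (lebesgue_on \<Omega>) ?f" using int_f by (intro Bochner_Integration.integrable_sum) auto
    show "integrable (lebesgue_on \<Omega>) (\<lambda>x. 2 * (grad_error \<T> U x \<bullet> grad_error \<T> U x))" using int by simp
    fix x
    show "?f x \<le> 2 * (grad_error \<T> U x \<bullet> grad_error \<T> U x)"
    proof (cases "\<exists>m\<le>2 * N. x \<in> interior (elt m) \<inter> \<Omega>")
      case True
      then obtain m where m: "m \<le> 2 * N" "x \<in> interior (elt m)" "x \<in> \<Omega>" by auto
      have zero: "indicator (interior (elt m') \<inter> \<Omega>) x = (0::real)" if "m' \<le> 2 * N" "m' \<noteq> m" for m'
      proof -
        have "x \<notin> elt m'"
          using triangulation_interior_unique[OF tri op elements[OF m(1)] elements[OF that(1)] m(2)] elt_inj that(2) by metis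
        then show ?thesis using interior_subset by (auto simp: indicator_def)
      qed
      have "?f x = (\<Sum>m'\<in>{m}. ?c m' * indicator (interior (elt m') \<inter> \<Omega>) x)"
        using m zero by (intro sum.mono_neutral_right) auto
      also have "\<dots> = ?c m" using m by simp
      also have "\<dots> \<le> 2 * ((x - slp m) \<bullet> (x - slp m))"
        using m(2) interior_subset by (intro defect_square_le) blast
      also have "x - slp m = grad_error \<T> U x" using pgrad_interior[OF tri op elements[OF m(1)] m(2)] by (simp add: grad_error_def)
      finally show ?thesis .
    next
      case False
      then have "?f x = 0" by (intro sum.neutral) (auto simp: indicator_def)
      then show ?thesis by simp
    qed
  qed
  finally show ?thesis by simp
qed

text \<open>A bound for the total variation of the tangential slope along the band: a jump costs at
  most 2 * hbar / h times the two adjacent defects, and every defect is counted at most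
  twice.\<close>

definition "spread = 4 * hbar / h * (\<Sum>m\<le>2 * N. \<bar>defect m\<bar>)"

lemma spread_nonneg: "0 \<le> spread"
  using h by (auto simp: spread_def intro!: mult_nonneg_nonneg sum_nonneg)

lemma slope_spread:
  assumes "m \<le> 2 * N"
  shows "\<bar>(slp m - slp 0) \<bullet> e\<bar> \<le> spread"
proof -
  have "\<bar>(slp k - slp 0) \<bullet> e\<bar> \<le> 2 * hbar / h * (\<Sum>j<k. \<bar>defect j\<bar> + \<bar>defect (Suc j)\<bar>)" if "k \<le> 2 * N" for k
    using that
  proof (induction k)
    case (Suc k)
    have "\<bar>(slp (k + 1) - slp k) \<bullet> e\<bar> * (h / 2) = \<bar>defect (Suc k) - defect k\<bar> * hbar"
      using slope_jump[of k] Suc.prems by (simp add: defect_def inner_diff_left)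
    then have "\<bar>(slp (k + 1) - slp k) \<bullet> e\<bar> = 2 * hbar / h * \<bar>defect (Suc k) - defect k\<bar>"
      using h by (simp add: field_simps)
    also have "\<dots> \<le> 2 * hbar / h * (\<bar>defect k\<bar> + \<bar>defect (Suc k)\<bar>)"
      using h by (intro mult_left_mono) auto
    finally have "\<bar>(slp (k + 1) - slp k) \<bullet> e\<bar> \<le> 2 * hbar / h * (\<bar>defect k\<bar> + \<bar>defect (Suc k)\<bar>)" .
    moreover have "\<bar>(slp k - slp 0) \<bullet> e\<bar> \<le> 2 * hbar / h * (\<Sum>j<k. \<bar>defect j\<bar> + \<bar>defect (Suc j)\<bar>)"
      using Suc by simp
    moreover have "(slp (Suc k) - slp 0) \<bullet> e = (slp (k + 1) - slp k) \<bullet> e + (slp k - slp 0) \<bullet> e"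
      by (simp add: inner_diff_left)
    ultimately have "\<bar>(slp (Suc k) - slp 0) \<bullet> e\<bar> \<le> 2 * hbar / h * (\<Sum>j<k. \<bar>defect j\<bar> + \<bar>defect (Suc j)\<bar>) +
        2 * hbar / h * (\<bar>defect k\<bar> + \<bar>defect (Suc k)\<bar>)"
      by linarith
    then show ?case by (simp add: distrib_left)
  qed simp
  from this[OF assms]
  have "\<bar>(slp m - slp 0) \<bullet> e\<bar> \<le> 2 * hbar / h * ((\<Sum>j<m. \<bar>defect j\<bar>) + (\<Sum>j<m. \<bar>defect (Suc j)\<bar>))"
    by (simp add: sum.distrib)
  also have "\<dots> \<le> 2 * hbar / h * ((\<Sum>j\<le>2 * N. \<bar>defect j\<bar>) + (\<Sum>j\<le>2 * N. \<bar>defect j\<bar>))"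
  proof (intro mult_left_mono add_mono)
    show "(\<Sum>j<m. \<bar>defect j\<bar>) \<le> (\<Sum>j\<le>2 * N. \<bar>defect j\<bar>)"
      using assms by (intro sum_mono2) auto
    have "(\<Sum>j<m. \<bar>defect (Suc j)\<bar>) = (\<Sum>j\<in>Suc ` {..<m}. \<bar>defect j\<bar>)"
      by (simp add: sum.reindex)
    also have "\<dots> \<le> (\<Sum>j\<le>2 * N. \<bar>defect j\<bar>)"
      using assms by (intro sum_mono2) auto
    finally show "(\<Sum>j<m. \<bar>defect (Suc j)\<bar>) \<le> (\<Sum>j\<le>2 * N. \<bar>defect j\<bar>)" .
  qed (use h in auto)
  finally show ?thesis by (simp add: spread_def)
qed

text \<open>Cauchy-Schwarz over the M = 2 * N + 1 elements, with M * h at most 2 * L. The first term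
  carries the error, the second one comes from the variation of x \<bullet> n across the
  band.\<close>

lemma spread_square_le:
  assumes int: "integrable (lebesgue_on \<Omega>) (\<lambda>x. grad_error \<T> U x \<bullet> grad_error \<T> U x)" and L: "L = (real N + 1) * h"
  shows "spread\<^sup>2 \<le> 128 * L * (LINT x|lebesgue_on \<Omega>. grad_error \<T> U x \<bullet> grad_error \<T> U x) * (hbar / h ^ 4) + 128 * L\<^sup>2 * (hbar / h) ^ 4"
proof -
  define E where "E = (LINT x|lebesgue_on \<Omega>. grad_error \<T> U x \<bullet> grad_error \<T> U x)"
  define M where "M = 2 * real N + 1"
  define S where "S = (\<Sum>m\<le>2 * N. (defect m)\<^sup>2)"
  have E0: "E \<ge> 0" by (simp add: E_def)
  have M: "M > 0" "M * h \<le> 2 * L" using h by (auto simp: M_def L algebra_simps)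
  have "(\<Sum>m\<le>2 * N. (defect m)\<^sup>2 - 2 * hbar\<^sup>2) = S - 2 * hbar\<^sup>2 * M"
    by (simp add: sum_subtractf S_def M_def algebra_simps)
  with sum_defect_square_le[OF int] have "(S - 2 * hbar\<^sup>2 * M) * (h * hbar / 2) \<le> 2 * E"
    by (simp add: E_def)
  then have S: "S \<le> 4 * E / (h * hbar) + 2 * hbar\<^sup>2 * M"
    using h by (simp add: field_simps)
  have "(\<Sum>m\<le>2 * N. \<bar>defect m\<bar>)\<^sup>2 \<le> (\<Sum>m\<le>2 * N. \<bar>defect m\<bar>\<^sup>2) * card {..2 * N}"
    by (rule sum_squared_le_sum_of_squares)
  also have "\<dots> = S * M" by (simp add: S_def M_def)
  also have "\<dots> \<le> (4 * E / (h * hbar) + 2 * hbar\<^sup>2 * M) * M"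
    using S M by (intro mult_right_mono) auto
  finally have *: "(\<Sum>m\<le>2 * N. \<bar>defect m\<bar>)\<^sup>2 \<le> (4 * E / (h * hbar) + 2 * hbar\<^sup>2 * M) * M" .
  have "spread\<^sup>2 = (4 * hbar / h)\<^sup>2 * (\<Sum>m\<le>2 * N. \<bar>defect m\<bar>)\<^sup>2"
    by (simp add: spread_def power_mult_distrib power_divide)
  also have "\<dots> \<le> (4 * hbar / h)\<^sup>2 * ((4 * E / (h * hbar) + 2 * hbar\<^sup>2 * M) * M)"
    using * by (intro mult_left_mono) auto
  also have "\<dots> = 64 * E * (M * h) * (hbar / h ^ 4) + 32 * (M * h)\<^sup>2 * (hbar / h) ^ 4"
    using h by (simp add: field_simps power2_eq_square power4_eq_xxxx)
  also have "\<dots> \<le> 64 * E * (2 * L) * (hbar / h ^ 4) + 32 * (2 * L)\<^sup>2 * (hbar / h) ^ 4"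
    using E0 M h by (intro add_mono mult_right_mono mult_left_mono power_mono) auto
  finally show ?thesis by (simp add: E_def power_mult_distrib mult_ac)
qed

text \<open>The edge consists of the bases of the elements with even index, on each of which U has a
  constant tangential slope within \<open>spread\<close> of the first one. Adding up the pieces
  gives the linear bound.\<close>

lemma band_edge_nearly_affine:
  assumes "0 \<le> t" "t \<le> (real N + 1) * h"
  shows "p + t *\<^sub>R e \<in> \<Union>\<T>" "\<bar>U (p + t *\<^sub>R e) - U p - (slp 0 \<bullet> e) * t\<bar> \<le> spread * t"
proof -
  have in_elt: "p + t *\<^sub>R e \<in> elt (2 * i)" if "real i * h \<le> t" "t \<le> (real i + 1) * h" for i t
  proof -
    define \<theta> where "\<theta> = (t - real i * h) / h"
    have \<theta>: "0 \<le> \<theta>" "\<theta> \<le> 1" "t = real i * h + \<theta> * h"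
      using that h by (auto simp: \<theta>_def field_simps)
    have "(1 - \<theta>) *\<^sub>R zz (2 * i) + \<theta> *\<^sub>R zz (2 * i + 2) \<in> elt (2 * i)"
      using \<theta> by (intro convexD[OF convex_convex_hull]) (auto intro!: hull_inc)
    also have "(1 - \<theta>) *\<^sub>R zz (2 * i) + \<theta> *\<^sub>R zz (2 * i + 2) = p + t *\<^sub>R e"
      by (simp add: zigzag_def \<theta>(3) algebra_simps add_divide_distrib)
    finally show ?thesis .
  qed
  have elt: "elt (2 * i) \<in> \<T>" if "i \<le> N" for i using elements[of "2 * i"] that by simp
  have main: "p + t *\<^sub>R e \<in> \<Union>\<T> \<and> \<bar>U (p + t *\<^sub>R e) - U p - (slp 0 \<bullet> e) * t\<bar> \<le> spread * t"
    if "k \<le> N + 1" "0 \<le> t" "t \<le> real k * h" for k t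
    using that
  proof (induction k arbitrary: t)
    case 0
    have "p + 0 *\<^sub>R e \<in> \<Union>\<T>" using in_elt[of 0 0] elt[of 0] h by auto
    then show ?case using 0 by simp
  next
    case (Suc k)
    show ?case
    proof (cases "t \<le> real k * h")
      case True
      then show ?thesis using Suc by auto
    next
      case False
      let ?s = "real k * h"
      have t: "?s \<le> t" "t \<le> (real k + 1) * h" using False Suc.prems by (auto simp: algebra_simps)
      have k: "k \<le> N" "0 \<le> ?s" using Suc.prems h by auto
      have I: "\<bar>U (p + ?s *\<^sub>R e) - U p - (slp 0 \<bullet> e) * ?s\<bar> \<le> spread * ?s"
        using Suc.IH[of ?s] k by auto
      have in_t: "p + t *\<^sub>R e \<in> elt (2 * k)" "p + ?s *\<^sub>R e \<in> elt (2 * k)"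
        using in_elt[OF t] in_elt[of k ?s] h by auto
      from fe_space_slope_offset[OF U elt[OF k(1)] in_t(1)] fe_space_slope_offset[OF U elt[OF k(1)] in_t(2)]
      have "U (p + t *\<^sub>R e) - U (p + ?s *\<^sub>R e) = (slp (2 * k) \<bullet> e) * (t - ?s)"
        by (simp add: inner_add_right algebra_simps)
      then have eq: "U (p + t *\<^sub>R e) - U p - (slp 0 \<bullet> e) * t =
          (U (p + ?s *\<^sub>R e) - U p - (slp 0 \<bullet> e) * ?s) + ((slp (2 * k) - slp 0) \<bullet> e) * (t - ?s)"
        by (simp add: inner_diff_left algebra_simps)
      have "\<bar>((slp (2 * k) - slp 0) \<bullet> e) * (t - ?s)\<bar> \<le> spread * (t - ?s)"
        unfolding abs_mult using t slope_spread[of "2 * k"] k by (intro mult_mono) (auto simp: spread_nonneg)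
      with I have "\<bar>U (p + t *\<^sub>R e) - U p - (slp 0 \<bullet> e) * t\<bar> \<le> spread * ?s + spread * (t - ?s)"
        unfolding eq by linarith
      moreover have "spread * ?s + spread * (t - ?s) = spread * t" by (simp add: algebra_simps)
      ultimately show ?thesis using in_t(1) elt[OF k(1)] by auto
    qed
  qed
  from main[of "N + 1" t] assms
  show "p + t *\<^sub>R e \<in> \<Union>\<T>" "\<bar>U (p + t *\<^sub>R e) - U p - (slp 0 \<bullet> e) * t\<bar> \<le> spread * t"
    by (auto simp: algebra_simps)
qed

end

text \<open>From here on the band is forgotten; only a segment of length L with a nearly affine
  trace of U remains.\<close>

lemma regular_band_nearly_affine:
  fixes \<Omega> :: "(real^2) set"
  assumes tri: "conforming_triangulation \<Omega> \<T>" "open \<Omega>" "negligible (frontier \<Omega>)" "U \<in> fe_space \<T>"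
    and band: "regular_band \<T> h hbar L B"
    and int: "integrable (lebesgue_on \<Omega>) (\<lambda>x. grad_error \<T> U x \<bullet> grad_error \<T> U x)"
  obtains p e s \<kappa> where "norm e = 1" "0 \<le> \<kappa>"
    "\<And>t. t \<in> {0..L} \<Longrightarrow> p + t *\<^sub>R e \<in> \<Union>\<T>"
    "\<And>t. t \<in> {0..L} \<Longrightarrow> \<bar>U (p + t *\<^sub>R e) - U p - s * t\<bar> \<le> \<kappa> * t"
    "\<kappa>\<^sup>2 \<le> 128 * L * (LINT x|lebesgue_on \<Omega>. grad_error \<T> U x \<bullet> grad_error \<T> U x) * (hbar / h ^ 4) + 128 * L\<^sup>2 * (hbar / h) ^ 4"
proof -
  obtain N p e n where L: "L = (real N + 1) * h" and h: "0 < h" "0 < hbar" and e: "norm e = 1" "norm n = 1" "e \<bullet> n = 0"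
    and el: "\<And>m. m \<le> 2 * N \<Longrightarrow> convex hull {zigzag p e n h hbar m, zigzag p e n h hbar (m + 1), zigzag p e n h hbar (m + 2)} \<in> \<T>"
    using regular_band_zigzag[OF band] by metis
  note * = tri h e el
  show ?thesis
  proof (rule that[where e=e and p=p and \<kappa>="spread U h hbar N p e n" and
      s="slope U (convex hull {zigzag p e n h hbar 0, zigzag p e n h hbar (0 + 1), zigzag p e n h hbar (0 + 2)}) \<bullet> e"])
    show "norm e = 1" by (rule e(1))
    show "0 \<le> spread U h hbar N p e n" by (rule spread_nonneg[OF *])
    show "(spread U h hbar N p e n)\<^sup>2 \<le> 128 * L * (LINT x|lebesgue_on \<Omega>. grad_error \<T> U x \<bullet> grad_error \<T> U x) * (hbar / h ^ 4) + 128 * L\<^sup>2 * (hbar / h) ^ 4"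
      by (rule spread_square_le[OF * int L])
    fix t assume "t \<in> {0..L}"
    then have t: "0 \<le> t" "t \<le> (real N + 1) * h" by (auto simp: L)
    show "p + t *\<^sub>R e \<in> \<Union>\<T>" by (rule band_edge_nearly_affine(1)[OF * t])
    show "\<bar>U (p + t *\<^sub>R e) - U p - slope U (convex hull {zigzag p e n h hbar 0, zigzag p e n h hbar (0 + 1), zigzag p e n h hbar (0 + 2)}) \<bullet> e * t\<bar>
        \<le> spread U h hbar N p e n * t"
      by (rule band_edge_nearly_affine(2)[OF * t])
  qed
qed

subsection \<open>A trace estimate for second differences\<close>

text \<open>A second difference on the base is carried to height s along \<nu>, where it is a
  difference of two increments along e. The transport costs vertical integrals with weights 1, 2, 1,
  the increments cost two horizontal ones. Integration over t up to \<tau> and s up to s0 gives the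
  factor 2 * \<tau> + 4 * s0; the points t + 2 * \<tau> explain the base length 3 * \<tau>.\<close>

lemma trace_second_difference:
  fixes q e \<nu> :: "real^2"
  assumes pw: "piecewise_C1 \<T> F D f" and norm: "norm e \<le> 1" "norm \<nu> \<le> 1"
    and d: "e $ 1 * \<nu> $ 2 - e $ 2 * \<nu> $ 1 \<noteq> 0" and pos: "0 < \<tau>" "0 < s0" "0 \<le> c"
    and rect: "\<And>t s. t \<in> {0..3 * \<tau>} \<Longrightarrow> s \<in> {0..s0} \<Longrightarrow> q + t *\<^sub>R e + s *\<^sub>R \<nu> \<in> \<Union>\<T>"
    and c: "\<And>t. t \<in> {0..\<tau>} \<Longrightarrow>
      c \<le> \<bar>f (q + (t + 2 * \<tau>) *\<^sub>R e) - 2 * f (q + (t + \<tau>) *\<^sub>R e) + f (q + t *\<^sub>R e)\<bar>"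
  shows "ennreal (\<bar>e $ 1 * \<nu> $ 2 - e $ 2 * \<nu> $ 1\<bar> * (c * \<tau> * s0)) \<le>
    ennreal (2 * \<tau> + 4 * s0) * (\<integral>\<^sup>+x. ennreal (norm (pgrad \<T> D x)) \<partial>lborel)"
proof -
  let ?d = "e $ 1 * \<nu> $ 2 - e $ 2 * \<nu> $ 1"
  define W where "W = (\<lambda>x. ennreal (norm (pgrad \<T> D x)))"
  define V where "V t s = W (q + t *\<^sub>R e + s *\<^sub>R \<nu>)" for t s
  define X where "X s = (\<integral>\<^sup>+t. V t s \<partial>lborel)" for s
  define Y where "Y t = (\<integral>\<^sup>+s. V t s \<partial>lborel)" for t
  have [measurable]: "pgrad \<T> D \<in> borel_measurable borel" by (rule pgrad_measurable[OF pw])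
  then have [measurable]: "W \<in> borel_measurable borel" unfolding W_def by measurable
  have V[measurable]: "(\<lambda>(t, s). V t s) \<in> borel_measurable (lborel \<Otimes>\<^sub>M lborel)"
    unfolding V_def split_beta' by measurable
  have V'[measurable]: "(\<lambda>(s, t). V t s) \<in> borel_measurable (lborel \<Otimes>\<^sub>M lborel)"
    unfolding V_def split_beta' by measurable
  have X[measurable]: "X \<in> borel_measurable borel"
    unfolding X_def[abs_def] using lborel.borel_measurable_nn_integral[OF V'] by simp
  have Y[measurable]: "Y \<in> borel_measurable borel"
    unfolding Y_def[abs_def] using lborel.borel_measurable_nn_integral[OF V] by simp
  define A where "A = (\<integral>\<^sup>+s. X s \<partial>lborel)"
  have AY: "(\<integral>\<^sup>+t. Y t \<partial>lborel) = A"
    unfolding A_def X_def Y_def using lborel_pair.Fubini'[of "\<lambda>s t. V t s"] V' by simp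
  have AW: "(\<integral>\<^sup>+x. W x \<partial>lborel) = ennreal \<bar>?d\<bar> * A"
    unfolding A_def X_def V_def using nn_integral_parallelogram[OF d, of W q] by simp
  define \<Phi> where "\<Phi> t s = f (q + t *\<^sub>R e + s *\<^sub>R \<nu>)" for t s
  have horiz: "ennreal \<bar>\<Phi> b s - \<Phi> a s\<bar> \<le> X s"
    if "0 \<le> a" "a \<le> b" "b \<le> 3 * \<tau>" "s \<in> {0..s0}" for a b s
  proof -
    have "q + s *\<^sub>R \<nu> + t *\<^sub>R e \<in> \<Union>\<T>" if "t \<in> {a..b}" for t
      using rect[of t s] that \<open>0 \<le> a\<close> \<open>b \<le> 3 * \<tau>\<close> \<open>s \<in> {0..s0}\<close> by (simp add: add_ac)
    from piecewise_C1_increment_le[OF pw \<open>a \<le> b\<close> this norm(1)]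
    have "ennreal \<bar>\<Phi> b s - \<Phi> a s\<bar> \<le> (\<integral>\<^sup>+t. V t s * indicator {a..b} t \<partial>lborel)"
      by (simp add: \<Phi>_def V_def W_def add_ac)
    also have "\<dots> \<le> X s"
      unfolding X_def by (intro nn_integral_mono) (auto simp: indicator_def)
    finally show ?thesis .
  qed
  have vert: "ennreal \<bar>\<Phi> t s - \<Phi> t 0\<bar> \<le> Y t" if "t \<in> {0..3 * \<tau>}" "s \<in> {0..s0}" for t s
  proof -
    have in_rect: "q + t *\<^sub>R e + s' *\<^sub>R \<nu> \<in> \<Union>\<T>" if "s' \<in> {0..s}" for s'
      using rect[of t s'] that \<open>t \<in> _\<close> \<open>s \<in> _\<close> by simp
    have "0 \<le> s" using that by simp
    from piecewise_C1_increment_le[OF pw this in_rect norm(2)]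
    have "ennreal \<bar>\<Phi> t s - \<Phi> t 0\<bar> \<le> (\<integral>\<^sup>+s'. V t s' * indicator {0..s} s' \<partial>lborel)"
      by (simp add: \<Phi>_def V_def W_def)
    also have "\<dots> \<le> Y t"
      unfolding Y_def by (intro nn_integral_mono) (auto simp: indicator_def)
    finally show ?thesis .
  qed
  have point: "ennreal c \<le> 2 * X s + (Y t + 2 * Y (t + \<tau>) + Y (t + 2 * \<tau>))"
    if t: "t \<in> {0..\<tau>}" and s: "s \<in> {0..s0}" for t s
  proof -
    let ?a = "\<lambda>t. \<bar>\<Phi> t s - \<Phi> t 0\<bar>"
    have "c \<le> \<bar>\<Phi> (t + 2 * \<tau>) 0 - 2 * \<Phi> (t + \<tau>) 0 + \<Phi> t 0\<bar>"
      using c[OF t] by (simp add: \<Phi>_def)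
    also have "\<dots> \<le> (\<bar>\<Phi> (t + 2 * \<tau>) s - \<Phi> (t + \<tau>) s\<bar> + \<bar>\<Phi> (t + \<tau>) s - \<Phi> t s\<bar>) +
        (?a t + (?a (t + \<tau>) + ?a (t + \<tau>)) + ?a (t + 2 * \<tau>))"
      by linarith
    finally have "ennreal c \<le> (ennreal \<bar>\<Phi> (t + 2 * \<tau>) s - \<Phi> (t + \<tau>) s\<bar> + ennreal \<bar>\<Phi> (t + \<tau>) s - \<Phi> t s\<bar>) +
        (ennreal (?a t) + (ennreal (?a (t + \<tau>)) + ennreal (?a (t + \<tau>))) + ennreal (?a (t + 2 * \<tau>)))"
      by (simp add: ennreal_leI flip: ennreal_plus)
    also have "\<dots> \<le> (X s + X s) + (Y t + (Y (t + \<tau>) + Y (t + \<tau>)) + Y (t + 2 * \<tau>))"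
      using t s pos by (intro add_mono horiz vert) auto
    finally show ?thesis unfolding mult_2 .
  qed
  \<comment> \<open>\<open>X\<close> and \<open>Y\<close> integrate over entire lines rather than
    over the parallelogram; nonnegativity permits this enlargement, and it makes the integrals
    invariant under translation.\<close>
  have shift: "(\<integral>\<^sup>+t. Y (t + r) \<partial>lborel) = A" for r
  proof -
    have "(\<integral>\<^sup>+t. Y (t + r) \<partial>lborel) = (\<integral>\<^sup>+t. Y t \<partial>(distr lborel borel ((+) r)))"
      by (subst nn_integral_distr) (auto simp: add.commute)
    then show ?thesis using AY by (simp add: lborel_distr_plus)
  qed
  let ?I = "indicator {0..\<tau>} :: real \<Rightarrow> ennreal" and ?J = "indicator {0..s0} :: real \<Rightarrow> ennreal"
  have "ennreal (c * \<tau> * s0) = (\<integral>\<^sup>+s. \<integral>\<^sup>+t. ennreal c * ?I t * ?J s \<partial>lborel \<partial>lborel)"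
  proof -
    have "(\<integral>\<^sup>+t. ennreal c * ?I t * ?J s \<partial>lborel) = ennreal (c * \<tau>) * ?J s" for s
      using pos by (simp add: nn_integral_multc nn_integral_cmult ennreal_mult)
    then show ?thesis using pos by (simp add: nn_integral_cmult ennreal_mult)
  qed
  also have "\<dots> \<le> (\<integral>\<^sup>+s. \<integral>\<^sup>+t. (2 * X s) * ?I t + (Y t + 2 * Y (t + \<tau>) + Y (t + 2 * \<tau>)) * ?J s \<partial>lborel \<partial>lborel)"
    using point by (intro nn_integral_mono) (auto simp: indicator_def)
  also have "\<dots> = (\<integral>\<^sup>+s. 2 * X s * ennreal \<tau> + 4 * A * ?J s \<partial>lborel)"
  proof (intro nn_integral_cong)
    fix s
    have "(\<integral>\<^sup>+t. (2 * X s) * ?I t + (Y t + 2 * Y (t + \<tau>) + Y (t + 2 * \<tau>)) * ?J s \<partial>lborel) =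
        2 * X s * ennreal \<tau> + ((\<integral>\<^sup>+t. Y t \<partial>lborel) + 2 * (\<integral>\<^sup>+t. Y (t + \<tau>) \<partial>lborel) + (\<integral>\<^sup>+t. Y (t + 2 * \<tau>) \<partial>lborel)) * ?J s"
      using pos by (simp add: nn_integral_add nn_integral_multc nn_integral_cmult)
    also have "(\<integral>\<^sup>+t. Y t \<partial>lborel) + 2 * (\<integral>\<^sup>+t. Y (t + \<tau>) \<partial>lborel) + (\<integral>\<^sup>+t. Y (t + 2 * \<tau>) \<partial>lborel) = (1 + 2 + 1) * A"
      unfolding shift AY by (simp only: distrib_right mult_1)
    finally show "(\<integral>\<^sup>+t. (2 * X s) * ?I t + (Y t + 2 * Y (t + \<tau>) + Y (t + 2 * \<tau>)) * ?J s \<partial>lborel) =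
        2 * X s * ennreal \<tau> + 4 * A * ?J s" by simp
  qed
  also have "\<dots> = 2 * A * ennreal \<tau> + 4 * A * ennreal s0"
    using pos by (simp add: nn_integral_add nn_integral_multc nn_integral_cmult A_def)
  also have "\<dots> = ennreal (2 * \<tau> + 4 * s0) * A"
    using pos by (simp add: ennreal_mult distrib_left distrib_right mult_ac)
  finally have "ennreal (c * \<tau> * s0) \<le> ennreal (2 * \<tau> + 4 * s0) * A" .
  then have "ennreal \<bar>?d\<bar> * ennreal (c * \<tau> * s0) \<le> ennreal \<bar>?d\<bar> * (ennreal (2 * \<tau> + 4 * s0) * A)"
    by (rule mult_left_mono) simp
  also have "\<dots> = ennreal (2 * \<tau> + 4 * s0) * (\<integral>\<^sup>+x. W x \<partial>lborel)"
    unfolding AW by (simp add: mult_ac)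
  finally show ?thesis using pos by (simp add: ennreal_mult W_def)
qed

text \<open>Young's inequality passes from the first to the second power of the gradient without
  square roots, and the free l later makes the volume term small. Outside the closure of \<Omega>
  \<open>pgrad\<close> is 0, so integrating over the plane adds nothing.\<close>

lemma nn_integral_pgrad_le:
  assumes pw: "piecewise_C1 \<T> F D f" and \<Omega>: "open \<Omega>" "\<Union>\<T> = closure \<Omega>" "negligible (frontier \<Omega>)"
    and l: "0 < l"
  shows "(\<integral>\<^sup>+x. ennreal (norm (pgrad \<T> D x)) \<partial>lborel) \<le>
    ennreal (l / 2 * measure lebesgue \<Omega> + (LINT x|lebesgue_on \<Omega>. pgrad \<T> D x \<bullet> pgrad \<T> D x) / (2 * l))"
proof -
  let ?g = "pgrad \<T> D"
  have sub: "\<Omega> \<subseteq> \<Union>\<T>" unfolding \<Omega>(2) by (rule closure_subset)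
  note lm = piecewise_C1_lmeasurable(2)[OF pw \<Omega>(1) sub]
  interpret finite_measure "lebesgue_on \<Omega>" using lm by (rule finite_measure_lebesgue_on)
  have [measurable]: "?g \<in> borel_measurable borel" by (rule pgrad_measurable[OF pw])
  have int: "integrable (lebesgue_on \<Omega>) (\<lambda>x. ?g x \<bullet> ?g x)"
    by (rule pgrad_inner_integrable[OF pw pw \<Omega>(1) sub])
  have zero: "?g x = 0" if "x \<notin> closure \<Omega>" for x
  proof -
    have "indicator K x = (0::real)" if "K \<in> \<T>" for K
      using that \<open>x \<notin> closure \<Omega>\<close> \<Omega>(2) by (auto simp: indicator_def)
    then show ?thesis by (simp add: pgrad_def)
  qed
  have "AE x in lebesgue. x \<notin> frontier \<Omega>"
    using \<Omega>(3) by (intro AE_not_in) (simp add: negligible_iff_null_sets)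
  then have ae: "AE x in lebesgue. ennreal (norm (?g x)) = ennreal (norm (?g x)) * indicator \<Omega> x"
  proof eventually_elim
    case (elim x)
    then have "x \<in> \<Omega> \<or> x \<notin> closure \<Omega>" using \<Omega>(1) by (auto simp: frontier_def interior_open)
    then show ?case using zero[of x] by (auto simp: indicator_def)
  qed
  have "(\<integral>\<^sup>+x. ennreal (norm (?g x)) \<partial>lborel) = (\<integral>\<^sup>+x. ennreal (norm (?g x)) \<partial>lebesgue)"
    by (rule nn_integral_completion[symmetric])
  also have "\<dots> = (\<integral>\<^sup>+x. ennreal (norm (?g x)) * indicator \<Omega> x \<partial>lebesgue)"
    by (rule nn_integral_cong_AE[OF ae])
  also have "\<dots> = (\<integral>\<^sup>+x. ennreal (norm (?g x)) \<partial>lebesgue_on \<Omega>)"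
    using \<Omega>(1) by (subst nn_integral_restrict_space) auto
  also have "\<dots> \<le> (\<integral>\<^sup>+x. ennreal (l / 2 + (?g x \<bullet> ?g x) / (2 * l)) \<partial>lebesgue_on \<Omega>)"
  proof (intro nn_integral_mono ennreal_leI)
    fix x
    have "0 \<le> (norm (?g x) - l)\<^sup>2" by simp
    then have "2 * l * norm (?g x) \<le> l * l + ?g x \<bullet> ?g x"
      by (simp add: power2_diff power2_eq_square dot_square_norm algebra_simps)
    then show "norm (?g x) \<le> l / 2 + (?g x \<bullet> ?g x) / (2 * l)" using l by (simp add: field_simps)
  qed
  also have "\<dots> = ennreal (LINT x|lebesgue_on \<Omega>. l / 2 + (?g x \<bullet> ?g x) / (2 * l))"
    using int l by (intro nn_integral_eq_integral) auto
  also have "(LINT x|lebesgue_on \<Omega>. l / 2 + (?g x \<bullet> ?g x) / (2 * l)) =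
      l / 2 * measure lebesgue \<Omega> + (LINT x|lebesgue_on \<Omega>. ?g x \<bullet> ?g x) / (2 * l)"
    using int \<Omega>(1) by (simp add: measure_restrict_space mult.commute)
  finally show ?thesis .
qed

subsection \<open>Parallelograms attached to a sequence of segments\<close>

text \<open>\<nu> is the vertical direction of the local graph. Upward motion keeps points above the
  graph, and halving the radius keeps them in the ball where \<Omega> is described. The statement
  for closures follows by continuity of the translation.\<close>

lemma lipschitz_boundary_upward:
  assumes lip: "lipschitz_boundary \<Omega>" and m: "m \<in> frontier \<Omega>"
  obtains \<nu> r where "norm \<nu> = 1" "0 < r" "\<And>s. s \<in> {0<..<r} \<Longrightarrow> m + s *\<^sub>R \<nu> \<in> \<Omega>"
    "\<And>x s. x \<in> closure \<Omega> \<Longrightarrow> x \<in> ball m r \<Longrightarrow> s \<in> {0..<r} \<Longrightarrow> x + s *\<^sub>R \<nu> \<in> closure \<Omega>"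
proof -
  obtain r R g M where r: "r > 0" and R: "orthogonal_transformation (R :: real^2 \<Rightarrow> real^2)"
    and g: "M-lipschitz_on UNIV (g :: real \<Rightarrow> real)"
    and eq: "\<Omega> \<inter> ball m r = {y \<in> ball m r. g (R y $ 1) < R y $ 2}"
    using lip m unfolding lipschitz_boundary_def by blast
  have linR: "linear R" using R by (simp add: orthogonal_transformation_linear)
  obtain \<nu> where \<nu>: "R \<nu> = axis 2 1" using orthogonal_transformation_surj[OF R] by (metis surjD)
  have n1: "norm \<nu> = 1" using orthogonal_transformation_norm[OF R, of \<nu>] \<nu> by simp
  have R_add: "R (x + s *\<^sub>R \<nu>) $ 1 = R x $ 1" "R (x + s *\<^sub>R \<nu>) $ 2 = R x $ 2 + s" for x s
    by (simp_all add: linear_add[OF linR] linear_cmul[OF linR] \<nu> axis_def)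
  have up: "x + s *\<^sub>R \<nu> \<in> \<Omega>" if "x \<in> ball m (r / 2)" "s \<in> {0..<r / 2}" "g (R x $ 1) < R x $ 2 + s" for x s
  proof -
    have "dist m (x + s *\<^sub>R \<nu>) \<le> dist m x + \<bar>s\<bar>"
      using norm_triangle_ineq4[of "m - x" "s *\<^sub>R \<nu>"] n1 by (simp add: dist_norm algebra_simps)
    then have "x + s *\<^sub>R \<nu> \<in> ball m r" using that by simp
    then show ?thesis using eq that(3) R_add by auto
  qed
  have contR: "continuous_on UNIV R" using linR by (simp add: linear_continuous_on linear_linear)
  have cont_g: "continuous_on UNIV g" using lipschitz_on_continuous_on[OF g] .
  have "closed {y. g (R y $ 1) \<le> R y $ 2}"
    by (intro closed_Collect_le continuous_on_compose2[OF cont_g] continuous_intros contR) auto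
  then have "closure (ball m r \<inter> \<Omega>) \<subseteq> {y. g (R y $ 1) \<le> R y $ 2}"
    unfolding Int_commute[of "ball m r"] eq by (intro closure_minimal) auto
  moreover have "m \<in> ball m r \<inter> closure \<Omega>" using r m by (simp add: frontier_def)
  then have "m \<in> closure (ball m r \<inter> \<Omega>)" using open_Int_closure_subset[of "ball m r" \<Omega>] by blast
  ultimately have gm: "g (R m $ 1) \<le> R m $ 2" by blast
  show ?thesis
  proof (rule that[OF n1, of "r / 2"])
    show "m + s *\<^sub>R \<nu> \<in> \<Omega>" if "s \<in> {0<..<r / 2}" for s
      using that gm r by (intro up) auto
    show "x + s *\<^sub>R \<nu> \<in> closure \<Omega>" if x: "x \<in> closure \<Omega>" "x \<in> ball m (r / 2)" and s: "s \<in> {0..<r / 2}" for x s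
    proof -
      have "(\<lambda>x. x + s *\<^sub>R \<nu>) ` closure (ball m (r / 2) \<inter> \<Omega>) \<subseteq> closure \<Omega>"
      proof (rule image_closure_subset)
        show "(\<lambda>x. x + s *\<^sub>R \<nu>) ` (ball m (r / 2) \<inter> \<Omega>) \<subseteq> closure \<Omega>"
        proof
          fix z assume "z \<in> (\<lambda>x. x + s *\<^sub>R \<nu>) ` (ball m (r / 2) \<inter> \<Omega>)"
          then obtain y where y: "y \<in> ball m (r / 2)" "y \<in> \<Omega>" "z = y + s *\<^sub>R \<nu>" by auto
          have "y \<in> \<Omega> \<inter> ball m r" using y r by auto
          then have "g (R y $ 1) < R y $ 2" using eq by auto
          then have "z \<in> \<Omega>" unfolding y(3) using s y(1) by (intro up) auto
          then show "z \<in> closure \<Omega>" using closure_subset by blast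
        qed
      qed (auto intro!: continuous_intros)
      moreover have "x \<in> closure (ball m (r / 2) \<inter> \<Omega>)"
        using open_Int_closure_subset[of "ball m (r / 2)" \<Omega>] x by blast
      ultimately show ?thesis by blast
    qed
  qed (use r in simp)
qed

text \<open>If the open segment meets \<Omega>, a perpendicular at such a point works. Otherwise its
  midpoint lies on the frontier, and the upward direction there cannot be parallel to e: it leads
  into \<Omega> at once, whereas moving along the segment does not.\<close>

lemma transversal_direction:
  fixes p e :: "real^2"
  assumes lip: "lipschitz_boundary \<Omega>" and op: "open \<Omega>" and e: "norm e = 1" and C: "0 < C"
    and seg: "\<And>t. t \<in> {0..C} \<Longrightarrow> p + t *\<^sub>R e \<in> closure \<Omega>"
  obtains c \<nu> r where "c \<in> {0<..<C}" "norm \<nu> = 1" "0 < r" "e $ 1 * \<nu> $ 2 - e $ 2 * \<nu> $ 1 \<noteq> 0"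
    "\<And>x s. x \<in> closure \<Omega> \<Longrightarrow> x \<in> ball (p + c *\<^sub>R e) r \<Longrightarrow> s \<in> {0..<r} \<Longrightarrow> x + s *\<^sub>R \<nu> \<in> closure \<Omega>"
proof (cases "\<exists>c\<in>{0<..<C}. p + c *\<^sub>R e \<in> \<Omega>")
  case True
  then obtain c where c: "c \<in> {0<..<C}" "p + c *\<^sub>R e \<in> \<Omega>" by blast
  then obtain r where r: "r > 0" "ball (p + c *\<^sub>R e) r \<subseteq> \<Omega>" using op open_contains_ball by blast
  define \<nu> :: "real^2" where "\<nu> = vector [- e $ 2, e $ 1]"
  have sq: "e $ 1 * e $ 1 + e $ 2 * e $ 2 = 1"
    using e by (simp add: norm_eq_1 inner_vec_def sum_2)
  have n1: "norm \<nu> = 1"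
    using sq by (simp add: norm_eq_1 inner_vec_def sum_2 \<nu>_def vector_2)
  show ?thesis
  proof (rule that[OF c(1) n1, of "r / 2"])
    show "e $ 1 * \<nu> $ 2 - e $ 2 * \<nu> $ 1 \<noteq> 0" using sq by (simp add: \<nu>_def vector_2)
    fix x s assume x: "x \<in> ball (p + c *\<^sub>R e) (r / 2)" and s: "s \<in> {0..<r / 2}"
    have "dist (p + c *\<^sub>R e) (x + s *\<^sub>R \<nu>) \<le> dist (p + c *\<^sub>R e) x + \<bar>s\<bar>"
      using norm_triangle_ineq4[of "p + c *\<^sub>R e - x" "s *\<^sub>R \<nu>"] n1 by (simp add: dist_norm algebra_simps)
    then have "x + s *\<^sub>R \<nu> \<in> ball (p + c *\<^sub>R e) r" using x s by simp
    then show "x + s *\<^sub>R \<nu> \<in> closure \<Omega>" using r(2) closure_subset by blast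
  qed (use r in simp)
next
  case False
  define m where "m = p + (C / 2) *\<^sub>R e"
  have "m \<in> closure \<Omega>" "m \<notin> \<Omega>" using seg[of "C / 2"] False C by (auto simp: m_def)
  then have "m \<in> frontier \<Omega>" using op by (simp add: frontier_def interior_open)
  from lipschitz_boundary_upward[OF lip this]
  obtain \<nu> r where \<nu>: "norm \<nu> = 1" and r: "0 < r" and up: "\<And>s. s \<in> {0<..<r} \<Longrightarrow> m + s *\<^sub>R \<nu> \<in> \<Omega>"
    and cl: "\<And>x s. x \<in> closure \<Omega> \<Longrightarrow> x \<in> ball m r \<Longrightarrow> s \<in> {0..<r} \<Longrightarrow> x + s *\<^sub>R \<nu> \<in> closure \<Omega>"
    by metis
  show ?thesis
  proof (rule that[of "C / 2", OF _ \<nu> r])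
    show "C / 2 \<in> {0<..<C}" using C by simp
    show "e $ 1 * \<nu> $ 2 - e $ 2 * \<nu> $ 1 \<noteq> 0"
    proof
      assume d: "e $ 1 * \<nu> $ 2 - e $ 2 * \<nu> $ 1 = 0"
      define \<sigma> where "\<sigma> = e \<bullet> \<nu>"
      have sq: "e $ 1 * e $ 1 + e $ 2 * e $ 2 = 1" using e by (simp add: norm_eq_1 inner_vec_def sum_2)
      have "\<sigma> * e $ 1 = (e $ 1 * e $ 1 + e $ 2 * e $ 2) * \<nu> $ 1"
        using d by (simp add: \<sigma>_def inner_vec_def sum_2) algebra
      moreover have "\<sigma> * e $ 2 = (e $ 1 * e $ 1 + e $ 2 * e $ 2) * \<nu> $ 2"
        using d by (simp add: \<sigma>_def inner_vec_def sum_2) algebra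
      ultimately have \<nu>_eq: "\<nu> = \<sigma> *\<^sub>R e" using sq by (simp add: vec_eq_iff forall_2)
      have \<sigma>: "\<bar>\<sigma>\<bar> \<le> 1" using Cauchy_Schwarz_ineq2[of e \<nu>] e \<nu> by (simp add: \<sigma>_def)
      \<comment> \<open>At most C / 4, so that from the midpoint a parallel \<nu> would stay within
        the open segment.\<close>
      define s where "s = min (r / 2) (C / 4)"
      have s: "s \<in> {0<..<r}" "s \<le> C / 4" using r C by (auto simp: s_def)
      have "s * \<bar>\<sigma>\<bar> \<le> s" using s by (intro mult_left_le[OF \<sigma>]) auto
      moreover have "\<bar>s * \<sigma>\<bar> = s * \<bar>\<sigma>\<bar>" using s by (simp add: abs_mult)
      ultimately have "\<bar>s * \<sigma>\<bar> \<le> C / 4" using s(2) by linarith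
      then have "C / 2 + s * \<sigma> \<in> {0<..<C}" using C by auto
      moreover have "m + s *\<^sub>R \<nu> = p + (C / 2 + s * \<sigma>) *\<^sub>R e"
        by (simp add: m_def \<nu>_eq scaleR_add_left)
      ultimately show False using up[OF s(1)] False by auto
    qed
  qed (use cl in \<open>auto simp: m_def\<close>)
qed

text \<open>The size and the second side must not depend on k. They are taken from the limit of a
  convergent subsequence of starting points and directions, whose segment lies in the closure as
  well, and they persist for nearby segments.\<close>

lemma transversal_parallelograms:
  fixes p e :: "nat \<Rightarrow> real^2"
  assumes lip: "lipschitz_boundary \<Omega>" and \<Omega>: "open \<Omega>" "bounded \<Omega>" and e: "\<And>k. norm (e k) = 1" and C: "0 < C"
    and seg: "\<And>k t. t \<in> {0..C} \<Longrightarrow> p k + t *\<^sub>R e k \<in> closure \<Omega>"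
  obtains \<rho> c \<tau> s0 \<delta> \<nu> where "strict_mono (\<rho> :: nat \<Rightarrow> nat)" "0 < c" "0 < \<tau>" "0 < s0" "0 < \<delta>" "norm \<nu> = 1" "c + 3 * \<tau> \<le> C"
    "\<forall>\<^sub>F k in sequentially. \<delta> \<le> \<bar>e (\<rho> k) $ 1 * \<nu> $ 2 - e (\<rho> k) $ 2 * \<nu> $ 1\<bar> \<and>
      (\<forall>t\<in>{0..3 * \<tau>}. \<forall>s\<in>{0..s0}. p (\<rho> k) + (c + t) *\<^sub>R e (\<rho> k) + s *\<^sub>R \<nu> \<in> closure \<Omega>)"
proof -
  have "compact (closure \<Omega> \<times> sphere (0::real^2) 1)"
    using \<Omega> by (intro compact_Times) (auto simp: compact_closure)
  moreover have "\<forall>k. (p k, e k) \<in> closure \<Omega> \<times> sphere 0 1"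
    using seg[of 0] e C by auto
  ultimately have *: "seq_compact (closure \<Omega> \<times> sphere (0::real^2) 1)" "\<forall>k. (p k, e k) \<in> closure \<Omega> \<times> sphere 0 1"
    using compact_eq_seq_compact_metric by blast+
  obtain l \<rho> where l: "l \<in> closure \<Omega> \<times> sphere (0::real^2) 1" "strict_mono (\<rho> :: nat \<Rightarrow> nat)"
    "((\<lambda>k. (p k, e k)) \<circ> \<rho>) \<longlonglongrightarrow> l"
    by (rule seq_compactE[OF *], rule that)
  obtain p' e' where pe: "l = (p', e')" by (cases l)
  have lim: "(\<lambda>k. p (\<rho> k)) \<longlonglongrightarrow> p'" "(\<lambda>k. e (\<rho> k)) \<longlonglongrightarrow> e'"
    using tendsto_fst[OF l(3)] tendsto_snd[OF l(3)] by (simp_all add: pe o_def)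
  have e': "norm e' = 1" using l(1) pe by simp
  have seg': "p' + t *\<^sub>R e' \<in> closure \<Omega>" if "t \<in> {0..C}" for t
  proof (rule closed_sequentially[OF closed_closure])
    show "p (\<rho> k) + t *\<^sub>R e (\<rho> k) \<in> closure \<Omega>" for k by (rule seg[OF that])
    show "(\<lambda>k. p (\<rho> k) + t *\<^sub>R e (\<rho> k)) \<longlonglongrightarrow> p' + t *\<^sub>R e'" by (intro tendsto_intros lim)
  qed
  obtain c \<nu> r where c: "c \<in> {0<..<C}" and \<nu>: "norm \<nu> = 1" and r: "0 < r"
    and d: "e' $ 1 * \<nu> $ 2 - e' $ 2 * \<nu> $ 1 \<noteq> 0"
    and cl: "\<And>x s. x \<in> closure \<Omega> \<Longrightarrow> x \<in> ball (p' + c *\<^sub>R e') r \<Longrightarrow> s \<in> {0..<r} \<Longrightarrow> x + s *\<^sub>R \<nu> \<in> closure \<Omega>"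
    using transversal_direction[OF lip \<Omega>(1) e' C seg'] by metis
  \<comment> \<open>The base has length 3 * \<tau>, half of the minimum: it fits into the remaining
    part of the segment, and with the r / 2 allowed for convergence it stays in the ball of radius
    r.\<close>
  define \<tau> where "\<tau> = min (r / 2) (C - c) / 6"
  have \<tau>: "0 < \<tau>" "3 * \<tau> < r / 2" "c + 3 * \<tau> \<le> C" using r c by (auto simp: \<tau>_def min_def field_simps)
  define \<delta> where "\<delta> = \<bar>e' $ 1 * \<nu> $ 2 - e' $ 2 * \<nu> $ 1\<bar> / 2"
  have \<delta>: "0 < \<delta>" using d by (simp add: \<delta>_def)
  have "(\<lambda>k. \<bar>e (\<rho> k) $ 1 * \<nu> $ 2 - e (\<rho> k) $ 2 * \<nu> $ 1\<bar>) \<longlonglongrightarrow> \<bar>e' $ 1 * \<nu> $ 2 - e' $ 2 * \<nu> $ 1\<bar>"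
    by (intro tendsto_intros lim)
  moreover have "\<delta> < \<bar>e' $ 1 * \<nu> $ 2 - e' $ 2 * \<nu> $ 1\<bar>" using d by (simp add: \<delta>_def)
  ultimately have ev1: "\<forall>\<^sub>F k in sequentially. \<delta> < \<bar>e (\<rho> k) $ 1 * \<nu> $ 2 - e (\<rho> k) $ 2 * \<nu> $ 1\<bar>"
    by (rule order_tendstoD)
  have "(\<lambda>k. p (\<rho> k) + c *\<^sub>R e (\<rho> k)) \<longlonglongrightarrow> p' + c *\<^sub>R e'" by (intro tendsto_intros lim)
  then have ev2: "\<forall>\<^sub>F k in sequentially. dist (p (\<rho> k) + c *\<^sub>R e (\<rho> k)) (p' + c *\<^sub>R e') < r / 2"
    by (rule tendstoD) (use r in simp)
  have "\<forall>\<^sub>F k in sequentially. \<delta> \<le> \<bar>e (\<rho> k) $ 1 * \<nu> $ 2 - e (\<rho> k) $ 2 * \<nu> $ 1\<bar> \<and>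
      (\<forall>t\<in>{0..3 * \<tau>}. \<forall>s\<in>{0..r / 2}. p (\<rho> k) + (c + t) *\<^sub>R e (\<rho> k) + s *\<^sub>R \<nu> \<in> closure \<Omega>)"
    using ev1 ev2
  proof eventually_elim
    case (elim k)
    have "p (\<rho> k) + (c + t) *\<^sub>R e (\<rho> k) + s *\<^sub>R \<nu> \<in> closure \<Omega>" if t: "t \<in> {0..3 * \<tau>}" and s: "s \<in> {0..r / 2}" for t s
    proof (rule cl)
      show "p (\<rho> k) + (c + t) *\<^sub>R e (\<rho> k) \<in> closure \<Omega>"
        using t c \<tau> by (intro seg) auto
      let ?x = "p (\<rho> k) + c *\<^sub>R e (\<rho> k)" and ?m = "p' + c *\<^sub>R e'"
      have "dist ?m (?x + t *\<^sub>R e (\<rho> k)) \<le> dist ?m ?x + \<bar>t\<bar>"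
        using norm_triangle_ineq4[of "?m - ?x" "t *\<^sub>R e (\<rho> k)"] e[of "\<rho> k"] by (simp add: dist_norm algebra_simps)
      also have "\<dots> < r" using elim(2) t \<tau>(2) by (simp add: dist_commute)
      finally show "p (\<rho> k) + (c + t) *\<^sub>R e (\<rho> k) \<in> ball ?m r" by (simp add: scaleR_add_left add_ac)
      show "s \<in> {0..<r}" using s r by auto
    qed
    with elim(1) show ?case by auto
  qed
  then show ?thesis using that[of \<rho> c \<tau> "r / 2" \<delta> \<nu>] l(2) c \<tau> r \<delta> \<nu> by auto
qed

subsection \<open>The quadratic solution and its error\<close>

text \<open>A segment is a degenerate triangle with a repeated vertex, so the area formula gives
  0.\<close>

lemma negligible_closed_segment_real2: "negligible (closed_segment a (b :: real^2))"
proof -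
  have eq: "closed_segment a b = convex hull {a, b, b}" by (simp add: segment_convex_hull)
  have "measure lborel (convex hull {a, b, b}) = 0" unfolding content_triangle by (simp add: mult.commute)
  moreover have "convex hull {a, b, b} \<in> sets lborel" by (simp add: borel_compact finite_imp_compact_convex_hull)
  ultimately have "measure lebesgue (closed_segment a b) = 0" unfolding eq by (simp add: measure_completion)
  moreover have "closed_segment a b \<in> lmeasurable" by (simp add: lmeasurable_compact)
  ultimately show ?thesis by (simp add: negligible_iff_measure0)
qed

lemma negligible_frontier_polygonal_domain:
  assumes "polygonal_domain \<Omega>" shows "negligible (frontier \<Omega>)"
proof -
  obtain S where S: "finite S" "frontier \<Omega> = (\<Union>(a, b)\<in>S. closed_segment a b)"
    using assms by (auto simp: polygonal_domain_def)
  have "negligible (\<Union>((\<lambda>(a, b). closed_segment a b) ` S))"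
    using S(1) by (intro negligible_Union) (auto simp: negligible_closed_segment_real2)
  then show ?thesis unfolding S(2) .
qed

text \<open>For \<open>H2\<close> the chosen first derivative is differentiated again, although it
  is known only almost everywhere; this allows replacing it by a coordinate function.\<close>

lemma is_weak_partial_cong_AE:
  assumes "is_weak_partial \<Omega> i u g" "AE x in lebesgue_on \<Omega>. u' x = u x"
    and m: "u \<in> borel_measurable (lebesgue_on \<Omega>)" "u' \<in> borel_measurable (lebesgue_on \<Omega>)"
  shows "is_weak_partial \<Omega> i u' g"
proof -
  have "(LINT x|lebesgue_on \<Omega>. u' x * partial i \<phi> x) = (LINT x|lebesgue_on \<Omega>. u x * partial i \<phi> x)"
    if "\<phi> \<in> test_functions \<Omega>" for \<phi>
  proof (rule integral_cong_AE)
    have "partial i \<phi> \<in> borel_measurable (lebesgue_on \<Omega>)"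
      using test_function_smooth(2)[OF that] by (intro borel_lebesgue_on borel_measurable_continuous_onI)
    with m show "(\<lambda>x. u' x * partial i \<phi> x) \<in> borel_measurable (lebesgue_on \<Omega>)"
      "(\<lambda>x. u x * partial i \<phi> x) \<in> borel_measurable (lebesgue_on \<Omega>)"
      by (auto intro: borel_measurable_times)
    show "AE x in lebesgue_on \<Omega>. u' x * partial i \<phi> x = u x * partial i \<phi> x"
      using assms(2) by eventually_elim simp
  qed
  with assms(1) show ?thesis by (simp add: is_weak_partial_def)
qed

lemma has_derivative_half_square:
  fixes x :: "'a::real_inner"
  shows "((\<lambda>x. (x \<bullet> x) / 2) has_derivative (\<bullet>) x) (at x)"
proof -
  have eq: "(\<bullet>) x = (\<lambda>h. 1 / 2 * (x \<bullet> h + h \<bullet> x))"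
    by (rule ext) (simp add: inner_commute[of _ x])
  have "((\<lambda>x. 1 / 2 * (x \<bullet> x)) has_derivative (\<lambda>h. 1 / 2 * (x \<bullet> h + h \<bullet> x))) (at x)"
    by (intro has_derivative_mult_right has_derivative_inner has_derivative_ident)
  then show ?thesis unfolding eq[symmetric] by simp
qed

text \<open>A ball around \<Omega> serves as the only piece, so the calculus for piecewise functions
  applies to u and to its derivatives, the coordinates.\<close>

lemma half_square_in_H2:
  assumes "open \<Omega>" "bounded \<Omega>"
  shows "(\<lambda>x::real^2. (x \<bullet> x) / 2) \<in> H2 \<Omega>"
proof -
  let ?u = "\<lambda>x::real^2. (x \<bullet> x) / 2"
  obtain R where "\<And>x. x \<in> \<Omega> \<Longrightarrow> norm x \<le> R"
    using assms(2) unfolding bounded_iff by auto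
  then have R: "\<Omega> \<subseteq> cball 0 R" by auto
  let ?\<T> = "{cball (0::real^2) R}"
  have sub: "\<Omega> \<subseteq> \<Union>?\<T>" using R by simp
  have pw: "piecewise_C1 ?\<T> (\<lambda>_. ?u) (\<lambda>_ x. x) ?u"
    unfolding piecewise_C1_def
    by (simp add: has_derivative_half_square)
  have pwi: "piecewise_C1 ?\<T> (\<lambda>_ x. x $ i) (\<lambda>_ _. axis i 1) (\<lambda>x. x $ i)" for i
    unfolding piecewise_C1_def
  proof (intro conjI ballI allI)
    have eq: "(\<lambda>x::real^2. x $ i) = (\<bullet>) (axis i 1)" by (simp add: fun_eq_iff inner_axis')
    show "((\<lambda>x::real^2. x $ i) has_derivative (\<bullet>) (axis i 1)) (at x)" for x
      unfolding eq by (rule bounded_linear_imp_has_derivative[OF bounded_linear_inner_right])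
  qed auto
  have H1: "weak_partial \<Omega> i ?u \<in> H1 \<Omega>" for i
  proof -
    note w = weak_partial_AE(1)[OF assms piecewise_C1_is_weak_partial[OF pw assms(1) sub], of i]
    have ae: "AE x in lebesgue_on \<Omega>. weak_partial \<Omega> i ?u x = x $ i"
    proof -
      have "AE x in lebesgue_on \<Omega>. x \<in> \<Omega>"
        by (rule AE_I2) (simp add: space_restrict_space)
      with weak_partial_piecewise_C1(1)[OF pw assms(1) sub, of i] show ?thesis
      proof eventually_elim
        case (elim x)
        have "pgrad ?\<T> (\<lambda>_ x. x) x \<bullet> axis i 1 = x \<bullet> axis i 1"
          by (rule pgrad_eqI) (use elim sub in auto)
        with elim show ?case by (simp add: inner_axis)
      qed
    qed
    have "is_weak_partial \<Omega> j (weak_partial \<Omega> i ?u) (\<lambda>x. pgrad ?\<T> (\<lambda>_ _. axis i 1) x $ j)" for j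
    proof (rule is_weak_partial_cong_AE[OF piecewise_C1_is_weak_partial[OF pwi assms(1) sub] ae])
      show "(\<lambda>x. x $ i) \<in> borel_measurable (lebesgue_on \<Omega>)"
        by (intro borel_lebesgue_on borel_measurable_continuous_onI continuous_intros)
      show "weak_partial \<Omega> i ?u \<in> borel_measurable (lebesgue_on \<Omega>)"
        by (rule weak_partial_piecewise_C1(2)[OF pw assms(1) sub])
    qed
    then show ?thesis
      using w unfolding H1_def is_weak_partial_def by blast
  qed
  with piecewise_C1_H1[OF pw assms(1) sub] show ?thesis by (simp add: H2_def)
qed

context
  fixes \<Omega> :: "(real^2) set" and \<T> :: "(real^2) set set" and U :: "real^2 \<Rightarrow> real"
  assumes tri: "conforming_triangulation \<Omega> \<T>" and op: "open \<Omega>" and U: "U \<in> fe_space \<T>"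
begin

lemma error_piecewise_C1:
  "piecewise_C1 \<T> (\<lambda>K x. (x \<bullet> x) / 2 - (slope U K \<bullet> x + offset U K)) (\<lambda>K x. x - slope U K) (\<lambda>x. (x \<bullet> x) / 2 - U x)"
  unfolding piecewise_C1_def
proof (intro conjI ballI allI)
  fix K assume K: "K \<in> \<T>"
  show "convex K" "compact K" using two_simplex_facts(1,2)[OF triangulation_facts(4)[OF tri op K]] by auto
  show "continuous_on UNIV (\<lambda>x. x - slope U K)" by (intro continuous_intros)
  show "((\<lambda>x. (x \<bullet> x) / 2 - (slope U K \<bullet> x + offset U K)) has_derivative (\<bullet>) (x - slope U K)) (at x)" for x
  proof -
    have d: "((\<lambda>x. slope U K \<bullet> x + offset U K) has_derivative (\<bullet>) (slope U K)) (at x)"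
      by (rule derivative_eq_intros | rule refl)+ simp
    have eq: "(\<bullet>) (x - slope U K) = (\<lambda>h. x \<bullet> h - slope U K \<bullet> h)"
      by (simp add: fun_eq_iff inner_diff_left)
    show ?thesis unfolding eq by (rule has_derivative_diff[OF has_derivative_half_square d])
  qed
  show "(x \<bullet> x) / 2 - U x = (x \<bullet> x) / 2 - (slope U K \<bullet> x + offset U K)" if "x \<in> K" for x
    using fe_space_slope_offset[OF U K that] by simp
qed (rule triangulation_facts[OF tri op])

text \<open>Restricted to the triangulated set because outside it every \<open>pgrad\<close> is 0,
  whereas \<open>grad_error\<close> is x.\<close>

lemma pgrad_error:
  assumes "x \<in> \<Union>\<T>"
  shows "pgrad \<T> (\<lambda>K x. x - slope U K) x = grad_error \<T> U x"
proof -
  have "pgrad \<T> (\<lambda>K x. x) x \<bullet> v = x \<bullet> v" for v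
    by (rule pgrad_eqI) (use assms triangulation_facts(1)[OF tri op] in auto)
  then have "pgrad \<T> (\<lambda>K x. x) x = x" by (meson vector_eq_rdot)
  then show ?thesis
    using pgrad_add_scaleR[of \<T> "\<lambda>K x. x" "- 1" "\<lambda>K x. slope U K" x] by (simp add: grad_error_def)
qed

lemma error_integrals:
  "(LINT x|lebesgue_on \<Omega>. pgrad \<T> (\<lambda>K x. x - slope U K) x \<bullet> pgrad \<T> (\<lambda>K x. x - slope U K) x) =
    (H1_seminorm \<Omega> (\<lambda>x. (x \<bullet> x) / 2 - U x))\<^sup>2"
  "integrable (lebesgue_on \<Omega>) (\<lambda>x. grad_error \<T> U x \<bullet> grad_error \<T> U x)"
  "(LINT x|lebesgue_on \<Omega>. grad_error \<T> U x \<bullet> grad_error \<T> U x) = (H1_seminorm \<Omega> (\<lambda>x. (x \<bullet> x) / 2 - U x))\<^sup>2"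
proof -
  let ?g = "pgrad \<T> (\<lambda>K x. x - slope U K)"
  note sub = triangulation_facts(3)[OF tri op]
  show 1: "(LINT x|lebesgue_on \<Omega>. ?g x \<bullet> ?g x) = (H1_seminorm \<Omega> (\<lambda>x. (x \<bullet> x) / 2 - U x))\<^sup>2"
    unfolding H1_seminorm_eq_dirichlet_form
      dirichlet_form_piecewise_C1[OF error_piecewise_C1 error_piecewise_C1 op sub sub]
    by simp
  have eq: "?g x \<bullet> ?g x = grad_error \<T> U x \<bullet> grad_error \<T> U x" if "x \<in> space (lebesgue_on \<Omega>)" for x
  proof -
    have "x \<in> \<Union>\<T>" using that by (intro subsetD[OF sub]) (simp add: space_restrict_space)
    from pgrad_error[OF this] show ?thesis by simp
  qed
  have "integrable (lebesgue_on \<Omega>) (\<lambda>x. ?g x \<bullet> ?g x)"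
    by (rule pgrad_inner_integrable[OF error_piecewise_C1 error_piecewise_C1 op sub])
  then show "integrable (lebesgue_on \<Omega>) (\<lambda>x. grad_error \<T> U x \<bullet> grad_error \<T> U x)"
    by (subst (asm) Bochner_Integration.integrable_cong[OF refl eq])
  show "(LINT x|lebesgue_on \<Omega>. grad_error \<T> U x \<bullet> grad_error \<T> U x) = (H1_seminorm \<Omega> (\<lambda>x. (x \<bullet> x) / 2 - U x))\<^sup>2"
    unfolding 1[symmetric] using eq by (intro Bochner_Integration.integral_cong) auto
qed

text \<open>On a segment where \<open>U\<close> is nearly affine, the second difference of \<open>u - U\<close> is close to that
  of \<open>u\<close>, namely \<open>\<tau>\<^sup>2\<close>; the trace estimate turns this into a lower bound for the error.\<close>

lemma error_lower_bound:
  assumes neg: "negligible (frontier \<Omega>)" and pos: "0 < \<tau>" "0 < s0" "0 < c" "0 < l"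
    and e: "norm e = 1" and \<nu>: "norm \<nu> = 1" and d: "e $ 1 * \<nu> $ 2 - e $ 2 * \<nu> $ 1 \<noteq> 0"
    and L: "c + 3 * \<tau> \<le> L"
    and affine: "\<And>t. t \<in> {0..L} \<Longrightarrow> \<bar>U (p + t *\<^sub>R e) - U p - s * t\<bar> \<le> \<kappa> * t"
    and \<kappa>: "0 \<le> \<kappa>" "4 * \<kappa> * L \<le> \<tau>\<^sup>2 / 2"
    and rect: "\<And>t s. t \<in> {0..3 * \<tau>} \<Longrightarrow> s \<in> {0..s0} \<Longrightarrow> p + (c + t) *\<^sub>R e + s *\<^sub>R \<nu> \<in> closure \<Omega>"
  shows "\<bar>e $ 1 * \<nu> $ 2 - e $ 2 * \<nu> $ 1\<bar> * (\<tau>\<^sup>2 / 2 * \<tau> * s0) \<le>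
    (2 * \<tau> + 4 * s0) * (l / 2 * measure lebesgue \<Omega> + (H1_seminorm \<Omega> (\<lambda>x. (x \<bullet> x) / 2 - U x))\<^sup>2 / (2 * l))"
    (is "?lhs \<le> ?r * ?b")
proof -
  let ?f = "\<lambda>x. (x \<bullet> x) / 2 - U x" and ?q = "p + c *\<^sub>R e"
  note cl = triangulation_facts(2)[OF tri op]
  have ee: "e \<bullet> e = 1" using e by (simp add: norm_eq_1)
  have second: "\<tau>\<^sup>2 / 2 \<le> \<bar>?f (?q + (t + 2 * \<tau>) *\<^sub>R e) - 2 * ?f (?q + (t + \<tau>) *\<^sub>R e) + ?f (?q + t *\<^sub>R e)\<bar>"
    if t: "t \<in> {0..\<tau>}" for t
  proof -
    have sh: "?q + r *\<^sub>R e = p + (c + r) *\<^sub>R e" for r by (simp add: scaleR_add_left)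
    \<comment> \<open>The deviation of U from an affine function, whose second differences vanish.
      The weights 1, 2, 1 produce the factor 4 in the smallness condition on \<kappa>, which leaves
      half of the second difference of u.\<close>
    define A where "A r = U (p + r *\<^sub>R e) - U p - s * r" for r
    have A: "\<bar>A (c + r)\<bar> \<le> \<kappa> * L" if "0 \<le> r" "r \<le> 3 * \<tau>" for r
    proof -
      have "\<bar>A (c + r)\<bar> \<le> \<kappa> * (c + r)" unfolding A_def using that pos L by (intro affine) auto
      also have "\<dots> \<le> \<kappa> * L" using \<kappa> that L by (intro mult_left_mono) auto
      finally show ?thesis .
    qed
    have u: "((p + r *\<^sub>R e) \<bullet> (p + r *\<^sub>R e)) / 2 = (p \<bullet> p) / 2 + r * (p \<bullet> e) + r\<^sup>2 / 2" for r
      by (simp add: inner_add_left inner_add_right ee inner_commute power2_eq_square field_simps)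
    have Ur: "U (p + r *\<^sub>R e) = A r + U p + s * r" for r by (simp add: A_def)
    have "?f (?q + (t + 2 * \<tau>) *\<^sub>R e) - 2 * ?f (?q + (t + \<tau>) *\<^sub>R e) + ?f (?q + t *\<^sub>R e) =
        \<tau>\<^sup>2 - (A (c + (t + 2 * \<tau>)) - 2 * A (c + (t + \<tau>)) + A (c + t))"
      unfolding sh u Ur by (simp add: power2_eq_square field_simps)
    moreover have "\<bar>A (c + (t + 2 * \<tau>)) - 2 * A (c + (t + \<tau>)) + A (c + t)\<bar> \<le> 4 * (\<kappa> * L)"
      using A[of "t + 2 * \<tau>"] A[of "t + \<tau>"] A[of t] t pos by auto
    ultimately show ?thesis using \<kappa>(2) by linarith
  qed
  have "?q + t *\<^sub>R e + s *\<^sub>R \<nu> \<in> \<Union>\<T>" if "t \<in> {0..3 * \<tau>}" "s \<in> {0..s0}" for t s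
    using rect[OF that] unfolding cl by (simp add: scaleR_add_left add_ac)
  from trace_second_difference[OF error_piecewise_C1 _ _ d pos(1,2) _ this second] e \<nu>
  have "ennreal ?lhs \<le> ennreal ?r * (\<integral>\<^sup>+x. ennreal (norm (pgrad \<T> (\<lambda>K x. x - slope U K) x)) \<partial>lborel)"
    by simp
  also have "\<dots> \<le> ennreal ?r * ennreal ?b"
    using nn_integral_pgrad_le[OF error_piecewise_C1 op cl neg pos(4)]
    by (intro mult_left_mono) (simp_all add: error_integrals)
  also have "\<dots> = ennreal (?r * ?b)" using pos by (intro ennreal_mult[symmetric]) auto
  finally show ?thesis
    using pos by (subst (asm) ennreal_le_iff) (auto intro!: mult_nonneg_nonneg add_nonneg_nonneg)
qed

end

theorem mainTheorem5:
  fixes \<Omega> :: "(real^2) set"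
    and h\<^sub>0 C\<^sub>L :: real
    and \<T> :: "real \<Rightarrow> (real^2) set set"
    and h hbar L :: "nat \<Rightarrow> real"
    and B :: "nat \<Rightarrow> (real^2) set"
  assumes "polygonal_domain \<Omega>" and "lipschitz_boundary \<Omega>"
    and "0 < h\<^sub>0"
    and "\<And>\<eta>. \<eta> \<in> {0<..<h\<^sub>0} \<Longrightarrow> conforming_triangulation \<Omega> (\<T> \<eta>)"
    and "\<And>\<eta>. \<eta> \<in> {0<..<h\<^sub>0} \<Longrightarrow> Max (diameter ` \<T> \<eta>) = \<eta>"
    and "0 < C\<^sub>L"
    and "\<And>k. h k \<in> {0<..<h\<^sub>0}" and "h \<longlonglongrightarrow> 0"
    and "\<And>k. regular_band (\<T> (h k)) (h k) (hbar k) (L k) (B k)"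
    and "\<And>k. C\<^sub>L \<le> L k"
    and "hbar \<in> o(\<lambda>k. h k ^ 4)"
  shows "\<not> (\<forall>u\<in>H2 \<Omega>. \<forall>U. (\<forall>\<eta>\<in>{0<..<h\<^sub>0}. fe_solution \<Omega> (\<T> \<eta>) u (U \<eta>)) \<longrightarrow>
            ((\<lambda>\<eta>. H1_seminorm \<Omega> (\<lambda>x. u x - U \<eta> x)) \<longlongrightarrow> 0) (at_right 0))"
proof
  assume conv: "\<forall>u\<in>H2 \<Omega>. \<forall>U. (\<forall>\<eta>\<in>{0<..<h\<^sub>0}. fe_solution \<Omega> (\<T> \<eta>) u (U \<eta>)) \<longrightarrow>
      ((\<lambda>\<eta>. H1_seminorm \<Omega> (\<lambda>x. u x - U \<eta> x)) \<longlongrightarrow> 0) (at_right 0)"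
  have \<Omega>: "open \<Omega>" "connected \<Omega>" "\<Omega> \<noteq> {}" "bounded \<Omega>"
    using assms(1) by (auto simp: polygonal_domain_def)
  have neg: "negligible (frontier \<Omega>)" by (rule negligible_frontier_polygonal_domain[OF assms(1)])
  define u :: "real^2 \<Rightarrow> real" where "u = (\<lambda>x. (x \<bullet> x) / 2)"
  have u: "u \<in> H2 \<Omega>" unfolding u_def by (rule half_square_in_H2[OF \<Omega>(1,4)])
  have "\<exists>U. fe_solution \<Omega> (\<T> \<eta>) u U" if \<eta>: "\<eta> \<in> {0<..<h\<^sub>0}" for \<eta>
  proof (rule fe_solution_exists[OF assms(4)[OF \<eta>] \<Omega>(1,2,4,3) u])
    show "continuous_on (closure \<Omega>) u" unfolding u_def by (intro continuous_intros) simp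
  qed simp
  then obtain U where U: "\<And>\<eta>. \<eta> \<in> {0<..<h\<^sub>0} \<Longrightarrow> fe_solution \<Omega> (\<T> \<eta>) u (U \<eta>)" by metis
  define \<epsilon> where "\<epsilon> k = H1_seminorm \<Omega> (\<lambda>x. (x \<bullet> x) / 2 - U (h k) x)" for k
  have h_pos: "0 < h k" for k using assms(7)[of k] by simp
  have \<epsilon>_lim: "\<epsilon> \<longlonglongrightarrow> 0"
  proof -
    have "filterlim h (at_right 0) sequentially"
      by (rule tendsto_imp_filterlim_at_right[OF assms(8)]) (simp add: h_pos)
    from filterlim_compose[OF conv[rule_format, OF u U] this]
    show ?thesis by (simp add: \<epsilon>_def[abs_def] u_def)
  qed
  have tri: "conforming_triangulation \<Omega> (\<T> (h k))" for k by (rule assms(4)[OF assms(7)])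
  have Uk: "U (h k) \<in> fe_space (\<T> (h k))" for k
    using U[OF assms(7)] by (simp add: fe_solution_def)
  note cl = triangulation_facts(2)[OF tri \<Omega>(1)]
  \<comment> \<open>The bound for the square of the deviation rate on the k-th band. It tends to 0
    because the edge lengths are bounded by the size of \<Omega> and hbar / h^4 tends to 0.\<close>
  define \<beta> where "\<beta> k = 128 * L k * (\<epsilon> k)\<^sup>2 * (hbar k / h k ^ 4) + 128 * (L k)\<^sup>2 * (hbar k / h k) ^ 4" for k
  have "\<exists>p e s \<kappa>. norm e = 1 \<and> 0 \<le> \<kappa> \<and> (\<forall>t\<in>{0..L k}. p + t *\<^sub>R e \<in> closure \<Omega> \<and>
      \<bar>U (h k) (p + t *\<^sub>R e) - U (h k) p - s * t\<bar> \<le> \<kappa> * t) \<and> \<kappa>\<^sup>2 \<le> \<beta> k" for k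
  proof -
    note err = error_integrals(2,3)[OF tri[of k] \<Omega>(1) Uk[of k]]
    show ?thesis
    proof (rule regular_band_nearly_affine[OF tri[of k] \<Omega>(1) neg Uk[of k] assms(9)[of k] err(1)])
      fix p e s \<kappa>
      assume *: "norm e = 1" "0 \<le> \<kappa>" "\<And>t. t \<in> {0..L k} \<Longrightarrow> p + t *\<^sub>R e \<in> \<Union>(\<T> (h k))"
        "\<And>t. t \<in> {0..L k} \<Longrightarrow> \<bar>U (h k) (p + t *\<^sub>R e) - U (h k) p - s * t\<bar> \<le> \<kappa> * t"
        "\<kappa>\<^sup>2 \<le> 128 * L k * (LINT x|lebesgue_on \<Omega>. grad_error (\<T> (h k)) (U (h k)) x \<bullet> grad_error (\<T> (h k)) (U (h k)) x) *
          (hbar k / h k ^ 4) + 128 * (L k)\<^sup>2 * (hbar k / h k) ^ 4"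
      have "\<kappa>\<^sup>2 \<le> \<beta> k" using *(5) unfolding err(2) \<beta>_def \<epsilon>_def .
      with *(1-4) show ?thesis unfolding cl by blast
    qed
  qed
  then obtain p e s \<kappa> where e: "\<And>k. norm (e k) = 1" and \<kappa>0: "\<And>k. 0 \<le> \<kappa> k"
    and seg: "\<And>k t. t \<in> {0..L k} \<Longrightarrow> p k + t *\<^sub>R e k \<in> closure \<Omega>"
    and affine: "\<And>k t. t \<in> {0..L k} \<Longrightarrow> \<bar>U (h k) (p k + t *\<^sub>R e k) - U (h k) (p k) - s k * t\<bar> \<le> \<kappa> k * t"
    and \<kappa>\<beta>: "\<And>k. (\<kappa> k)\<^sup>2 \<le> \<beta> k"
    by metis
  have L_pos: "0 < L k" for k using assms(6) assms(10)[of k] by simp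
  obtain R where R: "0 < R" "\<And>x. x \<in> closure \<Omega> \<Longrightarrow> norm x \<le> R"
    using bounded_closure[OF \<Omega>(4)] unfolding bounded_pos by auto
  have L_le: "L k \<le> 2 * R" for k
  proof -
    have "norm (p k + 0 *\<^sub>R e k) \<le> R" "norm (p k + L k *\<^sub>R e k) \<le> R"
      using L_pos[of k] by (intro R(2) seg; simp)+
    then have "norm ((p k + L k *\<^sub>R e k) - (p k + 0 *\<^sub>R e k)) \<le> R + R"
      by (intro order_trans[OF norm_triangle_ineq4] add_mono)
    then show ?thesis using e[of k] L_pos[of k] by simp
  qed
  have \<beta>_lim: "\<beta> \<longlonglongrightarrow> 0"
  proof -
    have q: "(\<lambda>k. hbar k / h k ^ 4) \<longlonglongrightarrow> 0" by (rule smalloD_tendsto[OF assms(11)])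
    have "(\<lambda>k. hbar k / h k ^ 4 * h k ^ 3) \<longlonglongrightarrow> 0 * 0 ^ 3" by (intro tendsto_intros q assms(8))
    moreover have "hbar k / h k ^ 4 * h k ^ 3 = hbar k / h k" for k
      using h_pos[of k] by (simp add: field_simps power_numeral_reduce)
    ultimately have q': "(\<lambda>k. hbar k / h k) \<longlonglongrightarrow> 0" by simp
    have hbar: "0 < hbar k" for k using assms(9)[of k] by (simp add: regular_band_def)
    have lim: "(\<lambda>k. 128 * (2 * R) * (\<epsilon> k)\<^sup>2 * (hbar k / h k ^ 4) + 128 * (2 * R)\<^sup>2 * (hbar k / h k) ^ 4) \<longlonglongrightarrow>
        128 * (2 * R) * 0\<^sup>2 * 0 + 128 * (2 * R)\<^sup>2 * 0 ^ 4"
      by (intro tendsto_intros \<epsilon>_lim q q')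
    show ?thesis
    proof (rule tendsto_sandwich[of "\<lambda>_. 0"])
      show "\<forall>\<^sub>F k in sequentially. 0 \<le> \<beta> k"
        using \<kappa>\<beta> by (intro always_eventually allI) (meson order_trans zero_le_power2)
      show "\<forall>\<^sub>F k in sequentially. \<beta> k \<le> 128 * (2 * R) * (\<epsilon> k)\<^sup>2 * (hbar k / h k ^ 4) + 128 * (2 * R)\<^sup>2 * (hbar k / h k) ^ 4"
        unfolding \<beta>_def using L_le L_pos hbar h_pos R(1)
        by (intro always_eventually allI add_mono mult_right_mono mult_left_mono power_mono)
          (auto intro!: divide_nonneg_nonneg simp: less_imp_le)
    qed (use lim in simp_all)
  qed
  have seg': "p k + t *\<^sub>R e k \<in> closure \<Omega>" if "t \<in> {0..C\<^sub>L}" for k t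
    using that assms(10)[of k] by (intro seg) auto
  obtain \<rho> c \<tau> s0 \<delta> \<nu> where \<rho>: "strict_mono (\<rho> :: nat \<Rightarrow> nat)" and pos: "0 < c" "0 < \<tau>" "0 < s0" "0 < \<delta>"
    and \<nu>: "norm \<nu> = 1" and C: "c + 3 * \<tau> \<le> C\<^sub>L"
    and ev: "\<forall>\<^sub>F k in sequentially. \<delta> \<le> \<bar>e (\<rho> k) $ 1 * \<nu> $ 2 - e (\<rho> k) $ 2 * \<nu> $ 1\<bar> \<and>
      (\<forall>t\<in>{0..3 * \<tau>}. \<forall>s\<in>{0..s0}. p (\<rho> k) + (c + t) *\<^sub>R e (\<rho> k) + s *\<^sub>R \<nu> \<in> closure \<Omega>)"
    by (rule transversal_parallelograms[OF assms(2) \<Omega>(1,4) e assms(6) seg'], assumption, rule that)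
  define r where "r = 2 * \<tau> + 4 * s0"
  define a where "a = \<delta> * (\<tau>\<^sup>2 / 2 * \<tau> * s0)"
  define m where "m = measure lebesgue \<Omega>"
  \<comment> \<open>Chosen so that the volume term r * (l / 2 * m) takes at most half of the lower
    bound a; m + 1 keeps the denominator positive.\<close>
  define l where "l = a / (r * (m + 1))"
  have m: "0 \<le> m" and r: "0 < r" and a: "0 < a" using pos by (auto simp: m_def r_def a_def)
  then have l: "0 < l" by (simp add: l_def)
  have rlm: "r * (l / 2 * m) \<le> a / 2"
  proof -
    have i1: "r * l = a / (m + 1)" using r by (simp add: l_def)
    have i2: "r * (l / 2 * m) = (r * l) * (m / 2)" by simp
    have i3: "a / (m + 1) * (m / 2) = a / 2 * (m / (m + 1))"
      unfolding times_divide_times_eq by (simp only: mult.commute)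
    have "r * (l / 2 * m) = a / 2 * (m / (m + 1))" by (simp only: i1 i2 i3)
    also have "\<dots> \<le> a / 2 * 1" using a m by (intro mult_left_mono) auto
    finally show ?thesis by simp
  qed
  have \<epsilon>2_lim: "(\<lambda>k. (\<epsilon> (\<rho> k))\<^sup>2) \<longlonglongrightarrow> 0\<^sup>2"
    using LIMSEQ_subseq_LIMSEQ[OF \<epsilon>_lim \<rho>] by (intro tendsto_intros) (simp add: o_def)
  \<comment> \<open>The threshold is the negation of what the lower bound yields once the volume
    term is absorbed: a / 2 is at most r times the squared error over 2 * l.\<close>
  have ev_\<epsilon>: "\<forall>\<^sub>F k in sequentially. (\<epsilon> (\<rho> k))\<^sup>2 < a * l / r"
    by (rule order_tendstoD(2)[OF \<epsilon>2_lim]) (use a l r in simp)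
  have \<beta>_sub_lim: "(\<lambda>k. \<beta> (\<rho> k)) \<longlonglongrightarrow> 0"
    using LIMSEQ_subseq_LIMSEQ[OF \<beta>_lim \<rho>] by (simp add: o_def)
  \<comment> \<open>With edge length at most 2 * R, a rate \<kappa> below \<tau>^2 / (16 * R) gives
    exactly the condition that 4 * \<kappa> * L is at most \<tau>^2 / 2.\<close>
  have ev_\<beta>: "\<forall>\<^sub>F k in sequentially. \<beta> (\<rho> k) < (\<tau>\<^sup>2 / (16 * R))\<^sup>2"
    by (rule order_tendstoD(2)[OF \<beta>_sub_lim]) (use pos R(1) in simp)
  obtain k where k: "\<delta> \<le> \<bar>e (\<rho> k) $ 1 * \<nu> $ 2 - e (\<rho> k) $ 2 * \<nu> $ 1\<bar>"
    "\<And>t s. t \<in> {0..3 * \<tau>} \<Longrightarrow> s \<in> {0..s0} \<Longrightarrow> p (\<rho> k) + (c + t) *\<^sub>R e (\<rho> k) + s *\<^sub>R \<nu> \<in> closure \<Omega>"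
    "(\<epsilon> (\<rho> k))\<^sup>2 < a * l / r" "\<beta> (\<rho> k) < (\<tau>\<^sup>2 / (16 * R))\<^sup>2"
    using eventually_happens[OF eventually_conj[OF ev eventually_conj[OF ev_\<epsilon> ev_\<beta>]]] by auto
  let ?j = "\<rho> k"
  have "(\<kappa> ?j)\<^sup>2 < (\<tau>\<^sup>2 / (16 * R))\<^sup>2" using \<kappa>\<beta>[of ?j] k(4) by linarith
  then have "\<kappa> ?j < \<tau>\<^sup>2 / (16 * R)" by (rule power2_less_imp_less) (use R(1) in simp)
  then have "\<kappa> ?j * (16 * R) \<le> \<tau>\<^sup>2" using R(1) by (simp add: field_simps)
  moreover have "\<kappa> ?j * L ?j \<le> \<kappa> ?j * (2 * R)" using \<kappa>0 L_le by (intro mult_left_mono)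
  ultimately have \<kappa>: "4 * \<kappa> ?j * L ?j \<le> \<tau>\<^sup>2 / 2" by (simp add: algebra_simps)
  have "c + 3 * \<tau> \<le> L ?j" using C assms(10)[of ?j] by linarith
  moreover have "e ?j $ 1 * \<nu> $ 2 - e ?j $ 2 * \<nu> $ 1 \<noteq> 0" using k(1) pos(4) by auto
  ultimately have "\<bar>e ?j $ 1 * \<nu> $ 2 - e ?j $ 2 * \<nu> $ 1\<bar> * (\<tau>\<^sup>2 / 2 * \<tau> * s0) \<le> r * (l / 2 * m + (\<epsilon> ?j)\<^sup>2 / (2 * l))"
    unfolding r_def m_def \<epsilon>_def
    by (intro error_lower_bound[OF tri \<Omega>(1) Uk neg pos(2,3,1) l e \<nu> _ _ affine \<kappa>0 \<kappa> k(2)])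
  moreover have "a \<le> \<bar>e ?j $ 1 * \<nu> $ 2 - e ?j $ 2 * \<nu> $ 1\<bar> * (\<tau>\<^sup>2 / 2 * \<tau> * s0)"
    unfolding a_def using k(1) pos by (intro mult_right_mono) auto
  ultimately have "a / 2 \<le> r * ((\<epsilon> ?j)\<^sup>2 / (2 * l))" using rlm by (simp add: distrib_left)
  then have "a * l / r \<le> (\<epsilon> ?j)\<^sup>2" using l r by (simp add: field_simps)
  with k(3) show False by simp
qed

end
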